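(* Let $\varepsilon\in\{1,-1\}$, $\varepsilon b>0$, $\kappa\in\{1,-1\}$, $a=\kappa\,\mathrm{i}/2$, and $\tilde c_1\in\mathbb{C}$. Let $u(\tau)$ be the solution of $$u''(\tau)=\frac{(u'(\tau))^2}{u(\tau)}-\frac{u'(\tau)}{\tau}+\frac1\tau\left(-8\varepsilon (u(\tau))^2+2ab\right)+\frac{b^2}{u(\tau)}$$ defined by the expansion at $\tau=0$ $$u(\tau)=-\frac{b\tau}{2a}\left(\tilde c_0+\tilde c_1\tau+\sum_{m=2}^\infty\tilde c_m\tau^m\right),\qquad \tilde c_0=1,$$ where, for $m\geqslant2$, $$(m^2-1)\tilde c_m=\sum_{k=0}^{m-2}(k+2)(m-2(k+1))\tilde c_{k+1}\tilde c_{m-k-1}-8\kappa\varepsilon b\,\mathrm{i}\sum_{k=0}^{m-2}\sum_{l=0}^{k}\tilde c_{m-k-2}\tilde c_l\tilde c_{k-l}.$$ Put $X:=\dfrac{\sqrt{\pi}\,\tilde c_1}{2^{3/2}(\varepsilon b)^{1/2}}$. Then the monodromy data $(a,s_0^0,s_0^\infty,s_1^\infty,g_{11},g_{12},g_{21},g_{22})$ of $u(\tau)$ (defined in the context) satisfy the following. (i) If $a=\mathrm{i}/2$, then $$s_0^0=s_1^\infty=0,\quad s_0^\infty g_{12}^2=X\mathrm{e}^{\mathrm{i}\pi/4},\quad g_{22}=-g_{12}\neq0,$$ $$\mathrm{i}g_{12}g_{11}=-\tfrac{\mathrm{i}}{2}\bigl(1+X\mathrm{e}^{\mathrm{i}\pi/4}\bigr),\quad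 \mathrm{i}g_{21}g_{22}=\tfrac{\mathrm{i}}{2}\bigl(1-X\mathrm{e}^{\mathrm{i}\pi/4}\bigr),$$ $$g_{11}g_{22}=\tfrac12\bigl(1+X\mathrm{e}^{\mathrm{i}\pi/4}\bigr),\quad g_{12}g_{21}=-\tfrac12\bigl(1-X\mathrm{e}^{\mathrm{i}\pi/4}\bigr).$$ (ii) If $a=-\mathrm{i}/2$, then $$s_0^0=s_0^\infty=0,\quad s_1^\infty g_{21}^2=X\mathrm{e}^{-\mathrm{i}\pi/4},\quad g_{11}=-g_{21}\neq0,$$ $$\mathrm{i}g_{12}g_{11}=\tfrac{\mathrm{i}}{2}\bigl(1-X\mathrm{e}^{-\mathrm{i}\pi/4}\bigr),\quad \mathrm{i}g_{21}g_{22}=-\tfrac{\mathrm{i}}{2}\bigl(1+X\mathrm{e}^{-\mathrm{i}\pi/4}\bigr),$$ $$g_{11}g_{22}=\tfrac12\bigl(1+X\mathrm{e}^{-\mathrm{i}\pi/4}\bigr),\quad g_{12}g_{21}=-\tfrac12\bigl(1-X\mathrm{e}^{-\mathrm{i}\pi/4}\bigr).$$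
   Context: Definition of the monodromy data. Let $u(\tau)$ solve the differential equation in the claim, let $\tau$ range over an interval $(0,\tau_0)$ on which $u$ has neither zeros nor poles, and let $\varphi(\tau)$ be any solution of $\varphi'(\tau)=\frac{2a}{\tau}+\frac{b}{u(\tau)}$ there. Put $$A=\frac{u}{\tau}\mathrm{e}^{\mathrm{i}\varphi},\qquad B=-\frac{u}{\tau}\mathrm{e}^{-\mathrm{i}\varphi},\qquad \sqrt{-AB}:=\frac{\varepsilon u}{\tau},\qquad D=-\frac{B'(\tau)}{4\sqrt{-AB}},\qquad \alpha=\frac{\mathrm{i}\varepsilon b}{B}.$$ With the Pauli matrices $\sigma_1=\begin{pmatrix}0&1\\ 1&0\end{pmatrix}$, $\sigma_3=\begin{pmatrix}1&0\\ 0&-1\end{pmatrix}$, and $\lambda^{\sigma_3}:=\mathrm{diag}(\lambda,\lambda^{-1})$, consider the pair of linear systems $\partial_\mu\Psi=\mathcal{U}\Psi$, $\partial_\tau\Psi=\mathcal{V}\Psi$, where $$\mathcal{U}=-2\mathrm{i}\tau\mu\sigma_3+2\tau\begin{pmatrix}0&\frac{2\mathrm{i}A}{\sqrt{-AB}}\\ -D&0\end{pmatrix}-\frac1\mu\left(\mathrm{i}a+\frac12+\frac{2\tau AD}{\sqrt{-AB}}\right)\sigma_3+\frac1{\mu^2}\begin{pmatrix}0&\alpha\\ \mathrm{i}\tau B&0\end{pmatrix},$$ $$\mathcal{V}=-\mathrm{i}\mu^2\sigma_3+\mu\begin{pmatrix}0&\frac{2\mathrm{i}A}{\sqrt{-AB}}\\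 -D&0\end{pmatrix}+\left(\frac{\mathrm{i}a}{2\tau}-\frac{AD}{\sqrt{-AB}}\right)\sigma_3-\frac1{2\tau\mu}\begin{pmatrix}0&\alpha\\ \mathrm{i}\tau B&0\end{pmatrix};$$ this pair is compatible because $u$ solves the differential equation. Canonical solutions of $\partial_\mu\Psi=\mathcal{U}\Psi$ (on the universal cover of $\mathbb{C}\setminus\{0\}$), for $k\in\mathbb{Z}$ and $\tau>0$: $Y_k^\infty(\mu)$ is the solution with $$Y_k^\infty(\mu)=\bigl(I+\mathcal{O}(\mu^{-1})\bigr)\exp\bigl(-\mathrm{i}(\tau\mu^2+(a-\mathrm{i}/2)\ln\mu)\sigma_3\bigr),\quad \mu\to\infty,\ -\tfrac{\pi}{2}+\tfrac{\pi k}{2}<\arg\mu<\tfrac{\pi}{2}+\tfrac{\pi k}{2},$$ and $X_k^0(\mu)$ is the solution with $$X_k^0(\mu)=\Psi_0(\tau)\bigl(I+\mathcal{O}(\mu)\bigr)\exp\bigl(-\mathrm{i}\sqrt{\tau\varepsilon b}\,\sigma_3/\mu\bigr),\quad \mu\to0,\ -\pi+\pi k<\arg\mu<\pi+\pi k,$$ $$\Psi_0(\tau)=\frac{\mathrm{i}}{\sqrt2}\left(\frac{(\varepsilon b)^{1/4}}{\tau^{1/4}\sqrt{B(\tau)}}\right)^{\sigma_3}(\sigma_1+\sigma_3).$$ The Stokes multipliers $s_0^\infty,s_1^\infty,s_0^0$ are defined by $$Y_1^\infty=Y_0^\infty\begin{pmatrix}1&0\\ {s_0^\infty}&1\end{pmatrix},\qquad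 Y_2^\infty=Y_1^\infty\begin{pmatrix}1&s_1^\infty\\ 0&1\end{pmatrix},\qquad X_1^0=X_0^0\begin{pmatrix}1&s_0^0\\ 0&1\end{pmatrix},$$ and the connection matrix $G=(g_{ij})$ by $Y_0^\infty(\mu)=X_0^0(\mu)G$. These quantities do not depend on $\tau$. The branch of $\sqrt{B(\tau)}$ may be chosen arbitrarily; changing it replaces $G$ by $-G$. Changing the integration constant in $\varphi$ does not affect any of the quantities appearing in the claim. The data satisfy $$s_0^\infty s_1^\infty=-1-\mathrm{e}^{-2\pi a}-\mathrm{i}s_0^0\mathrm{e}^{-\pi a},\quad g_{21}g_{22}-g_{11}g_{12}+s_0^0g_{11}g_{22}=\mathrm{i}\mathrm{e}^{-\pi a},$$ $$g_{11}^2-g_{21}^2-s_0^0g_{11}g_{21}=\mathrm{i}s_0^\infty\mathrm{e}^{-\pi a},\quad g_{22}^2-g_{12}^2+s_0^0g_{12}g_{22}=\mathrm{i}s_1^\infty\mathrm{e}^{\pi a},\quad g_{11}g_{22}-g_{12}g_{21}=1.$$ The power series in the claim has a positive radius of convergence, so it does define a solution $u(\tau)$. $(\varepsilon b)^{1/2}$ and $(\varepsilon b)^{1/4}$ denote positive roots. *)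

theory Defs
  imports "HOL-Analysis.Analysis" "HOL-Library.Landau_Symbols"
begin

definition mat2 :: "complex \<Rightarrow> complex \<Rightarrow> complex \<Rightarrow> complex \<Rightarrow> complex^2^2" where
  "mat2 p q r s = vector [vector [p, q], vector [r, s]]"

definition cscale :: "complex \<Rightarrow> complex^2^2 \<Rightarrow> complex^2^2"  (infixr "*\<^sub>c" 75) where
  "c *\<^sub>c M = map_matrix ((*) c) M"

definition sigma1 :: "complex^2^2" where "sigma1 = mat2 0 1 1 0"

definition sigma3 :: "complex^2^2" where "sigma3 = mat2 1 0 0 (-1)"

definition pow_sigma3 :: "complex \<Rightarrow> complex^2^2" where
  "pow_sigma3 z = mat2 z 0 0 (inverse z)"

text \<open>The matrix exponential of \<open>z \<sigma>\<^sub>3\<close>.\<close>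

definition exp_sigma3 :: "complex \<Rightarrow> complex^2^2" where
  "exp_sigma3 z = pow_sigma3 (exp z)"

text \<open>A solution on \<open>(0,\<tau>\<^sub>0)\<close> without zeros or poles.  The independent variable is real,
  the values are complex.\<close>

definition dp3_solution :: "real \<Rightarrow> complex \<Rightarrow> real \<Rightarrow> real \<Rightarrow> (real \<Rightarrow> complex) \<Rightarrow> bool" where
  "dp3_solution \<epsilon> a b \<tau>\<^sub>0 u \<longleftrightarrow>
     (\<exists>u' u''. \<forall>\<tau>\<in>{0<..<\<tau>\<^sub>0}.
        u \<tau> \<noteq> 0 \<and>
        (u has_vector_derivative u' \<tau>) (at \<tau>) \<and>
        (u' has_vector_derivative u'' \<tau>) (at \<tau>) \<and>
        u'' \<tau> = (u' \<tau>)\<^sup>2 / u \<tau> - u' \<tau> / of_real \<tau>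
                 + 1 / of_real \<tau> * (- 8 * of_real \<epsilon> * (u \<tau>)\<^sup>2 + 2 * a * of_real b)
                 + (of_real b)\<^sup>2 / u \<tau>)"

definition phase_of ::
    "complex \<Rightarrow> real \<Rightarrow> real \<Rightarrow> (real \<Rightarrow> complex) \<Rightarrow> (real \<Rightarrow> complex) \<Rightarrow> bool" where
  "phase_of a b \<tau>\<^sub>0 u \<phi> \<longleftrightarrow>
     (\<forall>\<tau>\<in>{0<..<\<tau>\<^sub>0}.
        (\<phi> has_vector_derivative (2 * a / of_real \<tau> + of_real b / u \<tau>)) (at \<tau>))"

definition A_fun :: "(real \<Rightarrow> complex) \<Rightarrow> (real \<Rightarrow> complex) \<Rightarrow> real \<Rightarrow> complex" where
  "A_fun u \<phi> \<tau> = u \<tau> / of_real \<tau> * exp (\<i> * \<phi> \<tau>)"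

definition B_fun :: "(real \<Rightarrow> complex) \<Rightarrow> (real \<Rightarrow> complex) \<Rightarrow> real \<Rightarrow> complex" where
  "B_fun u \<phi> \<tau> = - (u \<tau> / of_real \<tau>) * exp (- \<i> * \<phi> \<tau>)"

text \<open>The branch of the square root of \<open>-AB = (u/\<tau>)\<^sup>2\<close>.\<close>

definition sqrtmAB :: "real \<Rightarrow> (real \<Rightarrow> complex) \<Rightarrow> real \<Rightarrow> complex" where
  "sqrtmAB \<epsilon> u \<tau> = of_real \<epsilon> * u \<tau> / of_real \<tau>"

definition D_fun :: "real \<Rightarrow> (real \<Rightarrow> complex) \<Rightarrow> (real \<Rightarrow> complex) \<Rightarrow> real \<Rightarrow> complex" where
  "D_fun \<epsilon> u \<phi> \<tau> = - vector_derivative (B_fun u \<phi>) (at \<tau>) / (4 * sqrtmAB \<epsilon> u \<tau>)"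

definition alpha_fun ::
    "real \<Rightarrow> real \<Rightarrow> (real \<Rightarrow> complex) \<Rightarrow> (real \<Rightarrow> complex) \<Rightarrow> real \<Rightarrow> complex" where
  "alpha_fun \<epsilon> b u \<phi> \<tau> = \<i> * of_real \<epsilon> * of_real b / B_fun u \<phi> \<tau>"

definition U_mat ::
    "real \<Rightarrow> complex \<Rightarrow> real \<Rightarrow> (real \<Rightarrow> complex) \<Rightarrow> (real \<Rightarrow> complex) \<Rightarrow> real \<Rightarrow> complex \<Rightarrow> complex^2^2"
  where
  "U_mat \<epsilon> a b u \<phi> \<tau> \<mu> =
     (let A = A_fun u \<phi> \<tau>; B = B_fun u \<phi> \<tau>; R = sqrtmAB \<epsilon> u \<tau>;
          D = D_fun \<epsilon> u \<phi> \<tau>; \<alpha> = alpha_fun \<epsilon> b u \<phi> \<tau>; t = complex_of_real \<tau>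
      in (- 2 * \<i> * t * \<mu>) *\<^sub>c sigma3
         + (2 * t) *\<^sub>c mat2 0 (2 * \<i> * A / R) (- D) 0
         - (1 / \<mu> * (\<i> * a + 1 / 2 + 2 * t * A * D / R)) *\<^sub>c sigma3
         + (1 / \<mu>\<^sup>2) *\<^sub>c mat2 0 \<alpha> (\<i> * t * B) 0)"

text \<open>
  The universal cover of the punctured plane is parametrised by \<open>\<zeta> = ln \<mu>\<close>, so \<open>\<mu> = exp \<zeta>\<close>,
  \<open>arg \<mu> = Im \<zeta>\<close> and \<open>\<bar>\<mu>\<bar> = exp (Re \<zeta>)\<close>.  In this variable the equation
  \<open>\<partial>\<^sub>\<mu>\<Psi> = U \<Psi>\<close> becomes \<open>\<partial>\<^sub>\<zeta>\<Psi> = \<mu> U \<Psi>\<close>.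
\<close>

definition mu_solution ::
    "real \<Rightarrow> complex \<Rightarrow> real \<Rightarrow> (real \<Rightarrow> complex) \<Rightarrow> (real \<Rightarrow> complex) \<Rightarrow> real
      \<Rightarrow> (complex \<Rightarrow> complex^2^2) \<Rightarrow> bool" where
  "mu_solution \<epsilon> a b u \<phi> \<tau> \<Psi> \<longleftrightarrow>
     (\<forall>\<zeta> i j. ((\<lambda>z. \<Psi> z $ i $ j) has_field_derivative
                (exp \<zeta> *\<^sub>c (U_mat \<epsilon> a b u \<phi> \<tau> (exp \<zeta>) ** \<Psi> \<zeta>)) $ i $ j) (at \<zeta>))"

text \<open>\<open>\<mu> \<rightarrow> \<infinity>\<close> and \<open>\<mu> \<rightarrow> 0\<close>, uniformly in the closed sector \<open>\<theta>\<^sub>1 \<le> arg \<mu> \<le> \<theta>\<^sub>2\<close>.\<close>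

definition sector_at_infinity :: "real \<Rightarrow> real \<Rightarrow> complex filter" where
  "sector_at_infinity \<theta>\<^sub>1 \<theta>\<^sub>2 =
     inf (filtercomap Re at_top) (principal {\<zeta>. \<theta>\<^sub>1 \<le> Im \<zeta> \<and> Im \<zeta> \<le> \<theta>\<^sub>2})"

definition sector_at_zero :: "real \<Rightarrow> real \<Rightarrow> complex filter" where
  "sector_at_zero \<theta>\<^sub>1 \<theta>\<^sub>2 =
     inf (filtercomap Re at_bot) (principal {\<zeta>. \<theta>\<^sub>1 \<le> Im \<zeta> \<and> Im \<zeta> \<le> \<theta>\<^sub>2})"

text \<open>
  An asymptotic relation in an open sector means, as usual, that the estimate is uniform in
  every closed subsector.  On the full open sector it would in general fail, because the rays
  bounding these (maximal) sectors are the oscillatory ones.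
\<close>

definition canonical_inf ::
    "real \<Rightarrow> complex \<Rightarrow> real \<Rightarrow> (real \<Rightarrow> complex) \<Rightarrow> (real \<Rightarrow> complex) \<Rightarrow> real \<Rightarrow> int
      \<Rightarrow> (complex \<Rightarrow> complex^2^2) \<Rightarrow> bool" where
  "canonical_inf \<epsilon> a b u \<phi> \<tau> k Y \<longleftrightarrow>
     mu_solution \<epsilon> a b u \<phi> \<tau> Y \<and>
     (\<exists>R. (\<forall>\<zeta>. Y \<zeta> = (mat 1 + R \<zeta>) **
                 exp_sigma3 (- \<i> * (of_real \<tau> * (exp \<zeta>)\<^sup>2 + (a - \<i> / 2) * \<zeta>))) \<and>
          (\<forall>\<theta>\<^sub>1 \<theta>\<^sub>2. - pi / 2 + pi * of_int k / 2 < \<theta>\<^sub>1 \<and> \<theta>\<^sub>2 < pi / 2 + pi * of_int k / 2 \<longrightarrow>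
             (\<forall>i j. (\<lambda>\<zeta>. R \<zeta> $ i $ j) \<in> O[sector_at_infinity \<theta>\<^sub>1 \<theta>\<^sub>2](\<lambda>\<zeta>. inverse (exp \<zeta>)))))"

text \<open>\<open>q\<close> stands for the chosen value of the square root of \<open>B(\<tau>)\<close>.\<close>

definition Psi0 :: "real \<Rightarrow> real \<Rightarrow> real \<Rightarrow> complex \<Rightarrow> complex^2^2" where
  "Psi0 \<epsilon> b \<tau> q =
     (\<i> / of_real (sqrt 2)) *\<^sub>c
       (pow_sigma3 (of_real (root 4 (\<epsilon> * b)) / (of_real (root 4 \<tau>) * q)) ** (sigma1 + sigma3))"

definition canonical_zero ::
    "real \<Rightarrow> complex \<Rightarrow> real \<Rightarrow> (real \<Rightarrow> complex) \<Rightarrow> (real \<Rightarrow> complex) \<Rightarrow> real \<Rightarrow> complex \<Rightarrow> int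
      \<Rightarrow> (complex \<Rightarrow> complex^2^2) \<Rightarrow> bool" where
  "canonical_zero \<epsilon> a b u \<phi> \<tau> q k X \<longleftrightarrow>
     mu_solution \<epsilon> a b u \<phi> \<tau> X \<and>
     (\<exists>R. (\<forall>\<zeta>. X \<zeta> = Psi0 \<epsilon> b \<tau> q ** (mat 1 + R \<zeta>) **
                 exp_sigma3 (- \<i> * of_real (sqrt (\<tau> * \<epsilon> * b)) / exp \<zeta>)) \<and>
          (\<forall>\<theta>\<^sub>1 \<theta>\<^sub>2. - pi + pi * of_int k < \<theta>\<^sub>1 \<and> \<theta>\<^sub>2 < pi + pi * of_int k \<longrightarrow>
             (\<forall>i j. (\<lambda>\<zeta>. R \<zeta> $ i $ j) \<in> O[sector_at_zero \<theta>\<^sub>1 \<theta>\<^sub>2](exp))))"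

text \<open>
  The Stokes multipliers \<open>s00\<close>, \<open>sinf0\<close>, \<open>sinf1\<close> (for \<open>s\<^sub>0\<^sup>0\<close>, \<open>s\<^sub>0\<^sup>\<infinity>\<close>, \<open>s\<^sub>1\<^sup>\<infinity>\<close>) and the connection
  matrix \<open>G\<close> read off at the point \<open>\<tau>\<close>, for some choice of the sign of the root of \<open>B(\<tau>)\<close>.
\<close>

definition monodromy_data ::
    "real \<Rightarrow> complex \<Rightarrow> real \<Rightarrow> (real \<Rightarrow> complex) \<Rightarrow> (real \<Rightarrow> complex) \<Rightarrow> real
      \<Rightarrow> complex \<Rightarrow> complex \<Rightarrow> complex \<Rightarrow> complex^2^2 \<Rightarrow> bool" where
  "monodromy_data \<epsilon> a b u \<phi> \<tau> s00 sinf0 sinf1 G \<longleftrightarrow>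
     (\<exists>q Y0 Y1 Y2 X0 X1.
        q\<^sup>2 = B_fun u \<phi> \<tau> \<and>
        canonical_inf \<epsilon> a b u \<phi> \<tau> 0 Y0 \<and>
        canonical_inf \<epsilon> a b u \<phi> \<tau> 1 Y1 \<and>
        canonical_inf \<epsilon> a b u \<phi> \<tau> 2 Y2 \<and>
        canonical_zero \<epsilon> a b u \<phi> \<tau> q 0 X0 \<and>
        canonical_zero \<epsilon> a b u \<phi> \<tau> q 1 X1 \<and>
        (\<forall>\<zeta>. Y1 \<zeta> = Y0 \<zeta> ** mat2 1 0 sinf0 1) \<and>
        (\<forall>\<zeta>. Y2 \<zeta> = Y1 \<zeta> ** mat2 1 sinf1 0 1) \<and>
        (\<forall>\<zeta>. X1 \<zeta> = X0 \<zeta> ** mat2 1 s00 0 1) \<and>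
        (\<forall>\<zeta>. Y0 \<zeta> = X0 \<zeta> ** G))"

end

theory Submission
  imports Defs "HOL-Complex_Analysis.Cauchy_Integral_Theorem" "HOL-Probability.Distributions"
begin

text \<open>
  In the variable \<open>x = \<surd>\<tau> \<mu>\<close> the expansion of \<open>u\<close> makes the (gauged) Lax pair regular at \<open>\<tau> = 0\<close>: along
  fixed \<open>x\<close> solutions satisfy \<open>\<partial>\<^sub>\<tau> \<Omega> = - x\<^sup>-\<^sup>1 Q(\<tau>) \<Omega>\<close> with a continuous off-diagonal \<open>Q\<close> whose
  determinant is the constant \<open>\<epsilon> b\<close>.  The fundamental solution \<open>H(\<tau>, 1/x)\<close> with \<open>H(0) = I\<close> is entire in
  \<open>1/x\<close>, and compatibility means that it carries the \<open>x\<close>-equation at \<open>0\<close> to the one at \<open>\<tau>\<close>.  The former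
  is triangular and solved by a Gaussian integral with the coefficient \<open>c 1\<close>.  Since \<open>H \<rightarrow> I\<close> as
  \<open>x \<rightarrow> \<infinity>\<close>, the Stokes data at infinity are those of the triangular equation.  Since \<open>Q\<close> has the
  imaginary eigenvalues \<open>\<plusminus>\<i>\<surd>(\<epsilon> b)\<close>, \<open>H\<close> only oscillates as \<open>x \<rightarrow> 0\<close> along both real rays, and its WKB
  limit there compares the triangular equation with the canonical solutions at \<open>\<mu> = 0\<close>.
\<close>

section \<open>Preliminaries\<close>

text \<open>A column of a canonical solution is reduced to two constants, its coordinates in a
  fundamental system of the triangular equation. Stokes and connection relations then become linear
  equations between such pairs. Each pair is read off along single rays: at infinity one ray on
  which both exponentials oscillate and one on which the wanted exponential decays, at zero a real
  ray. Two obstacles shape the details. The coefficient \<open>n1 / t\<close> is singular at the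
  left endpoint, so its regularity there has to be extracted from the nonlinear system itself. The
  WKB limit produces a square root of an entry of Q, so it is stated for squares; constancy of
  determinants then restores the relative sign of the two columns, and the sign that remains is the
  freedom in the root of B. The factor sqrt pi / 2^(3/2) in X is the half-line integral of exp(-2
  s^2). The number c 1 enters through the limit of (u' - i \<kappa> b) / u, which is 2 c 1 and
  carries the off-diagonal entry that survives at \<tau> = 0.\<close>

lemma bounded_by_on_interval:
  fixes f :: "real \<Rightarrow> complex"
  assumes "continuous_on {0..T} f"
  shows "\<exists>B\<ge>0. \<forall>t\<in>{0..T}. norm (f t) \<le> B"
proof -
  have "bounded (f ` {0..T})"
    by (intro compact_imp_bounded compact_continuous_image assms compact_Icc)
  then obtain B where "\<forall>t\<in>{0..T}. norm (f t) \<le> B" unfolding bounded_iff by blast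
  then have "\<forall>t\<in>{0..T}. norm (f t) \<le> max 0 B" by (auto simp: le_max_iff_disj)
  then show ?thesis by (intro exI[of _ "max 0 B"]) auto
qed

text \<open>A mean value estimate with the derivative required only in the open interval: the
  coefficients used later are merely continuous at the singular point 0.\<close>

lemma norm_increment_bound:
  fixes f :: "real \<Rightarrow> complex"
  assumes cont: "continuous_on {0..T} f"
    and der: "\<And>t. t \<in> {0<..<T} \<Longrightarrow> (f has_vector_derivative f' t) (at t)"
    and bd: "\<And>t. t \<in> {0<..<T} \<Longrightarrow> norm (f' t) \<le> C"
    and t: "t \<in> {0..T}"
  shows "norm (f t - f 0) \<le> C * t"
proof (cases "t = 0")
  case False
  then have "0 < t" using t by simp
  moreover have "continuous_on {0..t} f"
    using t by (intro continuous_on_subset[OF cont]) auto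
  ultimately have "\<exists>x\<in>{0<..<t}. norm (f t - f 0) \<le> norm ((t - 0) *\<^sub>R f' x)"
    using der t by (intro mvt_general) (auto simp: has_vector_derivative_def)
  then obtain x where x: "x \<in> {0<..<t}" "norm (f t - f 0) \<le> t * norm (f' x)"
    using \<open>0 < t\<close> by auto
  have "t * norm (f' x) \<le> t * C"
    using x t \<open>0 < t\<close> bd by (intro mult_left_mono) auto
  then show ?thesis using x(2) by (simp add: mult.commute)
qed simp

lemma constant_if_derivative_zero:
  fixes f :: "real \<Rightarrow> complex"
  assumes "continuous_on {0..T} f"
    and "\<And>t. t \<in> {0<..<T} \<Longrightarrow> (f has_vector_derivative 0) (at t)"
    and "t \<in> {0..T}"
  shows "f t = f 0"
  using norm_increment_bound[of T f "\<lambda>_. 0" 0 t] assms by simp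

lemma series_continuous_on:
  fixes f :: "nat \<Rightarrow> real \<Rightarrow> complex"
  assumes cont: "\<And>n. continuous_on S (f n)"
    and bd: "\<And>n t. t \<in> S \<Longrightarrow> norm (f n t) \<le> B n"
    and "summable B"
  shows "continuous_on S (\<lambda>t. \<Sum>n. f n t)"
proof (rule uniform_limit_theorem)
  show "uniform_limit S (\<lambda>n t. \<Sum>i<n. f i t) (\<lambda>t. \<Sum>n. f n t) sequentially"
    by (rule Weierstrass_m_test[OF bd assms(3)])
  show "\<forall>\<^sub>F n in sequentially. continuous_on S (\<lambda>t. \<Sum>i<n. f i t)"
    by (intro always_eventually allI continuous_on_sum cont)
qed simp

text \<open>Termwise differentiation: the majorant \<open>B'\<close> makes the derivative series
  converge uniformly, and \<open>B\<close> provides the convergence of the series itself.\<close>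

lemma series_has_vector_derivative:
  fixes f :: "nat \<Rightarrow> real \<Rightarrow> complex"
  assumes der: "\<And>n t. t \<in> {0<..<T} \<Longrightarrow> (f n has_vector_derivative f' n t) (at t)"
    and bd: "\<And>n t. t \<in> {0<..<T} \<Longrightarrow> norm (f n t) \<le> B n"
    and bd': "\<And>n t. t \<in> {0<..<T} \<Longrightarrow> norm (f' n t) \<le> B' n"
    and B: "summable B" "summable B'"
    and t: "t \<in> {0<..<T}"
  shows "((\<lambda>t. \<Sum>n. f n t) has_vector_derivative (\<Sum>n. f' n t)) (at t)"
proof -
  have ul: "uniform_limit {0<..<T} (\<lambda>n t. \<Sum>i<n. f' i t) (\<lambda>t. \<Sum>n. f' n t) sequentially"
    by (rule Weierstrass_m_test[OF bd' B(2)])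
  have sm: "summable (\<lambda>n. f n s)" if "s \<in> {0<..<T}" for s
    using bd[OF that] by (intro summable_comparison_test'[OF B(1), of 0])
  have "\<exists>g. \<forall>x\<in>{0<..<T}. (\<lambda>n. f n x) sums (g x) \<and>
      (g has_derivative (\<lambda>h. h *\<^sub>R (\<Sum>n. f' n x))) (at x within {0<..<T})"
  proof (rule has_derivative_series[where f' = "\<lambda>n x h. h *\<^sub>R f' n x" and f = f and x = t])
    show "(f n has_derivative (\<lambda>h. h *\<^sub>R f' n x)) (at x within {0<..<T})" if "x \<in> {0<..<T}" for n x
      using der[OF that] unfolding has_vector_derivative_def by (rule has_derivative_at_withinI)
    show "\<forall>\<^sub>F n in sequentially. \<forall>x\<in>{0<..<T}. \<forall>h.
        norm ((\<Sum>i<n. h *\<^sub>R f' i x) - h *\<^sub>R (\<Sum>n. f' n x)) \<le> e * norm h" if "e > 0" for e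
      using uniform_limitD[OF ul that]
    proof eventually_elim
      case (elim n)
      show ?case
      proof (intro ballI allI)
        fix x h assume "x \<in> {0<..<T}"
        then have "norm ((\<Sum>i<n. f' i x) - (\<Sum>n. f' n x)) \<le> e"
          using elim by (simp add: dist_norm less_imp_le)
        then have "\<bar>h\<bar> * norm ((\<Sum>i<n. f' i x) - (\<Sum>n. f' n x)) \<le> \<bar>h\<bar> * e"
          by (rule mult_left_mono) simp
        then show "norm ((\<Sum>i<n. h *\<^sub>R f' i x) - h *\<^sub>R (\<Sum>n. f' n x)) \<le> e * norm h"
          by (simp add: scaleR_sum_right[symmetric] scaleR_diff_right[symmetric] mult.commute)
      qed
    qed
    show "(\<lambda>n. f n t) sums (\<Sum>n. f n t)" using sm t by (simp add: summable_sums)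
    show "t \<in> {0<..<T}" by (fact t)
  qed (rule convex_real_interval)
  then obtain g where g: "\<forall>x\<in>{0<..<T}. (\<lambda>n. f n x) sums (g x) \<and>
      (g has_derivative (\<lambda>h. h *\<^sub>R (\<Sum>n. f' n x))) (at x within {0<..<T})" ..
  then have "(g has_derivative (\<lambda>h. h *\<^sub>R (\<Sum>n. f' n t))) (at t within {0<..<T})"
    using t by blast
  then have *: "(g has_derivative (\<lambda>h. h *\<^sub>R (\<Sum>n. f' n t))) (at t)"
    unfolding at_within_open[OF t open_greaterThanLessThan] .
  have "((\<lambda>t. \<Sum>n. f n t) has_derivative (\<lambda>h. h *\<^sub>R (\<Sum>n. f' n t))) (at t)"
    by (rule has_derivative_transform_within_open[OF * open_greaterThanLessThan t])
       (use g in \<open>blast intro: sums_unique\<close>)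
  then show ?thesis by (simp add: has_vector_derivative_def)
qed

lemma constant_if_field_derivative_zero:
  fixes f :: "complex \<Rightarrow> complex"
  assumes "\<And>z. (f has_field_derivative 0) (at z)"
  shows "f z = f 0"
  using has_field_derivative_zero_constant[of UNIV f] assms by auto

text \<open>A bounded derivative gives a Lipschitz function, hence a uniformly continuous one, which
  extends to the closure by completeness. It yields the value of the phase \<phi> at the
  origin.\<close>

lemma bounded_derivative_limit_at_right:
  fixes f :: "real \<Rightarrow> complex"
  assumes d: "0 < d" and der: "\<And>t. t \<in> {0<..<d} \<Longrightarrow> (f has_vector_derivative f' t) (at t)"
    and bd: "\<And>t. t \<in> {0<..<d} \<Longrightarrow> norm (f' t) \<le> B"
  shows "\<exists>l. (f \<longlongrightarrow> l) (at_right 0)"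
proof -
  have lip: "B-lipschitz_on {0<..<d} f"
  proof (rule bounded_derivative_imp_lipschitz)
    show "(f has_derivative (\<lambda>h. h *\<^sub>R f' t)) (at t within {0<..<d})" if "t \<in> {0<..<d}" for t
      using der[OF that] unfolding has_vector_derivative_def by (rule has_derivative_at_withinI)
    have "0 \<le> B" using order_trans[OF norm_ge_zero bd[of "d / 2"]] d by simp
    then show "0 \<le> B" .
    fix t assume "t \<in> {0<..<d}"
    show "onorm (\<lambda>h. h *\<^sub>R f' t) \<le> B"
      using bd[OF \<open>t \<in> {0<..<d}\<close>] by (intro onorm_le) (simp add: mult.commute[of B] mult_left_mono)
  qed (rule convex_real_interval)
  have uc: "uniformly_continuous_on {0<..<d} f"
    using lip by (rule lipschitz_on_uniformly_continuous)
  have cl: "0 \<in> closure {0<..<d}" using d by simp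
  obtain l where l: "(f \<longlongrightarrow> l) (at 0 within {0<..<d})"
    using uniformly_continuous_on_extension_at_closure[OF uc cl] by blast
  have "at 0 within {0<..<d} = at_right 0"
    by (rule at_within_nhd[of _ "{..<d}"]) (use d in auto)
  with l show ?thesis by auto
qed

text \<open>The bracketed expressions are the components of the inverse of the unimodular matrix
  with rows \<open>(a, b)\<close> and \<open>(c, d)\<close>, applied to
  \<open>(v, w)\<close>.\<close>

lemma cramer:
  fixes a b c d v w :: complex
  assumes "a * d - b * c = 1"
  shows "v = a * (d * v - b * w) + b * (a * w - c * v)"
    and "w = c * (d * v - b * w) + d * (a * w - c * v)"
proof -
  have "a * (d * v - b * w) + b * (a * w - c * v) = (a * d - b * c) * v"
    "c * (d * v - b * w) + d * (a * w - c * v) = (a * d - b * c) * w"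
    by (simp_all add: algebra_simps)
  then show "v = a * (d * v - b * w) + b * (a * w - c * v)"
    "w = c * (d * v - b * w) + d * (a * w - c * v)"
    unfolding assms by simp_all
qed

lemma mat2_nth [simp]:
  "mat2 p q r s $ 1 $ 1 = p" "mat2 p q r s $ 1 $ 2 = q" "mat2 p q r s $ 2 $ 1 = r" "mat2 p q r s $ 2 $ 2 = s"
  by (simp_all add: mat2_def)

lemma cscale_nth [simp]: "(c *\<^sub>c M) $ i $ j = c * M $ i $ j"
  by (simp add: cscale_def map_matrix_def)

lemma matrix_mult_nth: "((A :: complex^2^2) ** B) $ i $ j = A $ i $ 1 * B $ 1 $ j + A $ i $ 2 * B $ 2 $ j"
  by (simp add: matrix_matrix_mult_def sum_2)

text \<open>A closed sector with equal bounding angles is a single ray. All asymptotic hypotheses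
  are evaluated on such degenerate sectors.\<close>

lemma filterlim_ray_infinity:
  "filterlim (\<lambda>r. complex_of_real r + \<i> * of_real \<theta>) (sector_at_infinity \<theta> \<theta>) at_top"
  unfolding sector_at_infinity_def
  by (simp add: filterlim_inf filterlim_filtercomap_iff filterlim_principal o_def filterlim_ident)

lemma filterlim_ray_zero:
  "filterlim (\<lambda>r. complex_of_real r + \<i> * of_real \<theta>) (sector_at_zero \<theta> \<theta>) at_bot"
  unfolding sector_at_zero_def
  by (simp add: filterlim_inf filterlim_filtercomap_iff filterlim_principal o_def filterlim_ident)

text \<open>The rate is kept, and not only the limit 0, because for \<open>\<kappa> = - 1\<close>
  the gauge multiplies one error entry by a growing power of \<mu>.\<close>

lemma bound_on_ray_infinity:
  assumes "f \<in> O[sector_at_infinity \<theta> \<theta>](\<lambda>\<zeta>. inverse (exp \<zeta>))"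
  shows "\<exists>C. \<forall>\<^sub>F r in at_top. norm (f (complex_of_real r + \<i> * of_real \<theta>)) \<le> C * exp (- r)"
proof -
  obtain C where "\<forall>\<^sub>F \<zeta> in sector_at_infinity \<theta> \<theta>. norm (f \<zeta>) \<le> C * norm (inverse (exp \<zeta>))"
    by (rule landau_o.bigE[OF assms]) (rule that)
  from eventually_compose_filterlim[OF this filterlim_ray_infinity]
  have "\<forall>\<^sub>F r in at_top. norm (f (complex_of_real r + \<i> * of_real \<theta>))
      \<le> C * norm (inverse (exp (complex_of_real r + \<i> * of_real \<theta>)))" .
  moreover have "norm (inverse (exp (complex_of_real r + \<i> * of_real \<theta>))) = exp (- r)" for r
    unfolding exp_minus[symmetric] norm_exp_eq_Re by simp
  ultimately show ?thesis by (simp only:) blast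
qed

lemma null_on_ray_infinity:
  assumes "f \<in> O[sector_at_infinity \<theta> \<theta>](\<lambda>\<zeta>. inverse (exp \<zeta>))"
  shows "((\<lambda>r. f (complex_of_real r + \<i> * of_real \<theta>)) \<longlongrightarrow> 0) at_top"
proof -
  obtain C where "\<forall>\<^sub>F r in at_top. norm (f (complex_of_real r + \<i> * of_real \<theta>)) \<le> C * exp (- r)"
    using bound_on_ray_infinity[OF assms] by blast
  moreover have "((\<lambda>r. C * exp (- r)) \<longlongrightarrow> C * 0) at_top"
    by (intro tendsto_mult tendsto_const filterlim_compose[OF exp_at_bot filterlim_uminus_at_bot_at_top])
  ultimately show ?thesis by - (rule Lim_null_comparison[of _ "\<lambda>r. C * exp (- r)"], simp_all)
qed

lemma null_on_ray_zero:
  assumes "f \<in> O[sector_at_zero \<theta> \<theta>](exp)"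
  shows "((\<lambda>r. f (complex_of_real r + \<i> * of_real \<theta>)) \<longlongrightarrow> 0) at_bot"
proof -
  obtain C where "\<forall>\<^sub>F \<zeta> in sector_at_zero \<theta> \<theta>. norm (f \<zeta>) \<le> C * norm (exp \<zeta>)"
    by (rule landau_o.bigE[OF assms]) (rule that)
  from eventually_compose_filterlim[OF this filterlim_ray_zero]
  have "\<forall>\<^sub>F r in at_bot. norm (f (complex_of_real r + \<i> * of_real \<theta>)) \<le> C * exp r" by simp
  moreover have "((\<lambda>r. C * exp r) \<longlongrightarrow> C * 0) at_bot"
    by (intro tendsto_intros exp_at_bot)
  ultimately show ?thesis by - (rule Lim_null_comparison[of _ "\<lambda>r. C * exp r"], simp_all)
qed

lemma times_exp_sigma3_nth [simp]:
  fixes M :: "complex^2^2"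
  shows "(M ** exp_sigma3 z) $ i $ 1 = M $ i $ 1 * exp z"
  "(M ** exp_sigma3 z) $ i $ 2 = M $ i $ 2 * exp (- z)"
  by (simp_all add: matrix_mult_nth exp_sigma3_def pow_sigma3_def exp_minus)

lemma mat_1_nth [simp]:
  "(mat 1 :: complex^2^2) $ 1 $ 1 = 1" "(mat 1 :: complex^2^2) $ 1 $ 2 = 0"
  "(mat 1 :: complex^2^2) $ 2 $ 1 = 0" "(mat 1 :: complex^2^2) $ 2 $ 2 = 1"
  by (simp_all add: mat_def)

text \<open>Here \<open>(v, r v)\<close> and \<open>(v, - r v)\<close> are the coordinate pairs of
  the two columns at zero, \<open>(t, Z t r)\<close> and \<open>(0, k / t)\<close> those of the two
  columns at infinity, and \<open>(x, y)\<close>, \<open>(x', y')\<close> the columns of the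
  connection matrix. The relation \<open>v\<^sup>2 * r = - 1 / 2\<close> eliminates \<open>r\<close>
  from the solution.\<close>

lemma connection_columns:
  fixes v t r Z x y x' y' k :: complex
  assumes v: "v\<^sup>2 * r = - 1 / 2" and t: "t \<noteq> 0"
    and dom: "v * x + v * y = t" "r * v * x + - r * v * y = Z * t * r"
    and rec: "v * x' + v * y' = 0" "r * v * x' + - r * v * y' = k / t"
  shows "x = t * (1 + Z) / (2 * v)" "y = t * (1 - Z) / (2 * v)" "x' = - k * v / t" "y' = k * v / t" "v \<noteq> 0"
proof -
  show v0: "v \<noteq> 0" using v by auto
  have r0: "r \<noteq> 0" using v by auto
  have "r * (v * (x - y)) = r * (Z * t)" using dom(2) by (simp add: algebra_simps)
  then have "v * (x - y) = Z * t" using r0 by simp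
  then have "v * (2 * x) = t * (1 + Z)" "v * (2 * y) = t * (1 - Z)"
  proof -
    assume *: "v * (x - y) = Z * t"
    have "v * (2 * x) = (v * x + v * y) + v * (x - y)" "v * (2 * y) = (v * x + v * y) - v * (x - y)"
      by (simp_all add: algebra_simps)
    then show "v * (2 * x) = t * (1 + Z)" "v * (2 * y) = t * (1 - Z)"
      unfolding dom(1) * by (simp_all add: algebra_simps)
  qed
  then show "x = t * (1 + Z) / (2 * v)" "y = t * (1 - Z) / (2 * v)"
    using v0 by (auto simp: field_simps)
  have "x' = - y'" using rec(1) v0 by (simp add: eq_neg_iff_add_eq_0 flip: distrib_left)
  then have "2 * (r * v) * y' = - (r * v * x' + - r * v * y')" by (simp add: algebra_simps)
  also have "\<dots> = - k / t" unfolding rec(2) by simp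
  finally have "2 * (r * v) * y' = - k / t" .
  then have "v * (2 * (r * v) * y') = v * (- k / t)" by simp
  then have "2 * (v\<^sup>2 * r) * y' = - k * v / t" by (simp add: power2_eq_square ac_simps)
  then show y: "y' = k * v / t" unfolding v by simp
  show "x' = - k * v / t" unfolding \<open>x' = - y'\<close> y by simp
qed

lemma exp_i_pi_half: "exp (\<i> * of_real pi / 2) = \<i>"
  using cis_pi_half by (simp add: cis_conv_exp)

section \<open>WKB estimate for an oscillating system\<close>

text \<open>The product of V with exp(-k t) has nonpositive derivative.\<close>

lemma gronwall:
  fixes V :: "real \<Rightarrow> real"
  assumes cont: "continuous_on {0..T} V"
    and der: "\<And>t. t \<in> {0<..<T} \<Longrightarrow> (V has_real_derivative V' t) (at t)"
    and le: "\<And>t. t \<in> {0<..<T} \<Longrightarrow> V' t \<le> k * V t"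
    and t: "t \<in> {0..T}"
  shows "V t \<le> V 0 * exp (k * t)"
proof -
  have "V t * exp (- k * t) \<le> V 0 * exp (- k * 0)"
  proof (rule DERIV_nonpos_imp_decreasing_open[where f = "\<lambda>t. V t * exp (- k * t)"])
    show "0 \<le> t" using t by simp
    show "continuous_on {0..t} (\<lambda>t. V t * exp (- k * t))"
      using t by (intro continuous_intros continuous_on_subset[OF cont]) auto
    fix s assume s: "0 < s" "s < t"
    then have s': "s \<in> {0<..<T}" using t by auto
    have "((\<lambda>t. exp (- k * t)) has_real_derivative - k * exp (- k * s)) (at s)"
      by (auto intro!: derivative_eq_intros)
    from DERIV_mult[OF der[OF s'] this]
    have "((\<lambda>t. V t * exp (- k * t)) has_real_derivative (V' s - k * V s) * exp (- k * s)) (at s)"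
      by (rule DERIV_cong) (simp add: algebra_simps)
    moreover have "(V' s - k * V s) * exp (- k * s) \<le> 0"
      using le[OF s'] by (intro mult_nonpos_nonneg) auto
    ultimately show "\<exists>y. ((\<lambda>t. V t * exp (- k * t)) has_real_derivative y) (at s) \<and> y \<le> 0"
      by blast
  qed
  then have "V t * exp (- k * t) * exp (k * t) \<le> V 0 * exp (k * t)"
    by (intro mult_right_mono) auto
  moreover have "exp (- k * t) * exp (k * t) = 1"
    unfolding mult_exp_exp by simp
  ultimately show ?thesis by (simp only: mult.assoc mult_1_right)
qed

lemma norm_square_deriv:
  fixes f :: "real \<Rightarrow> complex"
  assumes "(f has_vector_derivative f') (at t)"
  shows "((\<lambda>t. (norm (f t))\<^sup>2) has_real_derivative 2 * (f t \<bullet> f')) (at t)"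
  unfolding power2_norm_eq_inner has_field_derivative_def
  using has_derivative_inner[OF assms[unfolded has_vector_derivative_def] assms[unfolded has_vector_derivative_def]]
  by (rule has_derivative_eq_rhs) (auto simp: fun_eq_iff inner_commute)

lemma inner_mult_norm_le: "(x::complex) \<bullet> (m * y) \<le> norm x * norm m * norm y"
  using norm_cauchy_schwarz[of x "m * y"] by (simp add: norm_mult mult.assoc)

text \<open>Multiplication by an imaginary number is a rotation of the real plane. Therefore the
  large frequency drops out of all energy estimates and their constants do not depend on
  \<open>w\<close>.\<close>

lemma inner_imaginary_multiple: "(x::complex) \<bullet> (2 * \<i> * of_real w * x) = 0"
  by (simp add: inner_complex_def algebra_simps)

text \<open>The correction \<open>p - mE/(2i\<omega>)\<close> removes the leading oscillating term of \<open>p\<close>, so that no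
  integration by parts is needed.\<close>

lemma oscillating_system:
  fixes E p m m' r :: "real \<Rightarrow> complex" and w :: real
  assumes w: "w \<noteq> 0" and T: "0 < T" and M: "0 \<le> M" "0 \<le> M'" "0 \<le> R"
    and cont: "continuous_on {0..T} E" "continuous_on {0..T} p" "continuous_on {0..T} m"
      "continuous_on {0..T} r"
    and init: "E 0 = 1" "p 0 = 0"
    and dE: "\<And>t. t \<in> {0<..<T} \<Longrightarrow> (E has_vector_derivative m t * (E t - p t)) (at t)"
    and dp: "\<And>t. t \<in> {0<..<T} \<Longrightarrow>
      (p has_vector_derivative 2 * \<i> * of_real w * p t + m t * (p t - E t)) (at t)"
    and dm: "\<And>t. t \<in> {0<..<T} \<Longrightarrow> (m has_vector_derivative m' t) (at t)"
    and dr: "\<And>t. t \<in> {0<..<T} \<Longrightarrow> (r has_vector_derivative - 2 * m t * r t) (at t)"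
    and bd: "\<And>t. t \<in> {0..T} \<Longrightarrow> norm (m t) \<le> M" "\<And>t. t \<in> {0<..<T} \<Longrightarrow> norm (m' t) \<le> M'"
      "\<And>t. t \<in> {0..T} \<Longrightarrow> norm (r t) \<le> R"
    and A: "A = exp (2 * M * T)"
    and D: "D = (M' * A + 2 * M\<^sup>2 * A + M\<^sup>2 * A) / 2"
    and C: "C = (D + M / 2) * exp ((M + 1) * T) + M * A / 2"
  shows "norm (p T) \<le> C / \<bar>w\<bar>" "norm ((E T)\<^sup>2 * r T - r 0) \<le> 2 * M * A * C * R * T / \<bar>w\<bar>"
proof -
  have AD: "0 < A" "0 \<le> D" using M by (simp_all add: A D)
  \<comment> \<open>Energy estimate: \<open>m\<close> contributes at most 4 M times the energy, and
    the frequency term is orthogonal to \<open>p\<close>. Hence \<open>A\<close> bounds both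
    components uniformly in \<open>w\<close>.\<close>
  have S: "(norm (E t))\<^sup>2 + (norm (p t))\<^sup>2 \<le> A\<^sup>2" if t: "t \<in> {0..T}" for t
  proof -
    have "(norm (E t))\<^sup>2 + (norm (p t))\<^sup>2 \<le> ((norm (E 0))\<^sup>2 + (norm (p 0))\<^sup>2) * exp (4 * M * t)"
    proof (rule gronwall[OF _ _ _ t])
      show "continuous_on {0..T} (\<lambda>t. (norm (E t))\<^sup>2 + (norm (p t))\<^sup>2)"
        by (intro continuous_intros cont)
      fix s assume s: "s \<in> {0<..<T}"
      show "((\<lambda>t. (norm (E t))\<^sup>2 + (norm (p t))\<^sup>2) has_real_derivative
          2 * (E s \<bullet> (m s * (E s - p s))) +
          2 * (p s \<bullet> (2 * \<i> * of_real w * p s + m s * (p s - E s)))) (at s)"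
        by (intro DERIV_add norm_square_deriv dE dp s)
      let ?e = "norm (E s)" and ?p = "norm (p s)"
      have s': "s \<in> {0..T}" using s by simp
      have "E s \<bullet> (m s * (E s - p s)) \<le> ?e * norm (m s) * norm (E s - p s)"
        by (rule inner_mult_norm_le)
      also have "\<dots> \<le> ?e * M * (?e + ?p)"
        using bd(1)[OF s'] M by (intro mult_mono norm_triangle_ineq4) auto
      finally have 1: "E s \<bullet> (m s * (E s - p s)) \<le> ?e * M * (?e + ?p)" .
      have "p s \<bullet> (m s * (p s - E s)) \<le> ?p * norm (m s) * norm (p s - E s)"
        by (rule inner_mult_norm_le)
      also have "\<dots> \<le> ?p * M * (?p + ?e)"
        using bd(1)[OF s'] M by (intro mult_mono norm_triangle_ineq4) auto
      finally have 2: "p s \<bullet> (m s * (p s - E s)) \<le> ?p * M * (?p + ?e)" .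
      have "2 * (?e * M * (?e + ?p)) + 2 * (?p * M * (?p + ?e)) = 2 * M * (?e + ?p)\<^sup>2"
        by (simp add: power2_eq_square algebra_simps)
      also have "\<dots> \<le> 2 * M * (2 * (?e\<^sup>2 + ?p\<^sup>2))"
        using M(1) sum_squares_ge_zero[of "?e - ?p" 0]
        by (intro mult_left_mono) (auto simp: power2_eq_square algebra_simps)
      also have "\<dots> = 4 * M * (?e\<^sup>2 + ?p\<^sup>2)" by simp
      finally show "2 * (E s \<bullet> (m s * (E s - p s))) +
          2 * (p s \<bullet> (2 * \<i> * of_real w * p s + m s * (p s - E s)))
          \<le> 4 * M * (?e\<^sup>2 + ?p\<^sup>2)"
        using 1 2 inner_imaginary_multiple[of "p s" w] by (simp add: inner_add_right)
    qed
    also have "\<dots> \<le> exp (4 * M * T)"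
    proof -
      have "4 * M * t \<le> 4 * M * T" using t M(1) by (intro mult_left_mono) auto
      then show ?thesis unfolding init by simp
    qed
    also have "\<dots> = A\<^sup>2"
      unfolding A power2_eq_square mult_exp_exp by (rule arg_cong[where f = exp]) simp
    finally show ?thesis .
  qed
  have Ebd: "norm (E t) \<le> A" and pbd: "norm (p t) \<le> A" if t: "t \<in> {0..T}" for t
  proof -
    have "(norm (E t))\<^sup>2 \<le> A\<^sup>2" using S[OF t] zero_le_power2[of "norm (p t)"] by linarith
    then show "norm (E t) \<le> A" using AD(1) by (rule power2_le_imp_le[OF _ less_imp_le])
    have "(norm (p t))\<^sup>2 \<le> A\<^sup>2" using S[OF t] zero_le_power2[of "norm (E t)"] by linarith
    then show "norm (p t) \<le> A" using AD(1) by (rule power2_le_imp_le[OF _ less_imp_le])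
  qed
  define k where "k = 1 / (2 * \<i> * complex_of_real w)"
  have k: "2 * \<i> * of_real w * k = 1" "norm k = 1 / (2 * \<bar>w\<bar>)"
    using w by (simp_all add: k_def norm_mult norm_divide)
  define J where "J = (\<lambda>t. p t - k * (m t * E t))"
  \<comment> \<open>What remains of the derivative of \<open>J\<close> after the rotation.
    Expressing \<open>m p\<close> by \<open>m J\<close> leaves only terms with the factor
    \<open>k\<close>, which is of order 1 / w.\<close>
  define G where "G = (\<lambda>t. m t * J t + k * (m t * m t * E t - m' t * E t - m t * m t * (E t - p t)))"
  have dJ: "(J has_vector_derivative 2 * \<i> * of_real w * J t + G t) (at t)" if t: "t \<in> {0<..<T}" for t
  proof -
    have "(J has_vector_derivative
        (2 * \<i> * of_real w * p t + m t * (p t - E t)) - k * (m t * (m t * (E t - p t)) + m' t * E t)) (at t)"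
      unfolding J_def by (rule derivative_intros dE dp dm t)+
    moreover have "(2 * \<i> * of_real w * p t + m t * (p t - E t)) - k * (m t * (m t * (E t - p t)) + m' t * E t)
        = 2 * \<i> * of_real w * J t + G t"
    proof -
      have "2 * \<i> * of_real w * J t = 2 * \<i> * of_real w * p t - (2 * \<i> * of_real w * k) * (m t * E t)"
        by (simp add: J_def algebra_simps)
      then show ?thesis unfolding k by (simp add: G_def J_def algebra_simps)
    qed
    ultimately show ?thesis by simp
  qed
  have Gbd: "norm (G t) \<le> M * norm (J t) + D / \<bar>w\<bar>" if t: "t \<in> {0<..<T}" for t
  proof -
    have t': "t \<in> {0..T}" using t by simp
    have wkb_coeff: "norm (m t) * norm (m t) \<le> M\<^sup>2"
      unfolding power2_eq_square using bd(1)[OF t'] M by (intro mult_mono) auto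
    have "norm (E t - p t) \<le> 2 * A"
      using norm_triangle_ineq4[of "E t" "p t"] Ebd[OF t'] pbd[OF t'] by linarith
    then have 1: "norm (m t) * norm (m t) * norm (E t - p t) \<le> M\<^sup>2 * (2 * A)"
      using wkb_coeff AD by (intro mult_mono) auto
    have 2: "norm (m t) * norm (m t) * norm (E t) \<le> M\<^sup>2 * A"
      using wkb_coeff Ebd[OF t'] by (intro mult_mono) auto
    have 3: "norm (m' t) * norm (E t) \<le> M' * A"
      using bd(2)[OF t] Ebd[OF t'] M by (intro mult_mono) auto
    have D2: "2 * D = M' * A + M\<^sup>2 * A + M\<^sup>2 * (2 * A)" by (simp add: D)
    have "norm (m t * m t * E t - m' t * E t - m t * m t * (E t - p t)) \<le> 2 * D"
      using norm_triangle_ineq4[of "m t * m t * E t - m' t * E t" "m t * m t * (E t - p t)"]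
        norm_triangle_ineq4[of "m t * m t * E t" "m' t * E t"] 1 2 3 D2
      unfolding norm_mult by linarith
    then have "norm k * norm (m t * m t * E t - m' t * E t - m t * m t * (E t - p t)) \<le> norm k * (2 * D)"
      by (rule mult_left_mono) simp
    moreover have "norm (m t * J t) \<le> M * norm (J t)"
      using bd(1)[OF t'] by (simp add: norm_mult mult_right_mono)
    ultimately show ?thesis
      unfolding G_def using norm_triangle_ineq[of "m t * J t" "k * (m t * m t * E t - m' t * E t - m t * m t * (E t - p t))"]
      by (simp add: norm_mult k(2))
  qed
  have Jcont: "continuous_on {0..T} J" unfolding J_def by (intro continuous_intros cont)
  have Jbd: "norm (J t) \<le> (D + M / 2) / \<bar>w\<bar> * exp ((M + 1) * T)" if t: "t \<in> {0..T}" for t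
  proof -
    \<comment> \<open>Adding the constant \<open>?d\<close> squared to the energy of
      \<open>J\<close> turns the inhomogeneous differential inequality into one to which
      \<open>gronwall\<close> applies; the mixed term is absorbed by the inequality between
      arithmetic and geometric mean.\<close>
    let ?d = "D / \<bar>w\<bar>"
    have "(norm (J t))\<^sup>2 + ?d\<^sup>2 \<le> ((norm (J 0))\<^sup>2 + ?d\<^sup>2) * exp ((2 * M + 1) * t)"
    proof (rule gronwall[OF _ _ _ t])
      show "continuous_on {0..T} (\<lambda>t. (norm (J t))\<^sup>2 + ?d\<^sup>2)"
        by (intro continuous_intros Jcont)
      fix s assume s: "s \<in> {0<..<T}"
      show "((\<lambda>t. (norm (J t))\<^sup>2 + ?d\<^sup>2) has_real_derivative
          2 * (J s \<bullet> (2 * \<i> * of_real w * J s + G s)) + 0) (at s)"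
        by (intro DERIV_add norm_square_deriv dJ s DERIV_const)
      have "J s \<bullet> G s \<le> norm (J s) * norm (G s)" by (rule norm_cauchy_schwarz)
      also have "\<dots> \<le> norm (J s) * (M * norm (J s) + ?d)"
        using Gbd[OF s] by (rule mult_left_mono) simp
      finally have 1: "J s \<bullet> G s \<le> M * (norm (J s))\<^sup>2 + norm (J s) * ?d"
        by (simp add: power2_eq_square algebra_simps)
      have 2: "2 * (norm (J s) * ?d) \<le> (norm (J s))\<^sup>2 + ?d\<^sup>2"
        using sum_squares_bound[of "norm (J s)" ?d] by simp
      have 3: "0 \<le> M * ?d\<^sup>2" using M by simp
      show "2 * (J s \<bullet> (2 * \<i> * of_real w * J s + G s)) + 0 \<le> (2 * M + 1) * ((norm (J s))\<^sup>2 + ?d\<^sup>2)"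
      proof -
        have aux: "2 * g \<le> (2 * M + 1) * (x + y)"
          if "g \<le> M * x + c" "2 * c \<le> x + y" "0 \<le> M * y" for g x y c :: real
          using that by (simp add: algebra_simps)
        show ?thesis
          unfolding inner_add_right inner_imaginary_multiple using aux[OF 1 2 3] by simp
      qed
    qed
    also have "\<dots> \<le> ((norm (J 0))\<^sup>2 + ?d\<^sup>2) * exp (2 * ((M + 1) * T))"
    proof -
      have "(2 * M + 1) * t \<le> (2 * M + 2) * T" using t M by (intro mult_mono) auto
      then have "exp ((2 * M + 1) * t) \<le> exp (2 * ((M + 1) * T))" by (simp add: algebra_simps)
      then show ?thesis by (rule mult_left_mono) simp
    qed
    also have "\<dots> \<le> ((M / 2 / \<bar>w\<bar>)\<^sup>2 + ?d\<^sup>2) * exp (2 * ((M + 1) * T))"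
    proof -
      have "norm (J 0) \<le> M / 2 / \<bar>w\<bar>"
        using bd(1)[of 0] T by (simp add: J_def init norm_mult k(2) divide_right_mono)
      then show ?thesis by (simp add: power_mono)
    qed
    also have "\<dots> \<le> ((D + M / 2) / \<bar>w\<bar>)\<^sup>2 * exp (2 * ((M + 1) * T))"
    proof (rule mult_right_mono)
      have aux: "x + y \<le> y + x + z" if "0 \<le> z" for x y z :: real using that by simp
      show "(M / 2 / \<bar>w\<bar>)\<^sup>2 + ?d\<^sup>2 \<le> ((D + M / 2) / \<bar>w\<bar>)\<^sup>2"
        unfolding add_divide_distrib power2_sum by (rule aux) (use M AD in simp)
    qed simp
    also have "\<dots> = ((D + M / 2) / \<bar>w\<bar> * exp ((M + 1) * T))\<^sup>2"
      unfolding power_mult_distrib exp_double ..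
    finally have "(norm (J t))\<^sup>2 \<le> ((D + M / 2) / \<bar>w\<bar> * exp ((M + 1) * T))\<^sup>2"
      using zero_le_power2[of ?d] by linarith
    then show ?thesis by (rule power2_le_imp_le) (use AD M in simp)
  qed
  have pw: "norm (p t) \<le> C / \<bar>w\<bar>" if t: "t \<in> {0..T}" for t
  proof -
    have "norm (p t) \<le> norm (J t) + norm (k * (m t * E t))"
      using norm_triangle_ineq[of "J t" "k * (m t * E t)"] by (simp add: J_def)
    also have "norm (k * (m t * E t)) \<le> 1 / (2 * \<bar>w\<bar>) * (M * A)"
      unfolding norm_mult k using bd(1)[OF t] Ebd[OF t] M by (intro mult_left_mono mult_mono) auto
    finally have "norm (p t) \<le> (D + M / 2) / \<bar>w\<bar> * exp ((M + 1) * T) + 1 / (2 * \<bar>w\<bar>) * (M * A)"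
      using Jbd[OF t] by linarith
    moreover have "(D + M / 2) / \<bar>w\<bar> * exp ((M + 1) * T) + 1 / (2 * \<bar>w\<bar>) * (M * A) = C / \<bar>w\<bar>"
      using w by (simp add: C field_simps)
    ultimately show ?thesis by simp
  qed
  then show "norm (p T) \<le> C / \<bar>w\<bar>" using T by simp
  have C0: "0 \<le> C" using AD M by (simp add: C)
  \<comment> \<open>An adiabatic invariant: the equation for \<open>r\<close> cancels the term of
    order one in the derivative, and the rest contains the factor \<open>p\<close>, already known to
    be of order 1 / w.\<close>
  define V where "V = (\<lambda>t. E t * E t * r t)"
  have "norm (V T - V 0) \<le> 2 * M * A * (C / \<bar>w\<bar>) * R * T"
  proof (rule norm_increment_bound)
    show "continuous_on {0..T} V" unfolding V_def by (intro continuous_intros cont)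
    fix t assume t: "t \<in> {0<..<T}"
    then have t': "t \<in> {0..T}" by simp
    show "(V has_vector_derivative - 2 * m t * E t * p t * r t) (at t)"
      unfolding V_def
      by (rule has_vector_derivative_eq_rhs, (rule derivative_intros dE dr t)+) (simp add: algebra_simps)
    show "norm (- 2 * m t * E t * p t * r t) \<le> 2 * M * A * (C / \<bar>w\<bar>) * R"
      unfolding norm_mult norm_minus_cancel
      using bd(1)[OF t'] Ebd[OF t'] pw[OF t'] bd(3)[OF t'] M AD C0
      by (intro mult_mono) auto
  qed (use T in auto)
  then show "norm ((E T)\<^sup>2 * r T - r 0) \<le> 2 * M * A * C * R * T / \<bar>w\<bar>"
    by (simp add: V_def init power2_eq_square)
qed

section \<open>The flow in the deformation parameter\<close>

text \<open>In the variable \<open>x = \<surd>\<tau> \<mu>\<close>, after the gauge below, the flow in \<open>\<tau>\<close> at fixed \<open>x\<close> has the matrix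
  \<open>- Q / x\<close> with off-diagonal entries \<open>q1\<close>, \<open>q2\<close>, and \<open>x\<close> times the matrix of the \<open>x\<close>-equation has the
  upper right and lower left entries \<open>2 x n1 + \<tau> q1 / x\<close> and \<open>2 x n2 + \<tau> q2 / x\<close>.\<close>

locale lax_flow =
  fixes \<kappa> T lam :: real and n1 n2 q1 q2 :: "real \<Rightarrow> complex"
  assumes T: "0 < T" and lam: "0 < lam" and kappa: "\<kappa> \<in> {1, -1}"
    and cont: "continuous_on {0..T} n1" "continuous_on {0..T} n2"
      "continuous_on {0..T} q1" "continuous_on {0..T} q2"
    and n1_deriv: "\<And>t. t \<in> {0<..<T} \<Longrightarrow> (n1 has_vector_derivative - 2 * \<i> * \<kappa> * q1 t) (at t)"
    and n2_deriv: "\<And>t. t \<in> {0<..<T} \<Longrightarrow> (n2 has_vector_derivative 2 * \<i> * \<kappa> * q2 t) (at t)"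
    and q1_deriv: "\<And>t. t \<in> {0<..<T} \<Longrightarrow>
      (q1 has_vector_derivative - 2 * \<kappa> * \<i> * n1 t * n2 t * q1 t / t) (at t)"
    and q2_deriv: "\<And>t. t \<in> {0<..<T} \<Longrightarrow>
      (q2 has_vector_derivative 2 * \<kappa> * \<i> * n1 t * n2 t * q2 t / t) (at t)"
    and q1q2: "\<And>t. t \<in> {0..T} \<Longrightarrow> q1 t * q2 t = - (of_real lam)\<^sup>2"
    and n1_0: "n1 0 = 0"
begin

section \<open>Picard series of the flow in powers of y = 1/x\<close>

lemma kappa2: "complex_of_real \<kappa> * \<kappa> = 1"
  using kappa by auto

primrec coef :: "complex \<Rightarrow> complex \<Rightarrow> nat \<Rightarrow> real \<Rightarrow> complex \<times> complex" where
  "coef a b 0 t = (a, b)"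
| "coef a b (Suc n) t =
     (integral {0..t} (\<lambda>s. - q1 s * snd (coef a b n s)),
      integral {0..t} (\<lambda>s. - q2 s * fst (coef a b n s)))"

abbreviation c1 where "c1 a b n t \<equiv> fst (coef a b n t)"
abbreviation c2 where "c2 a b n t \<equiv> snd (coef a b n t)"

lemma integral_continuous_deriv:
  fixes f :: "real \<Rightarrow> complex"
  assumes "continuous_on {0..T} f"
  shows "continuous_on {0..T} (\<lambda>t. integral {0..t} f)"
    and "t \<in> {0<..<T} \<Longrightarrow> ((\<lambda>t. integral {0..t} f) has_vector_derivative f t) (at t)"
proof -
  have *: "((\<lambda>t. integral {0..t} f) has_vector_derivative f s) (at s within {0..T})"
    if "s \<in> {0..T}" for s
    using integral_has_vector_derivative[OF assms that] .
  show "continuous_on {0..T} (\<lambda>t. integral {0..t} f)"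
    using * by (meson continuous_on_eq_continuous_within has_vector_derivative_continuous)
  show "((\<lambda>t. integral {0..t} f) has_vector_derivative f t) (at t)" if "t \<in> {0<..<T}"
    using *[of t] that at_within_interior[of t "{0..T}"] by auto
qed

lemma coef_continuous: "continuous_on {0..T} (c1 a b n)" "continuous_on {0..T} (c2 a b n)"
proof (induction n)
  case (Suc n)
  show "continuous_on {0..T} (c1 a b (Suc n))" "continuous_on {0..T} (c2 a b (Suc n))"
    by (auto intro!: integral_continuous_deriv(1) continuous_intros cont Suc)
qed simp_all

lemma coef_deriv:
  assumes "t \<in> {0<..<T}"
  shows "(c1 a b (Suc n) has_vector_derivative - q1 t * c2 a b n t) (at t)"
    and "(c2 a b (Suc n) has_vector_derivative - q2 t * c1 a b n t) (at t)"
  using integral_continuous_deriv(2)[of "\<lambda>s. - q1 s * c2 a b n s" t]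
    integral_continuous_deriv(2)[of "\<lambda>s. - q2 s * c1 a b n s" t] assms
  by (simp_all add: continuous_intros cont coef_continuous)

lemma coef_at_0: "coef a b n 0 = (if n = 0 then (a, b) else (0, 0))"
  by (cases n) auto

definition qmax :: real where
  "qmax = (SOME M. 0 < M \<and> (\<forall>t\<in>{0..T}. norm (q1 t) \<le> M \<and> norm (q2 t) \<le> M))"

lemma qmax: "0 < qmax" "t \<in> {0..T} \<Longrightarrow> norm (q1 t) \<le> qmax" "t \<in> {0..T} \<Longrightarrow> norm (q2 t) \<le> qmax"
proof -
  have "bounded (q1 ` {0..T})" "bounded (q2 ` {0..T})"
    by (intro compact_imp_bounded compact_continuous_image cont compact_Icc)+
  then obtain A B where "\<And>t. t \<in> {0..T} \<Longrightarrow> norm (q1 t) \<le> A" "\<And>t. t \<in> {0..T} \<Longrightarrow> norm (q2 t) \<le> B"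
    unfolding bounded_iff by blast
  then have "0 < max 1 (max A B) \<and> (\<forall>t\<in>{0..T}. norm (q1 t) \<le> max 1 (max A B) \<and> norm (q2 t) \<le> max 1 (max A B))"
    by (auto simp: le_max_iff_disj)
  then have "0 < qmax \<and> (\<forall>t\<in>{0..T}. norm (q1 t) \<le> qmax \<and> norm (q2 t) \<le> qmax)"
    unfolding qmax_def by (rule someI)
  then show "0 < qmax" "t \<in> {0..T} \<Longrightarrow> norm (q1 t) \<le> qmax" "t \<in> {0..T} \<Longrightarrow> norm (q2 t) \<le> qmax"
    by auto
qed

lemma norm_integral_power_bound:
  fixes f :: "real \<Rightarrow> complex"
  assumes f: "continuous_on {0..T} f" and t: "t \<in> {0..T}"
    and bd: "\<And>s. s \<in> {0..T} \<Longrightarrow> norm (f s) \<le> C * s ^ n"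
  shows "norm (integral {0..t} f) \<le> C * t ^ Suc n / Suc n"
proof -
  have "((\<lambda>s. C * s ^ n) has_integral (C * t ^ Suc n / Suc n - C * 0 ^ Suc n / Suc n)) {0..t}"
    using t
    by (intro fundamental_theorem_of_calculus)
       (auto intro!: derivative_eq_intros simp: has_real_derivative_iff_has_vector_derivative[symmetric]
          field_simps simp del: of_nat_Suc power_Suc)
  then have I: "((\<lambda>s. C * s ^ n) has_integral C * t ^ Suc n / Suc n) {0..t}" by simp
  have "norm (integral {0..t} f) \<le> integral {0..t} (\<lambda>s. C * s ^ n)"
    using I f t bd
    by (intro integral_norm_bound_integral integrable_continuous_interval continuous_intros)
       (auto intro: continuous_on_subset)
  then show ?thesis using integral_unique[OF I] by simp
qed

text \<open>Each iterated integral contributes a factor qmax and raises the power of t, and the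
  nested integration produces the factorial. This makes the series entire in
  \<open>y\<close>.\<close>

lemma coef_bound:
  assumes "t \<in> {0..T}"
  shows "norm (c1 a b n t) \<le> (norm a + norm b) * (qmax * t) ^ n / fact n \<and>
    norm (c2 a b n t) \<le> (norm a + norm b) * (qmax * t) ^ n / fact n"
  using assms
proof (induction n arbitrary: t)
  case (Suc n)
  let ?C = "(norm a + norm b) * qmax ^ Suc n / fact n"
  have "norm (- q1 s * c2 a b n s) \<le> ?C * s ^ n \<and> norm (- q2 s * c1 a b n s) \<le> ?C * s ^ n"
    if s: "s \<in> {0..T}" for s
  proof -
    have "norm (q1 s) * norm (c2 a b n s) \<le> qmax * ((norm a + norm b) * (qmax * s) ^ n / fact n)"
      using Suc.IH[OF s] qmax(1) qmax(2)[OF s] by (intro mult_mono) auto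
    moreover have "norm (q2 s) * norm (c1 a b n s) \<le> qmax * ((norm a + norm b) * (qmax * s) ^ n / fact n)"
      using Suc.IH[OF s] qmax(1) qmax(3)[OF s] by (intro mult_mono) auto
    moreover have "qmax * ((norm a + norm b) * (qmax * s) ^ n / fact n) = ?C * s ^ n"
      unfolding power_mult_distrib power_Suc by simp
    ultimately show ?thesis unfolding norm_mult norm_minus_cancel by metis
  qed
  then have "norm (integral {0..t} (\<lambda>s. - q1 s * c2 a b n s)) \<le> ?C * t ^ Suc n / Suc n"
    "norm (integral {0..t} (\<lambda>s. - q2 s * c1 a b n s)) \<le> ?C * t ^ Suc n / Suc n"
    by (intro norm_integral_power_bound Suc.prems continuous_intros cont coef_continuous; simp)+
  moreover have "?C * t ^ Suc n / Suc n = (norm a + norm b) * (qmax * t) ^ Suc n / fact (Suc n)"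
    unfolding power_mult_distrib fact_Suc of_nat_mult by (simp add: ac_simps)
  ultimately show ?case by simp
qed simp

lemma coef_bound_T:
  assumes "t \<in> {0..T}"
  shows "norm (c1 a b n t) \<le> (norm a + norm b) * (qmax * T) ^ n / fact n"
    and "norm (c2 a b n t) \<le> (norm a + norm b) * (qmax * T) ^ n / fact n"
proof -
  have "(norm a + norm b) * (qmax * t) ^ n / fact n \<le> (norm a + norm b) * (qmax * T) ^ n / fact n"
    using assms qmax(1) by (intro divide_right_mono mult_left_mono power_mono) auto
  then show "norm (c1 a b n t) \<le> (norm a + norm b) * (qmax * T) ^ n / fact n"
    "norm (c2 a b n t) \<le> (norm a + norm b) * (qmax * T) ^ n / fact n"
    using coef_bound[OF assms, of a b n] by linarith+
qed

text \<open>The weights let one series serve two purposes: \<open>w n = 1\<close> gives the solution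
  of the flow, \<open>w n = n\<close> its Euler derivative in \<open>y\<close>.\<close>

definition ser1 :: "(nat \<Rightarrow> complex) \<Rightarrow> complex \<Rightarrow> complex \<Rightarrow> complex \<Rightarrow> real \<Rightarrow> complex" where
  "ser1 w a b y t = (\<Sum>n. w n * c1 a b n t * y ^ n)"

definition ser2 :: "(nat \<Rightarrow> complex) \<Rightarrow> complex \<Rightarrow> complex \<Rightarrow> complex \<Rightarrow> real \<Rightarrow> complex" where
  "ser2 w a b y t = (\<Sum>n. w n * c2 a b n t * y ^ n)"

text \<open>The factor 2 absorbs all weights bounded by \<open>2 ^ n\<close>, in particular both 1
  and \<open>n\<close>.\<close>

definition majorant :: "complex \<Rightarrow> complex \<Rightarrow> complex \<Rightarrow> nat \<Rightarrow> real" where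
  "majorant a b y n = (norm a + norm b) * ((2 * qmax * T * norm y) ^ n / fact n)"

lemma summable_majorant: "summable (majorant a b y)"
  unfolding majorant_def
  by (intro summable_mult) (use summable_exp[of "2 * qmax * T * norm y"] in \<open>simp add: field_simps\<close>)

lemma norm_term_le_majorant:
  assumes "t \<in> {0..T}" "norm v \<le> 2 ^ n"
  shows "norm (v * c1 a b n t * y ^ n) \<le> majorant a b y n"
    and "norm (v * c2 a b n t * y ^ n) \<le> majorant a b y n"
proof -
  have *: "norm (v * c * y ^ n) \<le> majorant a b y n"
    if "norm c \<le> (norm a + norm b) * (qmax * T) ^ n / fact n" for c
  proof -
    have "norm v * norm c \<le> 2 ^ n * ((norm a + norm b) * (qmax * T) ^ n / fact n)"
      using assms(2) that by (rule mult_mono) auto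
    then have "norm (v * c * y ^ n) \<le> 2 ^ n * ((norm a + norm b) * (qmax * T) ^ n / fact n) * norm y ^ n"
      unfolding norm_mult norm_power by (rule mult_right_mono) simp
    also have "\<dots> = majorant a b y n"
      by (simp add: majorant_def power_mult_distrib)
    finally show ?thesis .
  qed
  show "norm (v * c1 a b n t * y ^ n) \<le> majorant a b y n"
    "norm (v * c2 a b n t * y ^ n) \<le> majorant a b y n"
    by (intro * coef_bound_T assms)+
qed

lemma ser_summable:
  assumes "t \<in> {0..T}" "\<And>n. norm (w n) \<le> 2 ^ n"
  shows "summable (\<lambda>n. w n * c1 a b n t * y ^ n)" "summable (\<lambda>n. w n * c2 a b n t * y ^ n)"
  using norm_term_le_majorant[OF assms]
  by (auto intro!: summable_comparison_test'[OF summable_majorant, of 0])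

lemma ser_continuous:
  assumes "\<And>n. norm (w n) \<le> 2 ^ n"
  shows "continuous_on {0..T} (ser1 w a b y)" "continuous_on {0..T} (ser2 w a b y)"
proof -
  show "continuous_on {0..T} (ser1 w a b y)"
    unfolding ser1_def[abs_def]
  proof (rule series_continuous_on[OF _ _ summable_majorant[of a b y]])
    show "continuous_on {0..T} (\<lambda>t. w n * c1 a b n t * y ^ n)" for n
      by (intro continuous_intros coef_continuous)
  qed (intro norm_term_le_majorant assms)
  show "continuous_on {0..T} (ser2 w a b y)"
    unfolding ser2_def[abs_def]
  proof (rule series_continuous_on[OF _ _ summable_majorant[of a b y]])
    show "continuous_on {0..T} (\<lambda>t. w n * c2 a b n t * y ^ n)" for n
      by (intro continuous_intros coef_continuous)
  qed (intro norm_term_le_majorant assms)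
qed

text \<open>The derivative of the coefficient with index n + 1 is \<open>- q\<close> times the other
  coefficient with index n; this explains the shifted weights and the factor
  \<open>y\<close>.\<close>

lemma ser_deriv:
  assumes w: "\<And>n. norm (w n) \<le> 2 ^ n" and t: "t \<in> {0<..<T}"
  shows "(ser1 w a b y has_vector_derivative - q1 t * y * ser2 (\<lambda>n. w (Suc n)) a b y t) (at t)"
    and "(ser2 w a b y has_vector_derivative - q2 t * y * ser1 (\<lambda>n. w (Suc n)) a b y t) (at t)"
proof -
  have t': "t \<in> {0..T}" using t by simp
  \<comment> \<open>The coefficient with index 0 is constant, hence the entry 0. A shifted weight is
    bounded by \<open>2 ^ Suc m\<close> only, so it is halved before \<open>majorant\<close> applies
    and the 2 is paid for here.\<close>
  define B' where "B' = (\<lambda>n. case n of 0 \<Rightarrow> 0 | Suc m \<Rightarrow> 2 * qmax * norm y * majorant a b y m)"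
  have B': "summable B'"
    unfolding B'_def by (subst summable_Suc_iff[symmetric]) (auto intro!: summable_mult summable_majorant)
  have step: "norm (w (Suc m) * (- q * c) * y ^ Suc m) \<le> B' (Suc m)"
    if "norm q \<le> qmax" "norm (w (Suc m) / 2 * c * y ^ m) \<le> majorant a b y m" for q c m
  proof -
    have "norm (w (Suc m) * (- q * c) * y ^ Suc m) = norm q * (2 * norm y) * norm (w (Suc m) / 2 * c * y ^ m)"
      by (simp add: norm_mult norm_power norm_divide)
    also have "\<dots> \<le> qmax * (2 * norm y) * majorant a b y m"
      using that qmax(1) by (intro mult_mono) auto
    finally show ?thesis by (simp add: B'_def ac_simps)
  qed
  have w2: "norm (w (Suc m) / 2) \<le> 2 ^ m" for m
    using w[of "Suc m"] by (simp add: norm_divide)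
  have shift: "(\<Sum>n. case n of 0 \<Rightarrow> 0 | Suc m \<Rightarrow> w (Suc m) * (- q * c m) * y ^ Suc m)
      = - q * y * (\<Sum>m. w (Suc m) * c m * y ^ m)"
    if "summable (\<lambda>m. w (Suc m) / 2 * c m * y ^ m)" for q c
  proof -
    let ?f = "\<lambda>n. case n of 0 \<Rightarrow> 0 | Suc m \<Rightarrow> w (Suc m) * (- q * c m) * y ^ Suc m"
    have s: "summable (\<lambda>m. w (Suc m) * c m * y ^ m)"
      using summable_mult[OF that, of 2] by simp
    have eq: "(\<lambda>m. ?f (Suc m)) = (\<lambda>m. (- q * y) * (w (Suc m) * c m * y ^ m))"
      by (simp add: fun_eq_iff)
    have "summable ?f"
      by (subst summable_Suc_iff[symmetric], subst eq) (rule summable_mult[OF s])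
    then have "suminf ?f = (\<Sum>m. ?f (Suc m))"
      by (subst suminf_split_head) (assumption, simp)
    also have "\<dots> = - q * y * (\<Sum>m. w (Suc m) * c m * y ^ m)"
      unfolding eq using s by (rule suminf_mult)
    finally show ?thesis .
  qed
  have "((\<lambda>t. \<Sum>n. w n * c1 a b n t * y ^ n) has_vector_derivative
     (\<Sum>n. case n of 0 \<Rightarrow> 0 | Suc m \<Rightarrow> w (Suc m) * (- q1 t * c2 a b m t) * y ^ Suc m)) (at t)"
  proof (rule series_has_vector_derivative[OF _ _ _ summable_majorant B' t])
    fix n s assume s: "s \<in> {0<..<T}"
    show "((\<lambda>t. w n * c1 a b n t * y ^ n) has_vector_derivative
        (case n of 0 \<Rightarrow> 0 | Suc m \<Rightarrow> w (Suc m) * (- q1 s * c2 a b m s) * y ^ Suc m)) (at s)"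
    proof (cases n)
      case (Suc m)
      show ?thesis unfolding Suc nat.case
        by (intro has_vector_derivative_mult_left has_vector_derivative_mult_right coef_deriv s)
    qed simp
    show "norm (w n * c1 a b n s * y ^ n) \<le> majorant a b y n"
      using s by (intro norm_term_le_majorant w) auto
    show "norm (case n of 0 \<Rightarrow> 0 | Suc m \<Rightarrow> w (Suc m) * (- q1 s * c2 a b m s) * y ^ Suc m) \<le> B' n"
    proof (cases n)
      case (Suc m)
      show ?thesis unfolding Suc nat.case
        using s by (intro step norm_term_le_majorant w2 qmax) auto
    qed (simp add: B'_def)
  qed
  then show "(ser1 w a b y has_vector_derivative - q1 t * y * ser2 (\<lambda>n. w (Suc n)) a b y t) (at t)"
    unfolding ser1_def[abs_def] ser2_def shift[OF ser_summable(2)[OF t' w2]] .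
  have "((\<lambda>t. \<Sum>n. w n * c2 a b n t * y ^ n) has_vector_derivative
     (\<Sum>n. case n of 0 \<Rightarrow> 0 | Suc m \<Rightarrow> w (Suc m) * (- q2 t * c1 a b m t) * y ^ Suc m)) (at t)"
  proof (rule series_has_vector_derivative[OF _ _ _ summable_majorant B' t])
    fix n s assume s: "s \<in> {0<..<T}"
    show "((\<lambda>t. w n * c2 a b n t * y ^ n) has_vector_derivative
        (case n of 0 \<Rightarrow> 0 | Suc m \<Rightarrow> w (Suc m) * (- q2 s * c1 a b m s) * y ^ Suc m)) (at s)"
    proof (cases n)
      case (Suc m)
      show ?thesis unfolding Suc nat.case
        by (intro has_vector_derivative_mult_left has_vector_derivative_mult_right coef_deriv s)
    qed simp
    show "norm (w n * c2 a b n s * y ^ n) \<le> majorant a b y n"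
      using s by (intro norm_term_le_majorant w) auto
    show "norm (case n of 0 \<Rightarrow> 0 | Suc m \<Rightarrow> w (Suc m) * (- q2 s * c1 a b m s) * y ^ Suc m) \<le> B' n"
    proof (cases n)
      case (Suc m)
      show ?thesis unfolding Suc nat.case
        using s by (intro step norm_term_le_majorant w2 qmax) auto
    qed (simp add: B'_def)
  qed
  then show "(ser2 w a b y has_vector_derivative - q2 t * y * ser1 (\<lambda>n. w (Suc n)) a b y t) (at t)"
    unfolding ser2_def[abs_def] ser1_def shift[OF ser_summable(1)[OF t' w2]] .
qed

definition H1 where "H1 a b y t = ser1 (\<lambda>_. 1) a b y t"
definition H2 where "H2 a b y t = ser2 (\<lambda>_. 1) a b y t"
text \<open>The operator - y d/dy applied to \<open>H1\<close>. Since y = 1/x, this is x d/dx, that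
  is, the derivative in \<zeta>.\<close>

definition J1 where "J1 a b y t = - ser1 of_nat a b y t"
definition J2 where "J2 a b y t = - ser2 of_nat a b y t"

lemma one_le_2_power: "norm (1 :: complex) \<le> 2 ^ n"
  using one_le_power[of 2 n] by simp

lemma of_nat_le_2_power: "norm (of_nat n :: complex) \<le> 2 ^ n"
  using less_exp[of n] by (metis norm_of_nat of_nat_le_iff of_nat_numeral of_nat_power order_less_imp_le)

lemma HJ_continuous:
  "continuous_on {0..T} (H1 a b y)" "continuous_on {0..T} (H2 a b y)"
  "continuous_on {0..T} (J1 a b y)" "continuous_on {0..T} (J2 a b y)"
  unfolding H1_def[abs_def] H2_def[abs_def] J1_def[abs_def] J2_def[abs_def]
  by (intro continuous_intros ser_continuous one_le_2_power of_nat_le_2_power)+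

lemma H_deriv:
  assumes "t \<in> {0<..<T}"
  shows "(H1 a b y has_vector_derivative - y * q1 t * H2 a b y t) (at t)"
    and "(H2 a b y has_vector_derivative - y * q2 t * H1 a b y t) (at t)"
  using ser_deriv[OF one_le_2_power assms, of a b y]
  unfolding H1_def[abs_def] H2_def[abs_def] by (simp_all add: mult.commute)

lemma ser_of_nat_Suc:
  assumes "t \<in> {0..T}"
  shows "ser1 (\<lambda>n. of_nat (Suc n)) a b y t = H1 a b y t - J1 a b y t"
    and "ser2 (\<lambda>n. of_nat (Suc n)) a b y t = H2 a b y t - J2 a b y t"
  unfolding ser1_def ser2_def H1_def H2_def J1_def J2_def
  using ser_summable[OF assms one_le_2_power, of a b y]
    ser_summable[OF assms of_nat_le_2_power, of a b y]
  by (simp_all add: suminf_add algebra_simps)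

lemma J_deriv:
  assumes "t \<in> {0<..<T}"
  shows "(J1 a b y has_vector_derivative y * q1 t * (H2 a b y t - J2 a b y t)) (at t)"
    and "(J2 a b y has_vector_derivative y * q2 t * (H1 a b y t - J1 a b y t)) (at t)"
proof -
  have "t \<in> {0..T}" using assms by simp
  from ser_deriv[OF of_nat_le_2_power assms, of a b y]
  have "(ser1 of_nat a b y has_vector_derivative - q1 t * y * (H2 a b y t - J2 a b y t)) (at t)"
    "(ser2 of_nat a b y has_vector_derivative - q2 t * y * (H1 a b y t - J1 a b y t)) (at t)"
    unfolding ser_of_nat_Suc[OF \<open>t \<in> {0..T}\<close>] by auto
  from this[THEN has_vector_derivative_minus]
  show "(J1 a b y has_vector_derivative y * q1 t * (H2 a b y t - J2 a b y t)) (at t)"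
    "(J2 a b y has_vector_derivative y * q2 t * (H1 a b y t - J1 a b y t)) (at t)"
    unfolding J1_def[abs_def] J2_def[abs_def] by (simp_all add: mult.commute)
qed

lemma HJ_at_0:
  "H1 a b y 0 = a" "H2 a b y 0 = b" "J1 a b y 0 = 0" "J2 a b y 0 = 0"
proof -
  have *: "(\<Sum>n. w n * f (if n = 0 then (a, b) else (0, 0)) * y ^ n) = w 0 * f (a, b)"
    if "f (0, 0) = 0" for w and f :: "complex \<times> complex \<Rightarrow> complex"
    using suminf_finite[of "{0}" "\<lambda>n. w n * f (if n = 0 then (a, b) else (0, 0)) * y ^ n"] that by simp
  show "H1 a b y 0 = a" "H2 a b y 0 = b" "J1 a b y 0 = 0" "J2 a b y 0 = 0"
    unfolding H1_def H2_def J1_def J2_def ser1_def ser2_def coef_at_0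
    using *[of fst "\<lambda>_. 1"] *[of snd "\<lambda>_. 1"] *[of fst of_nat] *[of snd of_nat] by simp_all
qed

text \<open>The point y = 0 is treated separately because it corresponds to x = \<infinity>:
  differentiability and the value there give the limit of the flow matrix along rays to
  infinity.\<close>

lemma H_y_deriv:
  assumes t: "t \<in> {0..T}"
  shows "y \<noteq> 0 \<Longrightarrow> ((\<lambda>y. H1 a b y t) has_field_derivative - J1 a b y t / y) (at y)"
    and "y \<noteq> 0 \<Longrightarrow> ((\<lambda>y. H2 a b y t) has_field_derivative - J2 a b y t / y) (at y)"
    and "(\<lambda>y. H1 a b y t) field_differentiable at y" "(\<lambda>y. H2 a b y t) field_differentiable at y"
    and "H1 a b 0 t = a" "H2 a b 0 t = b"
proof -
  have *: "((\<lambda>y. \<Sum>n. 1 * c n * y ^ n) has_field_derivative (\<Sum>n. diffs c n * y ^ n)) (at y)"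
    if "\<And>y. summable (\<lambda>n. 1 * c n * y ^ n)" for c :: "nat \<Rightarrow> complex" and y
    using termdiffs_strong_converges_everywhere[of c y] that by simp
  have d: "(\<Sum>n. diffs c n * y ^ n) = (\<Sum>n. of_nat n * c n * y ^ n) / y"
    if "\<And>y. summable (\<lambda>n. of_nat n * c n * y ^ n)" "y \<noteq> 0" for c :: "nat \<Rightarrow> complex" and y
  proof -
    have s: "summable (\<lambda>n. diffs c n * y ^ n)"
    proof -
      have "summable (\<lambda>n. of_nat (Suc n) * c (Suc n) * y ^ Suc n / y)"
        using summable_Suc_iff[of "\<lambda>n. of_nat n * c n * y ^ n"] that(1)[of y] by (intro summable_divide) simp
      then show ?thesis using that(2) by (simp add: diffs_def mult.assoc del: of_nat_Suc)
    qed
    have "(\<Sum>n. of_nat n * c n * y ^ n) = (\<Sum>n. of_nat (Suc n) * c (Suc n) * y ^ Suc n)"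
      using suminf_split_head[OF that(1)] by simp
    also have "\<dots> = (\<Sum>n. y * (diffs c n * y ^ n))"
      by (simp add: diffs_def ac_simps del: of_nat_Suc)
    also have "\<dots> = y * (\<Sum>n. diffs c n * y ^ n)" using s by (rule suminf_mult)
    finally show ?thesis using that(2) by simp
  qed
  note s1 = ser_summable[OF t one_le_2_power] and sn = ser_summable[OF t of_nat_le_2_power]
  show "((\<lambda>y. H1 a b y t) has_field_derivative - J1 a b y t / y) (at y)" if "y \<noteq> 0"
    using *[OF s1(1), of a b y] unfolding d[OF sn(1) that] H1_def J1_def ser1_def by simp
  show "((\<lambda>y. H2 a b y t) has_field_derivative - J2 a b y t / y) (at y)" if "y \<noteq> 0"
    using *[OF s1(2), of a b y] unfolding d[OF sn(2) that] H2_def J2_def ser2_def by simp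
  show "(\<lambda>y. H1 a b y t) field_differentiable at y" "(\<lambda>y. H2 a b y t) field_differentiable at y"
    using *[OF s1(1), of a b y] *[OF s1(2), of a b y]
    unfolding H1_def H2_def ser1_def ser2_def by (auto simp: field_differentiable_def)
  show "H1 a b 0 t = a" "H2 a b 0 t = b"
    by (simp_all add: H1_def H2_def ser1_def ser2_def powser_zero)
qed

abbreviation H11 where "H11 \<equiv> H1 1 0"
abbreviation H12 where "H12 \<equiv> H1 0 1"
abbreviation H21 where "H21 \<equiv> H2 1 0"
abbreviation H22 where "H22 \<equiv> H2 0 1"

text \<open>Liouville's formula: the matrix of the flow is off-diagonal, hence has trace
  zero.\<close>

lemma det_H:
  assumes "t \<in> {0..T}"
  shows "H11 y t * H22 y t - H12 y t * H21 y t = 1"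
proof -
  have "(\<lambda>t. H11 y t * H22 y t - H12 y t * H21 y t) t = (\<lambda>t. H11 y t * H22 y t - H12 y t * H21 y t) 0"
  proof (rule constant_if_derivative_zero[OF _ _ assms])
    show "continuous_on {0..T} (\<lambda>t. H11 y t * H22 y t - H12 y t * H21 y t)"
      by (intro continuous_intros HJ_continuous)
    fix s assume s: "s \<in> {0<..<T}"
    show "((\<lambda>t. H11 y t * H22 y t - H12 y t * H21 y t) has_vector_derivative 0) (at s)"
      by (rule has_vector_derivative_eq_rhs, (rule derivative_intros H_deriv s)+)
         (simp add: algebra_simps)
  qed
  then show ?thesis by (simp add: HJ_at_0)
qed

text \<open>The inverse of the fundamental matrix, applied to a solution, is constant; since the
  determinant is 1, its two components are the expressions \<open>?w1\<close> and
  \<open>?w2\<close>.\<close>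

lemma flow_unique:
  assumes c: "continuous_on {0..T} z1" "continuous_on {0..T} z2"
    and d: "\<And>t. t \<in> {0<..<T} \<Longrightarrow> (z1 has_vector_derivative - y * q1 t * z2 t) (at t)"
      "\<And>t. t \<in> {0<..<T} \<Longrightarrow> (z2 has_vector_derivative - y * q2 t * z1 t) (at t)"
    and t: "t \<in> {0..T}"
  shows "z1 t = H11 y t * z1 0 + H12 y t * z2 0" "z2 t = H21 y t * z1 0 + H22 y t * z2 0"
proof -
  have "(\<lambda>t. H22 y t * z1 t - H12 y t * z2 t) t = (\<lambda>t. H22 y t * z1 t - H12 y t * z2 t) 0"
    (is "?w1 t = _")
  proof (rule constant_if_derivative_zero[OF _ _ t])
    show "continuous_on {0..T} ?w1" by (intro continuous_intros HJ_continuous c)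
    fix s assume s: "s \<in> {0<..<T}"
    show "(?w1 has_vector_derivative 0) (at s)"
      by (rule has_vector_derivative_eq_rhs, (rule derivative_intros H_deriv d s)+)
         (simp add: algebra_simps)
  qed
  then have 1: "H22 y t * z1 t - H12 y t * z2 t = z1 0" by (simp add: HJ_at_0)
  have "(\<lambda>t. H11 y t * z2 t - H21 y t * z1 t) t = (\<lambda>t. H11 y t * z2 t - H21 y t * z1 t) 0"
    (is "?w2 t = _")
  proof (rule constant_if_derivative_zero[OF _ _ t])
    show "continuous_on {0..T} ?w2" by (intro continuous_intros HJ_continuous c)
    fix s assume s: "s \<in> {0<..<T}"
    show "(?w2 has_vector_derivative 0) (at s)"
      by (rule has_vector_derivative_eq_rhs, (rule derivative_intros H_deriv d s)+)
         (simp add: algebra_simps)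
  qed
  then have 2: "H11 y t * z2 t - H21 y t * z1 t = z2 0" by (simp add: HJ_at_0)
  show "z1 t = H11 y t * z1 0 + H12 y t * z2 0" "z2 t = H21 y t * z1 0 + H22 y t * z2 0"
    using cramer[OF det_H[OF t, of y], where v = "z1 t" and w = "z2 t"] unfolding 1 2 .
qed

lemma H_linear:
  assumes "t \<in> {0..T}"
  shows "H1 a b y t = H11 y t * a + H12 y t * b" "H2 a b y t = H21 y t * a + H22 y t * b"
  using flow_unique[OF HJ_continuous(1,2) H_deriv assms, of a b y]
  by (simp_all add: HJ_at_0)

section \<open>Compatibility of the flow with the x-equation\<close>

definition diag :: "real \<Rightarrow> complex" where "diag t = \<i> * n1 t * n2 t"
definition offdiag1 :: "complex \<Rightarrow> complex \<Rightarrow> real \<Rightarrow> complex" where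
  "offdiag1 x y t = 2 * x * n1 t + of_real t * y * q1 t"
definition offdiag2 :: "complex \<Rightarrow> complex \<Rightarrow> real \<Rightarrow> complex" where
  "offdiag2 x y t = 2 * x * n2 t + of_real t * y * q2 t"

lemma diag_offdiag_continuous:
  "continuous_on {0..T} diag" "continuous_on {0..T} (offdiag1 x y)" "continuous_on {0..T} (offdiag2 x y)"
  unfolding diag_def[abs_def] offdiag1_def[abs_def] offdiag2_def[abs_def]
  by (intro continuous_intros cont)+

lemma of_real_has_vector_derivative:
  "((\<lambda>t. complex_of_real t) has_vector_derivative 1) (at t)"
  unfolding has_vector_derivative_def by (rule derivative_eq_intros refl)+ (simp add: scaleR_conv_of_real)

lemma diag_offdiag_deriv:
  assumes t: "t \<in> {0<..<T}"
  shows "(diag has_vector_derivative 2 * \<kappa> * (q1 t * n2 t - n1 t * q2 t)) (at t)"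
    and "(offdiag1 x y has_vector_derivative
      - 4 * \<i> * \<kappa> * x * q1 t + y * q1 t - 2 * \<kappa> * diag t * y * q1 t) (at t)"
    and "(offdiag2 x y has_vector_derivative
      4 * \<i> * \<kappa> * x * q2 t + y * q2 t + 2 * \<kappa> * diag t * y * q2 t) (at t)"
proof -
  show "(diag has_vector_derivative 2 * \<kappa> * (q1 t * n2 t - n1 t * q2 t)) (at t)"
    unfolding diag_def[abs_def]
    by (rule has_vector_derivative_eq_rhs, (rule derivative_intros n1_deriv n2_deriv t)+)
       (simp add: algebra_simps)
  show "(offdiag1 x y has_vector_derivative
      - 4 * \<i> * \<kappa> * x * q1 t + y * q1 t - 2 * \<kappa> * diag t * y * q1 t) (at t)"
    unfolding offdiag1_def[abs_def]
    by (rule has_vector_derivative_eq_rhs,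
        (rule derivative_intros n1_deriv q1_deriv of_real_has_vector_derivative t)+)
       (use t in \<open>simp add: diag_def field_simps\<close>)
  show "(offdiag2 x y has_vector_derivative
      4 * \<i> * \<kappa> * x * q2 t + y * q2 t + 2 * \<kappa> * diag t * y * q2 t) (at t)"
    unfolding offdiag2_def[abs_def]
    by (rule has_vector_derivative_eq_rhs,
        (rule derivative_intros n2_deriv q2_deriv of_real_has_vector_derivative t)+)
       (use t in \<open>simp add: diag_def field_simps\<close>)
qed

abbreviation J11 where "J11 \<equiv> J1 1 0"
abbreviation J12 where "J12 \<equiv> J1 0 1"
abbreviation J21 where "J21 \<equiv> J2 1 0"
abbreviation J22 where "J22 \<equiv> J2 0 1"

text \<open>In matrix form x dH/dx = A(t) H - H A(0), where A(t) has diagonal -\<kappa> (2 i x^2 +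
  diag t), \<kappa> (2 i x^2 + diag t) and the given off-diagonal entries. By compatibility the
  difference of both sides solves the flow equation, and it vanishes at t = 0. Because
  \<open>n1 0 = 0\<close>, the matrix A(0) is lower triangular with the entry 2 x n2(0) below the
  diagonal.\<close>

lemma intertwining:
  assumes xy: "x * y = 1" and t: "t \<in> {0..T}"
  shows "J11 y t = offdiag1 x y t * H21 y t - \<kappa> * diag t * H11 y t - 2 * x * n2 0 * H12 y t"
    and "J21 y t = offdiag2 x y t * H11 y t + \<kappa> * (4 * \<i> * x\<^sup>2 + diag t) * H21 y t - 2 * x * n2 0 * H22 y t"
    and "J12 y t = offdiag1 x y t * H22 y t - \<kappa> * (4 * \<i> * x\<^sup>2 + diag t) * H12 y t"
    and "J22 y t = offdiag2 x y t * H12 y t + \<kappa> * diag t * H22 y t"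
proof -
  note cs = continuous_intros HJ_continuous diag_offdiag_continuous
  note ds = derivative_intros H_deriv J_deriv diag_offdiag_deriv
  have dd: "diag t = \<i> * n1 t * n2 t" "offdiag1 x y t = 2 * x * n1 t + of_real t * y * q1 t"
    "offdiag2 x y t = 2 * x * n2 t + of_real t * y * q2 t" for t
    by (simp_all add: diag_def offdiag1_def offdiag2_def)
  have xyz: "x * (y * z) = z" "y * (x * z) = z" for z
    using xy by (simp_all add: mult.assoc[symmetric] mult.commute)
  have kk: "of_real \<kappa> * (of_real \<kappa> * z) = z" for z :: complex
    by (simp only: mult.assoc[symmetric] kappa2 mult_1)
  \<comment> \<open>The entries of x dH/dx - A(t) H + H A(0). In the first row of the first column
    and the second row of the second column the terms 2 i x^2 of A(t) and A(0) cancel; in the other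
    two entries they add up to 4 i x^2.\<close>
  define z11 where "z11 = (\<lambda>t. J11 y t + \<kappa> * (diag t * H11 y t) - offdiag1 x y t * H21 y t + 2 * x * n2 0 * H12 y t)"
  define z21 where "z21 = (\<lambda>t. J21 y t - offdiag2 x y t * H11 y t - \<kappa> * ((4 * \<i> * x\<^sup>2 + diag t) * H21 y t) + 2 * x * n2 0 * H22 y t)"
  define z12 where "z12 = (\<lambda>t. J12 y t + \<kappa> * ((4 * \<i> * x\<^sup>2 + diag t) * H12 y t) - offdiag1 x y t * H22 y t)"
  define z22 where "z22 = (\<lambda>t. J22 y t - offdiag2 x y t * H12 y t - \<kappa> * (diag t * H22 y t))"
  have c21: "continuous_on {0..T} z11" "continuous_on {0..T} z21"
    unfolding z11_def z21_def by (intro cs)+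
  have d21: "(z11 has_vector_derivative - y * q1 s * z21 s) (at s)"
    "(z21 has_vector_derivative - y * q2 s * z11 s) (at s)" if s: "s \<in> {0<..<T}" for s
  proof -
    show "(z11 has_vector_derivative - y * q1 s * z21 s) (at s)"
      unfolding z11_def z21_def
      by (rule has_vector_derivative_eq_rhs, (rule ds s)+)
         (simp add: dd algebra_simps power2_eq_square xyz kk)
    show "(z21 has_vector_derivative - y * q2 s * z11 s) (at s)"
      unfolding z11_def z21_def
      by (rule has_vector_derivative_eq_rhs, (rule ds s)+)
         (simp add: dd algebra_simps power2_eq_square xyz kk)
  qed
  have "z11 0 = 0" "z21 0 = 0"
    by (simp_all add: z11_def z21_def HJ_at_0 dd n1_0)
  with flow_unique[OF c21 d21 t] have 1: "z11 t = 0" "z21 t = 0" by simp_all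
  have c22: "continuous_on {0..T} z12" "continuous_on {0..T} z22"
    unfolding z12_def z22_def by (intro cs)+
  have d22: "(z12 has_vector_derivative - y * q1 s * z22 s) (at s)"
    "(z22 has_vector_derivative - y * q2 s * z12 s) (at s)" if s: "s \<in> {0<..<T}" for s
  proof -
    show "(z12 has_vector_derivative - y * q1 s * z22 s) (at s)"
      unfolding z12_def z22_def
      by (rule has_vector_derivative_eq_rhs, (rule ds s)+)
         (simp add: dd algebra_simps power2_eq_square xyz kk)
    show "(z22 has_vector_derivative - y * q2 s * z12 s) (at s)"
      unfolding z12_def z22_def
      by (rule has_vector_derivative_eq_rhs, (rule ds s)+)
         (simp add: dd algebra_simps power2_eq_square xyz kk)
  qed
  have "z12 0 = 0" "z22 0 = 0"
    by (simp_all add: z12_def z22_def HJ_at_0 dd n1_0)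
  with flow_unique[OF c22 d22 t] have 2: "z12 t = 0" "z22 t = 0" by simp_all
  show "J11 y t = offdiag1 x y t * H21 y t - \<kappa> * diag t * H11 y t - 2 * x * n2 0 * H12 y t"
    "J21 y t = offdiag2 x y t * H11 y t + \<kappa> * (4 * \<i> * x\<^sup>2 + diag t) * H21 y t - 2 * x * n2 0 * H22 y t"
    "J12 y t = offdiag1 x y t * H22 y t - \<kappa> * (4 * \<i> * x\<^sup>2 + diag t) * H12 y t"
    "J22 y t = offdiag2 x y t * H12 y t + \<kappa> * diag t * H22 y t"
    using 1 2 unfolding z11_def z12_def z21_def z22_def by (simp_all add: algebra_simps)
qed

definition xv :: "complex \<Rightarrow> complex" where "xv \<zeta> = of_real (sqrt T) * exp \<zeta>"
definition yv :: "complex \<Rightarrow> complex" where "yv \<zeta> = 1 / xv \<zeta>"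

lemma xv_nonzero [simp]: "xv \<zeta> \<noteq> 0"
  using T by (simp add: xv_def)

lemma xv_yv: "xv \<zeta> * yv \<zeta> = 1"
  by (simp add: yv_def)

lemma xv_deriv: "(xv has_field_derivative xv \<zeta>) (at \<zeta>)"
  unfolding xv_def[abs_def] by (auto intro!: derivative_eq_intros)

lemma yv_deriv: "(yv has_field_derivative - yv \<zeta>) (at \<zeta>)"
  unfolding yv_def[abs_def]
  by (rule derivative_eq_intros xv_deriv refl xv_nonzero)+ (simp add: power2_eq_square)

text \<open>The x-equation at parameter value \<open>T\<close>, written with the derivative in
  \<zeta>, for one column with components \<open>b\<close> and \<open>a\<close>.\<close>

definition rotated_system :: "(complex \<Rightarrow> complex) \<Rightarrow> (complex \<Rightarrow> complex) \<Rightarrow> bool" where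
  "rotated_system b a \<longleftrightarrow> (\<forall>\<zeta>.
     (b has_field_derivative
        - \<kappa> * (2 * \<i> * (xv \<zeta>)\<^sup>2 + diag T) * b \<zeta> + offdiag1 (xv \<zeta>) (yv \<zeta>) T * a \<zeta>) (at \<zeta>) \<and>
     (a has_field_derivative
        offdiag2 (xv \<zeta>) (yv \<zeta>) T * b \<zeta> + \<kappa> * (2 * \<i> * (xv \<zeta>)\<^sup>2 + diag T) * a \<zeta>) (at \<zeta>))"

text \<open>\<open>dress1\<close> and \<open>dress2\<close> are the components of the inverse flow
  matrix applied to \<open>(b, a)\<close>; the determinant is 1.\<close>

definition dress1 :: "(complex \<Rightarrow> complex) \<Rightarrow> (complex \<Rightarrow> complex) \<Rightarrow> complex \<Rightarrow> complex" where
  "dress1 b a \<zeta> = H22 (yv \<zeta>) T * b \<zeta> - H12 (yv \<zeta>) T * a \<zeta>"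
definition dress2 :: "(complex \<Rightarrow> complex) \<Rightarrow> (complex \<Rightarrow> complex) \<Rightarrow> complex \<Rightarrow> complex" where
  "dress2 b a \<zeta> = H11 (yv \<zeta>) T * a \<zeta> - H21 (yv \<zeta>) T * b \<zeta>"

lemma H_zeta_deriv:
  "((\<lambda>\<zeta>. H1 c d (yv \<zeta>) T) has_field_derivative J1 c d (yv \<zeta>) T) (at \<zeta>)"
  "((\<lambda>\<zeta>. H2 c d (yv \<zeta>) T) has_field_derivative J2 c d (yv \<zeta>) T) (at \<zeta>)"
proof -
  have T': "T \<in> {0..T}" and y: "yv \<zeta> \<noteq> 0" using T xv_yv[of \<zeta>] by auto
  show "((\<lambda>\<zeta>. H1 c d (yv \<zeta>) T) has_field_derivative J1 c d (yv \<zeta>) T) (at \<zeta>)"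
    using DERIV_chain2[OF H_y_deriv(1)[OF T' y] yv_deriv] y by simp
  show "((\<lambda>\<zeta>. H2 c d (yv \<zeta>) T) has_field_derivative J2 c d (yv \<zeta>) T) (at \<zeta>)"
    using DERIV_chain2[OF H_y_deriv(2)[OF T' y] yv_deriv] y by simp
qed

lemma undress:
  "b \<zeta> = H11 (yv \<zeta>) T * dress1 b a \<zeta> + H12 (yv \<zeta>) T * dress2 b a \<zeta>"
  "a \<zeta> = H21 (yv \<zeta>) T * dress1 b a \<zeta> + H22 (yv \<zeta>) T * dress2 b a \<zeta>"
  unfolding dress1_def dress2_def using T by (intro cramer det_H; simp)+

text \<open>Differentiating the inverse of H applied to a solution, the intertwining relation
  replaces A(T) by the triangular A(0).\<close>

lemma dressed_deriv:
  assumes "rotated_system b a"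
  shows "(dress1 b a has_field_derivative - 2 * \<i> * \<kappa> * (xv \<zeta>)\<^sup>2 * dress1 b a \<zeta>) (at \<zeta>)"
    and "(dress2 b a has_field_derivative
      2 * xv \<zeta> * n2 0 * dress1 b a \<zeta> + 2 * \<i> * \<kappa> * (xv \<zeta>)\<^sup>2 * dress2 b a \<zeta>) (at \<zeta>)"
proof -
  have T': "T \<in> {0..T}" using T by simp
  have d: "(b has_field_derivative
        - \<kappa> * (2 * \<i> * (xv \<zeta>)\<^sup>2 + diag T) * b \<zeta> + offdiag1 (xv \<zeta>) (yv \<zeta>) T * a \<zeta>) (at \<zeta>)"
     "(a has_field_derivative
        offdiag2 (xv \<zeta>) (yv \<zeta>) T * b \<zeta> + \<kappa> * (2 * \<i> * (xv \<zeta>)\<^sup>2 + diag T) * a \<zeta>) (at \<zeta>)"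
    using assms unfolding rotated_system_def by blast+
  note J = intertwining[OF xv_yv T', of \<zeta>]
  show "(dress1 b a has_field_derivative - 2 * \<i> * \<kappa> * (xv \<zeta>)\<^sup>2 * dress1 b a \<zeta>) (at \<zeta>)"
    unfolding dress1_def[abs_def]
    by (rule DERIV_cong, (rule derivative_intros H_zeta_deriv d)+)
       (simp add: J algebra_simps)
  show "(dress2 b a has_field_derivative
      2 * xv \<zeta> * n2 0 * dress1 b a \<zeta> + 2 * \<i> * \<kappa> * (xv \<zeta>)\<^sup>2 * dress2 b a \<zeta>) (at \<zeta>)"
    unfolding dress1_def[abs_def] dress2_def[abs_def]
    by (rule DERIV_cong, (rule derivative_intros H_zeta_deriv d)+)
       (simp add: J algebra_simps)
qed

section \<open>Eigenvector frame of Q and its WKB limit\<close>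

definition slope :: "real \<Rightarrow> complex" where
  "slope t = (if t = 0 then - 2 * \<i> * \<kappa> * q1 0 else n1 t * inverse (of_real t))"
definition slope' :: "real \<Rightarrow> complex" where
  "slope' t = (- 2 * \<i> * \<kappa> * q1 t * of_real t - n1 t) * (inverse (of_real t))\<^sup>2"

lemma slope_deriv:
  assumes t: "t \<in> {0<..<T}"
  shows "(slope has_vector_derivative slope' t) (at t)"
proof -
  have inv: "((\<lambda>t. inverse (complex_of_real t)) has_vector_derivative - (inverse (of_real t))\<^sup>2) (at t)"
    using t by (intro has_vector_derivative_real_field) (auto intro!: derivative_eq_intros simp: power2_eq_square)
  have "((\<lambda>t. n1 t * inverse (of_real t)) has_vector_derivative slope' t) (at t)"
    by (rule has_vector_derivative_eq_rhs, rule has_vector_derivative_mult[OF n1_deriv[OF t] inv])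
       (use t in \<open>simp add: slope'_def field_simps power2_eq_square\<close>)
  then show ?thesis
    by (rule has_vector_derivative_transform_within_open[where S = "{0<..<T}"])
       (use t in \<open>auto simp: slope_def\<close>)
qed

lemma n1_bound: "t \<in> {0..T} \<Longrightarrow> norm (n1 t) \<le> 2 * qmax * t"
  using norm_increment_bound[OF cont(1) n1_deriv, of "2 * qmax" t] qmax(2) kappa
  by (auto simp: n1_0 norm_mult)

text \<open>The WKB estimate requires a bounded derivative of n1(t)/t up to t = 0. Its numerator
  vanishes there to second order, as the equations for \<open>n1\<close> and \<open>q1\<close> show
  when combined.\<close>

lemma slope_bounds:
  "\<exists>B\<ge>0. (\<forall>t\<in>{0<..<T}. norm (slope' t) \<le> B) \<and> (\<forall>t\<in>{0<..<T}. norm (slope t - slope 0) \<le> B * t)"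
proof -
  obtain N where N: "0 \<le> N" "\<And>t. t \<in> {0..T} \<Longrightarrow> norm (n2 t) \<le> N"
    using bounded_by_on_interval[OF cont(2)] by auto
  \<comment> \<open>This is t^2 times \<open>slope'\<close>. The terms with \<open>q1\<close> cancel
    in its derivative - 4 n1 n2 q1, which is of order t because \<open>n1\<close> is; so g is of
    order t^2. It also equals t times the difference of -2 i \<kappa> q1 and the quotient
    n1/t.\<close>
  define g where "g = (\<lambda>t. - 2 * \<i> * \<kappa> * (q1 t * of_real t) - n1 t)"
  have gd: "(g has_vector_derivative - 4 * n1 t * n2 t * q1 t) (at t)" if t: "t \<in> {0<..<T}" for t
    unfolding g_def
    by (rule has_vector_derivative_eq_rhs,
        (rule derivative_intros q1_deriv n1_deriv of_real_has_vector_derivative t)+)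
       (use t kappa in \<open>auto simp: field_simps\<close>)
  have gb: "norm (g t) \<le> (8 * qmax\<^sup>2 * N * t) * t" if t: "t \<in> {0<..<T}" for t
  proof -
    have "norm (g t - g 0) \<le> (8 * qmax\<^sup>2 * N * t) * t"
    proof (rule norm_increment_bound[of t g])
      show "continuous_on {0..t} g" unfolding g_def
        using t by (intro continuous_intros continuous_on_subset[OF cont(1)] continuous_on_subset[OF cont(3)]) auto
      fix s assume s: "s \<in> {0<..<t}"
      then have s': "s \<in> {0..T}" "s \<in> {0<..<T}" using t by auto
      show "(g has_vector_derivative - 4 * n1 s * n2 s * q1 s) (at s)" by (rule gd[OF s'(2)])
      have "2 * qmax * s \<le> 2 * qmax * t" using s qmax(1) by (intro mult_left_mono) auto
      then have "norm (n1 s) \<le> 2 * qmax * t" using n1_bound[OF s'(1)] by linarith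
      then have "4 * norm (n1 s) * norm (n2 s) * norm (q1 s) \<le> 4 * (2 * qmax * t) * N * qmax"
        using N(1) N(2)[OF s'(1)] qmax(1) qmax(2)[OF s'(1)] s by (intro mult_mono) auto
      then show "norm (- 4 * n1 s * n2 s * q1 s) \<le> 8 * qmax\<^sup>2 * N * t"
        by (simp add: norm_mult power2_eq_square algebra_simps)
    qed (use t in auto)
    then show ?thesis by (simp add: g_def n1_0)
  qed
  have 1: "norm (slope' t) \<le> 8 * qmax\<^sup>2 * N" if t: "t \<in> {0<..<T}" for t
  proof -
    have "slope' t = g t * (inverse (of_real t))\<^sup>2" by (simp add: slope'_def g_def algebra_simps)
    then have "norm (slope' t) = norm (g t) / t\<^sup>2"
      using t by (simp add: norm_mult norm_inverse norm_power divide_inverse power_inverse)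
    also have "\<dots> \<le> 8 * qmax\<^sup>2 * N" using gb[OF t] t by (simp add: divide_le_eq power2_eq_square mult.assoc)
    finally show ?thesis .
  qed
  obtain Q where Q: "0 \<le> Q" "\<And>t. t \<in> {0<..<T} \<Longrightarrow> norm (q1 t - q1 0) \<le> Q * t"
  proof -
    have "norm (q1 t - q1 0) \<le> (4 * qmax\<^sup>2 * N) * t" if "t \<in> {0<..<T}" for t
    proof (rule norm_increment_bound[OF cont(3) q1_deriv])
      fix s assume s: "s \<in> {0<..<T}"
      then have s': "s \<in> {0..T}" by auto
      have "norm (n1 s) * norm (n2 s) * norm (q1 s) \<le> (2 * qmax * s) * N * qmax"
        using N qmax(1) qmax(2)[OF s'] s n1_bound[OF s'] by (intro mult_mono) auto
      then show "norm (- 2 * \<kappa> * \<i> * n1 s * n2 s * q1 s / s) \<le> 4 * qmax\<^sup>2 * N"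
        using s kappa by (auto simp: norm_mult norm_divide divide_le_eq power2_eq_square algebra_simps)
    qed (use that in auto)
    then show thesis by (intro that[of "4 * qmax\<^sup>2 * N"]) (use N(1) in auto)
  qed
  have 2: "norm (slope t - slope 0) \<le> (8 * qmax\<^sup>2 * N + 2 * Q) * t" if t: "t \<in> {0<..<T}" for t
  proof -
    have eq: "slope t - slope 0 = - 2 * \<i> * \<kappa> * (q1 t - q1 0) - g t * inverse (of_real t)"
      using t by (simp add: slope_def g_def field_simps)
    have "norm (- 2 * \<i> * \<kappa> * (q1 t - q1 0)) \<le> 2 * Q * t"
      using Q(2)[OF t] kappa by (auto simp: norm_mult)
    moreover have "norm (g t * inverse (of_real t)) \<le> 8 * qmax\<^sup>2 * N * t"
      using gb[OF t] t by (simp add: norm_mult norm_divide divide_inverse[symmetric] divide_le_eq)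
    ultimately show ?thesis
      using norm_triangle_ineq4[of "- 2 * \<i> * \<kappa> * (q1 t - q1 0)" "g t * inverse (of_real t)"]
      unfolding eq distrib_right by linarith
  qed
  show ?thesis
  proof (intro exI conjI ballI)
    let ?B = "8 * qmax\<^sup>2 * N + 2 * Q"
    show "0 \<le> ?B" using N Q by simp
    fix t assume t: "t \<in> {0<..<T}"
    show "norm (slope' t) \<le> ?B" using 1[OF t] Q(1) by linarith
    show "norm (slope t - slope 0) \<le> ?B * t" by (rule 2[OF t])
  qed
qed

lemma slope_continuous: "continuous_on {0..T} slope"
proof -
  obtain B where B: "0 \<le> B" "\<And>t. t \<in> {0<..<T} \<Longrightarrow> norm (slope t - slope 0) \<le> B * t"
    using slope_bounds by auto
  have "continuous (at t within {0..T}) slope" if t: "t \<in> {0..T}" for t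
  proof (cases "t = 0")
    case True
    have "((\<lambda>t. slope t - slope 0) \<longlongrightarrow> 0) (at 0 within {0..T})"
    proof (rule Lim_null_comparison)
      have "\<forall>\<^sub>F t in at 0 within {0..T}. t < T"
        by (rule order_tendstoD(2)[OF tendsto_ident_at T])
      moreover have "\<forall>\<^sub>F t in at 0 within {0..T}. t \<in> {0..T} \<and> t \<noteq> 0"
        by (simp add: eventually_at_filter)
      ultimately show "\<forall>\<^sub>F t in at 0 within {0..T}. norm (slope t - slope 0) \<le> B * t"
        by eventually_elim (use B(2) in auto)
      show "((\<lambda>t. B * t) \<longlongrightarrow> 0) (at 0 within {0..T})"
        by (auto intro!: tendsto_eq_intros)
    qed
    then show ?thesis unfolding True continuous_within by (simp add: LIM_zero_iff)
  next
    case False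
    have "continuous_on {0<..T} (\<lambda>t. n1 t * inverse (of_real t))"
      by (intro continuous_intros continuous_on_subset[OF cont(1)]) auto
    then have "continuous_on {0<..T} slope"
      by (rule continuous_on_eq) (auto simp: slope_def)
    then have "continuous (at t within {0<..T}) slope"
      using t False by (simp add: continuous_on_eq_continuous_within)
    moreover have "at t within {0<..T} = at t within {0..T}"
      by (rule at_within_nhd[of _ "{0<..}"]) (use t False in auto)
    ultimately show ?thesis by (simp add: continuous_within)
  qed
  then show ?thesis by (simp add: continuous_on_eq_continuous_within)
qed

text \<open>Half the logarithmic derivative of \<open>ratio\<close>, the rate at which the
  eigenvectors of Q turn.\<close>

definition wkb_coeff :: "real \<Rightarrow> complex" where "wkb_coeff t = - \<kappa> * \<i> * slope t * n2 t"

lemma wkb_coeff_facts: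
  obtains M M' m' where "0 \<le> M" "0 \<le> M'" "continuous_on {0..T} wkb_coeff"
    "\<And>t. t \<in> {0<..<T} \<Longrightarrow> (wkb_coeff has_vector_derivative m' t) (at t)"
    "\<And>t. t \<in> {0..T} \<Longrightarrow> norm (wkb_coeff t) \<le> M" "\<And>t. t \<in> {0<..<T} \<Longrightarrow> norm (m' t) \<le> M'"
proof -
  have c: "continuous_on {0..T} wkb_coeff"
    unfolding wkb_coeff_def[abs_def] by (intro continuous_intros slope_continuous cont)
  obtain M where M: "0 \<le> M" "\<And>t. t \<in> {0..T} \<Longrightarrow> norm (wkb_coeff t) \<le> M"
    using bounded_by_on_interval[OF c] by auto
  obtain N where N: "0 \<le> N" "\<And>t. t \<in> {0..T} \<Longrightarrow> norm (n2 t) \<le> N"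
    using bounded_by_on_interval[OF cont(2)] by auto
  obtain S where S: "0 \<le> S" "\<And>t. t \<in> {0..T} \<Longrightarrow> norm (slope t) \<le> S"
    using bounded_by_on_interval[OF slope_continuous] by auto
  obtain B where B: "0 \<le> B" "\<And>t. t \<in> {0<..<T} \<Longrightarrow> norm (slope' t) \<le> B"
    using slope_bounds by auto
  let ?m' = "\<lambda>t. - \<kappa> * \<i> * (slope t * (2 * \<i> * \<kappa> * q2 t) + slope' t * n2 t)"
  have d: "(wkb_coeff has_vector_derivative ?m' t) (at t)" if t: "t \<in> {0<..<T}" for t
    unfolding wkb_coeff_def[abs_def]
    by (rule has_vector_derivative_eq_rhs,
        (rule has_vector_derivative_mult has_vector_derivative_const slope_deriv n2_deriv t)+) (simp add: algebra_simps)
  have b: "norm (?m' t) \<le> S * (2 * qmax) + B * N" if t: "t \<in> {0<..<T}" for t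
  proof -
    have t': "t \<in> {0..T}" using t by simp
    have "norm (slope t * (2 * \<i> * \<kappa> * q2 t) + slope' t * n2 t)
        \<le> norm (slope t) * (2 * norm (q2 t)) + norm (slope' t) * norm (n2 t)"
      using kappa by (intro order_trans[OF norm_triangle_ineq]) (auto simp: norm_mult)
    also have "\<dots> \<le> S * (2 * qmax) + B * N"
      using S B N qmax(1) qmax(3)[OF t'] t t' by (intro add_mono mult_mono) auto
    finally show ?thesis using kappa by (auto simp: norm_mult)
  qed
  show thesis
    by (rule that[of M "S * (2 * qmax) + B * N", OF _ _ c d M(2) b])
       (use M S B N qmax(1) in auto)
qed

text \<open>Q is i lam times the matrix with off-diagonal entries \<open>ratio\<close> and
  \<open>inv_ratio\<close>. Its eigenvectors are (1, inv_ratio) and (1, - inv_ratio) with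
  eigenvalues i lam and - i lam.\<close>

definition ratio :: "real \<Rightarrow> complex" where "ratio t = q1 t / (\<i> * lam)"
definition inv_ratio :: "real \<Rightarrow> complex" where "inv_ratio t = - \<i> * q2 t / lam"

lemma ratio_inv_ratio:
  assumes "t \<in> {0..T}"
  shows "ratio t * inv_ratio t = 1" "q1 t = \<i> * lam * ratio t" "q2 t = \<i> * lam * inv_ratio t"
  using q1q2[OF assms] lam by (simp_all add: ratio_def inv_ratio_def field_simps power2_eq_square)

lemma ratio_continuous: "continuous_on {0..T} ratio" "continuous_on {0..T} inv_ratio"
  unfolding ratio_def[abs_def] inv_ratio_def[abs_def] using lam by (intro continuous_intros cont; simp)+

lemma ratio_deriv:
  assumes t: "t \<in> {0<..<T}"
  shows "(ratio has_vector_derivative 2 * wkb_coeff t * ratio t) (at t)"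
    and "(inv_ratio has_vector_derivative - 2 * wkb_coeff t * inv_ratio t) (at t)"
proof -
  have "((\<lambda>t. q1 t * (1 / (\<i> * lam))) has_vector_derivative
      (- 2 * \<kappa> * \<i> * n1 t * n2 t * q1 t / t) * (1 / (\<i> * lam))) (at t)"
    by (intro has_vector_derivative_mult_left q1_deriv t)
  then show "(ratio has_vector_derivative 2 * wkb_coeff t * ratio t) (at t)"
    unfolding ratio_def[abs_def] using t by (simp add: wkb_coeff_def slope_def field_simps)
  have "((\<lambda>t. q2 t * (- \<i> / lam)) has_vector_derivative
      (2 * \<kappa> * \<i> * n1 t * n2 t * q2 t / t) * (- \<i> / lam)) (at t)"
    by (intro has_vector_derivative_mult_left q2_deriv t)
  then show "(inv_ratio has_vector_derivative - 2 * wkb_coeff t * inv_ratio t) (at t)"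
    unfolding inv_ratio_def[abs_def] using t by (simp add: wkb_coeff_def slope_def field_simps)
qed

text \<open>Start the flow at the eigenvector (1, \<sigma> inv_ratio 0) of Q(0) and remove the phase
  exp(- i \<sigma> lam y T). Then \<open>amp\<close> and \<open>refl_amp\<close> are the coordinates
  of the result along the eigenvectors (1, \<sigma> inv_ratio T) and (1, - \<sigma> inv_ratio T) of
  Q(T): the transmitted and the reflected part.\<close>

definition amp :: "real \<Rightarrow> real \<Rightarrow> complex" where
  "amp \<sigma> y = exp (\<i> * \<sigma> * lam * y * T) / 2 *
     (H1 1 (\<sigma> * inv_ratio 0) y T + \<sigma> * ratio T * H2 1 (\<sigma> * inv_ratio 0) y T)"

definition refl_amp :: "real \<Rightarrow> real \<Rightarrow> complex" where
  "refl_amp \<sigma> y = exp (\<i> * \<sigma> * lam * y * T) / 2 *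
     (H1 1 (\<sigma> * inv_ratio 0) y T - \<sigma> * ratio T * H2 1 (\<sigma> * inv_ratio 0) y T)"

lemma H_amp:
  assumes "\<sigma> \<in> {1, -1}"
  shows "exp (\<i> * \<sigma> * lam * y * T) * H1 1 (\<sigma> * inv_ratio 0) y T = amp \<sigma> y + refl_amp \<sigma> y"
    and "exp (\<i> * \<sigma> * lam * y * T) * (ratio T * H2 1 (\<sigma> * inv_ratio 0) y T) = \<sigma> * (amp \<sigma> y - refl_amp \<sigma> y)"
  using assms by (auto simp: amp_def refl_amp_def field_simps)

text \<open>The instance of \<open>oscillating_system\<close> with frequency \<sigma> lam y. The
  transmitted amplitude approaches a square root of inv_ratio 0 / inv_ratio T; stating this for its
  square avoids following a branch of the root along the path.\<close>

lemma amp_bounds: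
  "\<exists>C. \<forall>y \<sigma>. y \<noteq> 0 \<longrightarrow> \<sigma> \<in> {1, -1} \<longrightarrow>
     norm (refl_amp \<sigma> y) \<le> C / \<bar>y\<bar> \<and> norm ((amp \<sigma> y)\<^sup>2 * inv_ratio T - inv_ratio 0) \<le> C / \<bar>y\<bar>"
proof -
  obtain M M' m' where M: "0 \<le> M" "0 \<le> M'" "continuous_on {0..T} wkb_coeff"
    "\<And>t. t \<in> {0<..<T} \<Longrightarrow> (wkb_coeff has_vector_derivative m' t) (at t)"
    "\<And>t. t \<in> {0..T} \<Longrightarrow> norm (wkb_coeff t) \<le> M" "\<And>t. t \<in> {0<..<T} \<Longrightarrow> norm (m' t) \<le> M'"
    by (rule wkb_coeff_facts) (rule that; assumption)
  obtain R where R: "0 \<le> R" "\<And>t. t \<in> {0..T} \<Longrightarrow> norm (inv_ratio t) \<le> R"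
    using bounded_by_on_interval[OF ratio_continuous(2)] by auto
  define A where "A = exp (2 * M * T)"
  define D where "D = (M' * A + 2 * M\<^sup>2 * A + M\<^sup>2 * A) / 2"
  define C where "C = (D + M / 2) * exp ((M + 1) * T) + M * A / 2"
  define K where "K = (\<bar>C\<bar> + \<bar>2 * M * A * C * R * T\<bar>) / lam"
  have "norm (refl_amp \<sigma> y) \<le> K / \<bar>y\<bar> \<and> norm ((amp \<sigma> y)\<^sup>2 * inv_ratio T - inv_ratio 0) \<le> K / \<bar>y\<bar>"
    if y: "y \<noteq> 0" and s: "\<sigma> \<in> {1, -1}" for y \<sigma> :: real
  proof -
    let ?e = "\<lambda>t. exp (\<i> * \<sigma> * lam * y * of_real t)"
    let ?h1 = "H1 1 (\<sigma> * inv_ratio 0) y" and ?h2 = "H2 1 (\<sigma> * inv_ratio 0) y"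
    define E where "E = (\<lambda>t. ?e t * (1 / 2 * (?h1 t + \<sigma> * (ratio t * ?h2 t))))"
    define p where "p = (\<lambda>t. ?e t * (1 / 2 * (?h1 t - \<sigma> * (ratio t * ?h2 t))))"
    have de: "(?e has_vector_derivative \<i> * \<sigma> * lam * y * ?e t) (at t)" for t
      by (rule has_vector_derivative_real_field) (auto intro!: derivative_eq_intros)
    have sig: "of_real \<sigma> * (of_real \<sigma> * z) = z" for z :: complex using s by auto
    have iis: "\<i> * (\<i> * z) = - z" for z by (simp add: mult.assoc[symmetric])
    have sr: "ratio t * (inv_ratio t * z) = z" "inv_ratio t * (ratio t * z) = z" "inv_ratio t * ratio t = 1" if "t \<in> {0..T}" for t z
    proof -
      show *: "inv_ratio t * ratio t = 1" using ratio_inv_ratio(1)[OF that] by (simp only: mult.commute)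
      show "ratio t * (inv_ratio t * z) = z" "inv_ratio t * (ratio t * z) = z"
        by (simp_all only: mult.assoc[symmetric] ratio_inv_ratio(1)[OF that] * mult_1_left)
    qed
    have c: "continuous_on {0..T} E" "continuous_on {0..T} p"
      unfolding E_def p_def by (intro continuous_intros HJ_continuous ratio_continuous)+
    have 00: "0 \<in> {0..T}" using T by simp
    have i: "E 0 = 1" "p 0 = 0"
      using s ratio_inv_ratio(1)[OF 00] by (auto simp: E_def p_def HJ_at_0)
    have EP: "E t - p t = \<sigma> * (?e t * (ratio t * ?h2 t))" "p t - E t = - \<sigma> * (?e t * (ratio t * ?h2 t))" for t
      by (simp_all add: E_def p_def algebra_simps)
    have dE: "(E has_vector_derivative wkb_coeff t * (E t - p t)) (at t)" if t: "t \<in> {0<..<T}" for t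
    proof -
      have t': "t \<in> {0..T}" using t by simp
      show ?thesis
        unfolding EP unfolding E_def
        by (rule has_vector_derivative_eq_rhs,
            (rule has_vector_derivative_mult has_vector_derivative_const has_vector_derivative_add
              has_vector_derivative_diff de H_deriv ratio_deriv t)+)
           (simp add: ratio_inv_ratio(2,3)[OF t'] algebra_simps sig sr[OF t'] iis)
    qed
    have dp: "(p has_vector_derivative 2 * \<i> * of_real (\<sigma> * lam * y) * p t + wkb_coeff t * (p t - E t)) (at t)"
      if t: "t \<in> {0<..<T}" for t
    proof -
      have t': "t \<in> {0..T}" using t by simp
      show ?thesis
        unfolding EP unfolding p_def
        by (rule has_vector_derivative_eq_rhs,
            (rule has_vector_derivative_mult has_vector_derivative_const has_vector_derivative_add
              has_vector_derivative_diff de H_deriv ratio_deriv t)+)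
           (simp add: ratio_inv_ratio(2,3)[OF t'] algebra_simps sig sr[OF t'] iis)
    qed
    have w: "\<sigma> * lam * y \<noteq> 0" "\<bar>\<sigma> * lam * y\<bar> = lam * \<bar>y\<bar>"
      using y s lam by (auto simp: abs_mult)
    have "norm (p T) \<le> C / \<bar>\<sigma> * lam * y\<bar>"
      "norm ((E T)\<^sup>2 * inv_ratio T - inv_ratio 0) \<le> 2 * M * A * C * R * T / \<bar>\<sigma> * lam * y\<bar>"
      by (rule oscillating_system[OF w(1) T M(1,2) R(1) c M(3) ratio_continuous(2) i dE dp M(4)
        ratio_deriv(2) M(5,6) R(2) A_def D_def C_def]; assumption)+
    moreover have "C / (lam * \<bar>y\<bar>) \<le> K / \<bar>y\<bar>" "2 * M * A * C * R * T / (lam * \<bar>y\<bar>) \<le> K / \<bar>y\<bar>"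
    proof -
      have "x / (lam * \<bar>y\<bar>) \<le> K / \<bar>y\<bar>" if "x \<le> \<bar>C\<bar> + \<bar>2 * M * A * C * R * T\<bar>" for x
      proof -
        have "x / (lam * \<bar>y\<bar>) \<le> (\<bar>C\<bar> + \<bar>2 * M * A * C * R * T\<bar>) / (lam * \<bar>y\<bar>)"
          using that lam by (intro divide_right_mono) auto
        then show ?thesis by (simp add: K_def)
      qed
      from this[of C] this[of "2 * M * A * C * R * T"]
      show "C / (lam * \<bar>y\<bar>) \<le> K / \<bar>y\<bar>" "2 * M * A * C * R * T / (lam * \<bar>y\<bar>) \<le> K / \<bar>y\<bar>"
        by linarith+
    qed
    moreover have "refl_amp \<sigma> y = p T" "amp \<sigma> y = E T"
      by (simp_all add: refl_amp_def amp_def E_def p_def mult.assoc)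
    ultimately show ?thesis unfolding w(2) by (auto intro: order_trans)
  qed
  then show ?thesis by blast
qed

end

section \<open>Connection with the triangular equation\<close>

locale lax_flow_primitive = lax_flow +
  fixes E :: "complex \<Rightarrow> complex"
  assumes E_deriv: "\<And>z. (E has_field_derivative exp (- 2 * \<i> * \<kappa> * z\<^sup>2)) (at z)"
    and E_0: "E 0 = 0"
begin

text \<open>The pair \<open>(v, w)\<close> gives the coordinates of a solution in a fundamental
  system of the triangular equation, whose inhomogeneous part is integrated by \<open>E\<close>.
  Since \<open>E\<close> vanishes at 0, the pair is also the limit of the dressed solution as x
  tends to 0.\<close>

definition represents ::
    "(complex \<Rightarrow> complex) \<Rightarrow> (complex \<Rightarrow> complex) \<Rightarrow> complex \<Rightarrow> complex \<Rightarrow> bool" where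
  "represents b a v w \<longleftrightarrow> (\<forall>\<zeta>.
     dress1 b a \<zeta> = exp (- \<i> * \<kappa> * (xv \<zeta>)\<^sup>2) * v \<and>
     dress2 b a \<zeta> = exp (\<i> * \<kappa> * (xv \<zeta>)\<^sup>2) * (w + 2 * n2 0 * v * E (xv \<zeta>)))"

lemma represents_exists:
  assumes "rotated_system b a"
  shows "\<exists>v w. represents b a v w"
proof -
  let ?x = xv
  define v where "v = exp (\<i> * \<kappa> * (xv 0)\<^sup>2) * dress1 b a 0"
  define f where "f = (\<lambda>\<zeta>. exp (- \<i> * \<kappa> * (xv \<zeta>)\<^sup>2) * dress2 b a \<zeta> - 2 * n2 0 * v * E (xv \<zeta>))"
  have e: "exp (\<i> * \<kappa> * z) * exp (- \<i> * \<kappa> * z) = 1" for z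
    by (simp add: mult_exp_exp)
  have cancel: "q = exp (- \<i> * \<kappa> * z) * r" if "exp (\<i> * \<kappa> * z) * q = r" for q r z
    unfolding that[symmetric] mult.assoc[symmetric] using e[of z] by (simp add: mult.commute)
  have cancel': "q = exp (\<i> * \<kappa> * z) * r" if "exp (- \<i> * \<kappa> * z) * q = r" for q r z
    unfolding that[symmetric] mult.assoc[symmetric] using e[of z] by simp
  have "(\<lambda>\<zeta>. exp (\<i> * \<kappa> * (xv \<zeta>)\<^sup>2) * dress1 b a \<zeta>) \<zeta> = (\<lambda>\<zeta>. exp (\<i> * \<kappa> * (xv \<zeta>)\<^sup>2) * dress1 b a \<zeta>) 0" for \<zeta>
  proof (rule constant_if_field_derivative_zero)
    fix \<zeta>
    have "((\<lambda>\<zeta>. exp (\<i> * \<kappa> * (xv \<zeta>)\<^sup>2)) has_field_derivative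
        2 * \<i> * \<kappa> * (xv \<zeta>)\<^sup>2 * exp (\<i> * \<kappa> * (xv \<zeta>)\<^sup>2)) (at \<zeta>)"
      by (rule derivative_eq_intros xv_deriv refl)+ (simp add: power2_eq_square)
    from DERIV_mult[OF this dressed_deriv(1)[OF assms, of \<zeta>]]
    show "((\<lambda>\<zeta>. exp (\<i> * \<kappa> * (xv \<zeta>)\<^sup>2) * dress1 b a \<zeta>) has_field_derivative 0) (at \<zeta>)"
      by (rule DERIV_cong) (simp add: algebra_simps)
  qed
  then have "exp (\<i> * \<kappa> * (xv \<zeta>)\<^sup>2) * dress1 b a \<zeta> = v" for \<zeta> by (simp add: v_def)
  then have 1: "dress1 b a \<zeta> = exp (- \<i> * \<kappa> * (xv \<zeta>)\<^sup>2) * v" for \<zeta>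
    by (rule cancel)
  have fc: "f \<zeta> = f 0" for \<zeta>
  proof (rule constant_if_field_derivative_zero)
    fix \<zeta>
    have d1: "((\<lambda>\<zeta>. exp (- \<i> * \<kappa> * (xv \<zeta>)\<^sup>2)) has_field_derivative
        - 2 * \<i> * \<kappa> * (xv \<zeta>)\<^sup>2 * exp (- \<i> * \<kappa> * (xv \<zeta>)\<^sup>2)) (at \<zeta>)"
      by (rule derivative_eq_intros xv_deriv refl)+ (simp add: power2_eq_square)
    have d2: "((\<lambda>\<zeta>. E (xv \<zeta>)) has_field_derivative exp (- 2 * \<i> * \<kappa> * (xv \<zeta>)\<^sup>2) * xv \<zeta>) (at \<zeta>)"
      by (rule DERIV_chain2[OF E_deriv xv_deriv])
    have e2: "exp (- 2 * \<i> * \<kappa> * (xv \<zeta>)\<^sup>2) = exp (- \<i> * \<kappa> * (xv \<zeta>)\<^sup>2) * exp (- \<i> * \<kappa> * (xv \<zeta>)\<^sup>2)"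
      unfolding mult_exp_exp by (rule arg_cong[where f = exp]) (simp add: algebra_simps)
    show "(f has_field_derivative 0) (at \<zeta>)"
      using DERIV_diff[OF DERIV_mult[OF d1 dressed_deriv(2)[OF assms]] DERIV_cmult[OF d2, of "2 * n2 0 * v"]]
      unfolding f_def by (rule DERIV_cong) (simp only: 1 e2, simp add: algebra_simps)
  qed
  have "exp (- \<i> * \<kappa> * (xv \<zeta>)\<^sup>2) * dress2 b a \<zeta> = f 0 + 2 * n2 0 * v * E (xv \<zeta>)" for \<zeta>
  proof -
    have "exp (- \<i> * \<kappa> * (xv \<zeta>)\<^sup>2) * dress2 b a \<zeta> = f \<zeta> + 2 * n2 0 * v * E (xv \<zeta>)"
      by (simp add: f_def)
    then show ?thesis unfolding fc[of \<zeta>] .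
  qed
  then have "dress2 b a \<zeta> = exp (\<i> * \<kappa> * (xv \<zeta>)\<^sup>2) * (f 0 + 2 * n2 0 * v * E (xv \<zeta>))" for \<zeta>
    by (rule cancel')
  with 1 show ?thesis unfolding represents_def by blast
qed

lemma represents_unique:
  assumes "represents b a v w" "represents b a v' w'"
  shows "v = v'" "w = w'"
proof -
  from assms have "exp (- \<i> * \<kappa> * (xv 0)\<^sup>2) * v = exp (- \<i> * \<kappa> * (xv 0)\<^sup>2) * v'"
    unfolding represents_def by simp
  then show "v = v'" by simp
  from assms have "exp (\<i> * \<kappa> * (xv 0)\<^sup>2) * (w + 2 * n2 0 * v * E (xv 0)) =
      exp (\<i> * \<kappa> * (xv 0)\<^sup>2) * (w' + 2 * n2 0 * v' * E (xv 0))"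
    unfolding represents_def by metis
  then show "w = w'" unfolding \<open>v = v'\<close> by simp
qed

lemma represents_linear:
  assumes "represents b a v w" "represents b' a' v' w'"
  shows "represents (\<lambda>\<zeta>. b \<zeta> * c + b' \<zeta> * d) (\<lambda>\<zeta>. a \<zeta> * c + a' \<zeta> * d) (v * c + v' * d) (w * c + w' * d)"
proof -
  have "dress1 (\<lambda>\<zeta>. b \<zeta> * c + b' \<zeta> * d) (\<lambda>\<zeta>. a \<zeta> * c + a' \<zeta> * d) \<zeta> = dress1 b a \<zeta> * c + dress1 b' a' \<zeta> * d"
    "dress2 (\<lambda>\<zeta>. b \<zeta> * c + b' \<zeta> * d) (\<lambda>\<zeta>. a \<zeta> * c + a' \<zeta> * d) \<zeta> = dress2 b a \<zeta> * c + dress2 b' a' \<zeta> * d" for \<zeta>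
    by (simp_all add: dress1_def dress2_def algebra_simps)
  then show ?thesis
    using assms by (simp add: represents_def algebra_simps)
qed

lemma E_continuous: "isCont E z"
  using E_deriv DERIV_isCont by blast

text \<open>On a ray with exp(i \<theta>) real, x and y are real and y is unbounded as x tends to 0,
  so \<open>amp_bounds\<close> applies to the flow matrix. The dressed solution tends to
  \<open>(v, w)\<close>; expanding it in eigenvectors of Q(0), only the mode with the phase of the
  given solution may survive, and its amplitude is transported by the adiabatic invariant.\<close>

lemma connection_at_zero:
  fixes \<theta> sg \<sigma> :: real and \<delta> :: complex
  assumes rep: "represents b a v w"
    and ray: "exp (\<i> * \<theta>) = of_real sg" "sg \<in> {1, -1}" and sigma: "\<sigma> \<in> {1, -1}"
    and lim_b: "((\<lambda>r. exp (\<i> * \<sigma> * lam * T * yv (of_real r + \<i> * \<theta>)) * b (of_real r + \<i> * \<theta>)) \<longlongrightarrow> \<delta>) at_bot"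
    and lim_a: "((\<lambda>r. exp (\<i> * \<sigma> * lam * T * yv (of_real r + \<i> * \<theta>)) * (ratio T * a (of_real r + \<i> * \<theta>))) \<longlongrightarrow> \<sigma> * \<delta>) at_bot"
  shows "w = \<sigma> * inv_ratio 0 * v" and "v\<^sup>2 * inv_ratio 0 = \<delta>\<^sup>2 * inv_ratio T"
proof -
  let ?z = "\<lambda>r. complex_of_real r + \<i> * \<theta>"
  define Y where "Y = (\<lambda>r. sg / (sqrt T * exp r))"
  have x: "xv (?z r) = of_real (sg * (sqrt T * exp r))" for r
    unfolding xv_def exp_add ray exp_of_real by simp
  have Y: "yv (?z r) = of_real (Y r)" for r
    using ray(2) unfolding yv_def x Y_def by auto
  have Y0: "Y r \<noteq> 0" for r using ray(2) T by (auto simp: Y_def)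
  have absY: "1 / \<bar>Y r\<bar> = sqrt T * exp r" for r
    using ray(2) T by (auto simp: Y_def abs_mult)
  have small: "((\<lambda>r. C / \<bar>Y r\<bar>) \<longlongrightarrow> 0) at_bot" for C
  proof -
    have "((\<lambda>r. C * (sqrt T * exp r)) \<longlongrightarrow> C * (sqrt T * 0)) at_bot"
      by (intro tendsto_intros exp_at_bot)
    then show ?thesis by (simp add: absY[symmetric] divide_inverse)
  qed
  obtain C where C: "\<And>y \<sigma>. y \<noteq> 0 \<Longrightarrow> \<sigma> \<in> {1, -1} \<Longrightarrow>
     norm (refl_amp \<sigma> y) \<le> C / \<bar>y\<bar> \<and> norm ((amp \<sigma> y)\<^sup>2 * inv_ratio T - inv_ratio 0) \<le> C / \<bar>y\<bar>"
    using amp_bounds by blast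
  have refl0: "((\<lambda>r. refl_amp \<rho> (Y r)) \<longlongrightarrow> 0) at_bot" if "\<rho> \<in> {1, -1}" for \<rho>
    by (rule Lim_null_comparison[OF _ small[of C]]) (use C Y0 that in auto)
  have amp0: "((\<lambda>r. (amp \<rho> (Y r))\<^sup>2 * inv_ratio T) \<longlongrightarrow> inv_ratio 0) at_bot" if "\<rho> \<in> {1, -1}" for \<rho>
    by (rule LIM_zero_cancel, rule Lim_null_comparison[OF _ small[of C]]) (use C Y0 that in auto)
  have s00: "0 \<in> {0..T}" "T \<in> {0..T}" using T by auto
  have sr0: "ratio 0 * inv_ratio 0 = 1" and r0: "inv_ratio 0 \<noteq> 0" and srT: "ratio T * inv_ratio T = 1"
    using ratio_inv_ratio(1)[OF s00(1)] ratio_inv_ratio(1)[OF s00(2)] by auto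
  define l1 where "l1 = (\<lambda>r. dress1 b a (?z r))"
  define l2 where "l2 = (\<lambda>r. dress2 b a (?z r))"
  have xlim: "((\<lambda>r. xv (?z r)) \<longlongrightarrow> 0) at_bot"
  proof -
    have "((\<lambda>r. complex_of_real (sg * (sqrt T * exp r))) \<longlongrightarrow> of_real (sg * (sqrt T * 0))) at_bot"
      by (intro tendsto_intros exp_at_bot)
    then show ?thesis unfolding x by simp
  qed
  have l1: "(l1 \<longlongrightarrow> v) at_bot"
  proof -
    have "((\<lambda>r. exp (- \<i> * \<kappa> * (xv (?z r))\<^sup>2) * v) \<longlongrightarrow> exp (- \<i> * \<kappa> * 0\<^sup>2) * v) at_bot"
      by (intro tendsto_intros xlim)
    then show ?thesis using rep by (simp add: l1_def represents_def)
  qed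
  have l2: "(l2 \<longlongrightarrow> w) at_bot"
  proof -
    have "((\<lambda>r. exp (\<i> * \<kappa> * (xv (?z r))\<^sup>2) * (w + 2 * n2 0 * v * E (xv (?z r)))) \<longlongrightarrow>
        exp (\<i> * \<kappa> * 0\<^sup>2) * (w + 2 * n2 0 * v * E 0)) at_bot"
      by (intro tendsto_intros xlim isCont_tendsto_compose[OF E_continuous])
    then show ?thesis using rep by (simp add: l2_def represents_def E_0)
  qed
  \<comment> \<open>Coordinates of the dressed vector along the eigenvectors of Q(0), with
    \<open>c0\<close> and \<open>d0\<close> their limits.\<close>
  define c where "c = (\<lambda>r. (l1 r + \<sigma> * ratio 0 * l2 r) / 2)"
  define d where "d = (\<lambda>r. (l1 r - \<sigma> * ratio 0 * l2 r) / 2)"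
  define c0 where "c0 = (v + \<sigma> * ratio 0 * w) / 2"
  define d0 where "d0 = (v - \<sigma> * ratio 0 * w) / 2"
  have clim: "(c \<longlongrightarrow> c0) at_bot" and dlim: "(d \<longlongrightarrow> d0) at_bot"
    unfolding c_def d_def c0_def d0_def by (intro tendsto_intros l1 l2; simp)+
  have sig: "of_real \<sigma> * (of_real \<sigma> * z) = z" for z :: complex using sigma by auto
  have ll: "l1 r = c r + d r" "l2 r = (\<sigma> * inv_ratio 0) * c r + (- \<sigma> * inv_ratio 0) * d r" for r
  proof -
    show "l1 r = c r + d r" by (simp add: c_def d_def field_simps)
    have "(\<sigma> * inv_ratio 0) * c r + (- \<sigma> * inv_ratio 0) * d r = of_real \<sigma> * (of_real \<sigma> * (ratio 0 * inv_ratio 0 * l2 r))"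
      by (simp add: c_def d_def field_simps)
    then show "l2 r = (\<sigma> * inv_ratio 0) * c r + (- \<sigma> * inv_ratio 0) * d r" by (simp add: sig sr0)
  qed
  let ?y = "\<lambda>r. complex_of_real (Y r)"
  have ba: "b (?z r) = c r * H1 1 (\<sigma> * inv_ratio 0) (?y r) T + d r * H1 1 (- \<sigma> * inv_ratio 0) (?y r) T"
    "a (?z r) = c r * H2 1 (\<sigma> * inv_ratio 0) (?y r) T + d r * H2 1 (- \<sigma> * inv_ratio 0) (?y r) T" for r
  proof -
    have "b (?z r) = H11 (?y r) T * l1 r + H12 (?y r) T * l2 r"
      "a (?z r) = H21 (?y r) T * l1 r + H22 (?y r) T * l2 r"
      using undress[of b "?z r" a] undress(2)[of a "?z r" b] unfolding l1_def l2_def Y by auto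
    then show "b (?z r) = c r * H1 1 (\<sigma> * inv_ratio 0) (?y r) T + d r * H1 1 (- \<sigma> * inv_ratio 0) (?y r) T"
      "a (?z r) = c r * H2 1 (\<sigma> * inv_ratio 0) (?y r) T + d r * H2 1 (- \<sigma> * inv_ratio 0) (?y r) T"
      unfolding ll H_linear[OF s00(2), of 1 "\<sigma> * inv_ratio 0"] H_linear[OF s00(2), of 1 "- \<sigma> * inv_ratio 0"]
      by (simp_all add: algebra_simps)
  qed
  \<comment> \<open>Relative to the phase \<open>e\<close>, the opposite mode carries the factor
    e^2. It has modulus 1 but no limit, so the terms containing it are treated through their
    norms.\<close>
  define e where "e = (\<lambda>r. exp (\<i> * \<sigma> * lam * Y r * T))"
  define e' where "e' = (\<lambda>r. exp (\<i> * complex_of_real (- \<sigma>) * lam * Y r * T))"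
  have ee: "e r = e r * e r * e' r" for r
    unfolding e_def e'_def mult_exp_exp by (rule arg_cong[where f = exp]) simp
  have e1: "norm (e r) = 1" for r
    using norm_exp_i_times[of "\<sigma> * lam * Y r * T"] by (simp add: e_def mult.assoc)
  have sigma': "- \<sigma> \<in> {1, -1}" using sigma by auto
  have Hc: "e r * H1 1 (\<sigma> * inv_ratio 0) (?y r) T = amp \<sigma> (Y r) + refl_amp \<sigma> (Y r)"
    "e r * (ratio T * H2 1 (\<sigma> * inv_ratio 0) (?y r) T) = \<sigma> * (amp \<sigma> (Y r) - refl_amp \<sigma> (Y r))"
    "e' r * H1 1 (- \<sigma> * inv_ratio 0) (?y r) T = amp (- \<sigma>) (Y r) + refl_amp (- \<sigma>) (Y r)"
    "e' r * (ratio T * H2 1 (- \<sigma> * inv_ratio 0) (?y r) T) = - \<sigma> * (amp (- \<sigma>) (Y r) - refl_amp (- \<sigma>) (Y r))" for r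
    using H_amp[OF sigma, of "Y r"] H_amp[OF sigma', of "Y r"] unfolding e_def e'_def by simp_all
  have B: "e r * b (?z r) = c r * (amp \<sigma> (Y r) + refl_amp \<sigma> (Y r))
      + d r * (e r * e r * (amp (- \<sigma>) (Y r) + refl_amp (- \<sigma>) (Y r)))" for r
  proof -
    have "e r * b (?z r) = c r * (e r * H1 1 (\<sigma> * inv_ratio 0) (?y r) T)
        + d r * (e r * e r * e' r * H1 1 (- \<sigma> * inv_ratio 0) (?y r) T)"
      unfolding ba ee[of r, symmetric] by (simp add: algebra_simps)
    also have "\<dots> = c r * (e r * H1 1 (\<sigma> * inv_ratio 0) (?y r) T)
        + d r * (e r * e r * (e' r * H1 1 (- \<sigma> * inv_ratio 0) (?y r) T))"
      by (simp add: mult.assoc)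
    finally show ?thesis unfolding Hc .
  qed
  have A: "\<sigma> * (e r * (ratio T * a (?z r))) = c r * (amp \<sigma> (Y r) - refl_amp \<sigma> (Y r))
      - d r * (e r * e r * (amp (- \<sigma>) (Y r) - refl_amp (- \<sigma>) (Y r)))" for r
  proof -
    have "e r * (ratio T * a (?z r)) = c r * (e r * (ratio T * H2 1 (\<sigma> * inv_ratio 0) (?y r) T))
        + d r * (e r * e r * e' r * (ratio T * H2 1 (- \<sigma> * inv_ratio 0) (?y r) T))"
      unfolding ba ee[of r, symmetric] by (simp add: algebra_simps)
    also have "\<dots> = c r * (e r * (ratio T * H2 1 (\<sigma> * inv_ratio 0) (?y r) T))
        + d r * (e r * e r * (e' r * (ratio T * H2 1 (- \<sigma> * inv_ratio 0) (?y r) T)))"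
      by (simp add: mult.assoc)
    finally have "e r * (ratio T * a (?z r)) = \<sigma> * (c r * (amp \<sigma> (Y r) - refl_amp \<sigma> (Y r))
      - d r * (e r * e r * (amp (- \<sigma>) (Y r) - refl_amp (- \<sigma>) (Y r))))"
      unfolding Hc by (simp add: algebra_simps)
    then show ?thesis by (simp only: sig)
  qed
  have limb: "((\<lambda>r. e r * b (?z r)) \<longlongrightarrow> \<delta>) at_bot"
    using lim_b unfolding e_def Y by (simp add: ac_simps)
  have lima: "((\<lambda>r. \<sigma> * (e r * (ratio T * a (?z r)))) \<longlongrightarrow> \<delta>) at_bot"
  proof -
    have "((\<lambda>r. e r * (ratio T * a (?z r))) \<longlongrightarrow> \<sigma> * \<delta>) at_bot"
      using lim_a unfolding e_def Y by (simp add: ac_simps)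
    from tendsto_mult_left[OF this, of "of_real \<sigma>"] show ?thesis by (simp only: sig)
  qed
  have eq1: "(e r * b (?z r) - \<sigma> * (e r * (ratio T * a (?z r)))) / 2 - c r * refl_amp \<sigma> (Y r)
      = d r * (e r * e r * amp (- \<sigma>) (Y r))" for r
    unfolding A B by (simp add: field_simps)
  have eq2: "(e r * b (?z r) + \<sigma> * (e r * (ratio T * a (?z r)))) / 2 -
      d r * (e r * e r * refl_amp (- \<sigma>) (Y r)) = c r * amp \<sigma> (Y r)" for r
    unfolding A B by (simp add: field_simps)
  have "((\<lambda>r. (e r * b (?z r) - \<sigma> * (e r * (ratio T * a (?z r)))) / 2 - c r * refl_amp \<sigma> (Y r))
      \<longlongrightarrow> (\<delta> - \<delta>) / 2 - c0 * 0) at_bot"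
    by (intro tendsto_intros limb lima clim refl0 sigma) simp
  then have "((\<lambda>r. d r * (e r * e r * amp (- \<sigma>) (Y r))) \<longlongrightarrow> 0) at_bot"
    unfolding eq1 by simp
  then have "((\<lambda>r. norm (d r * (e r * e r * amp (- \<sigma>) (Y r)))) \<longlongrightarrow> 0) at_bot"
    by (rule tendsto_norm_zero)
  then have "((\<lambda>r. norm (d r * amp (- \<sigma>) (Y r))) \<longlongrightarrow> 0) at_bot"
    by (simp add: norm_mult e1)
  then have "((\<lambda>r. d r * amp (- \<sigma>) (Y r)) \<longlongrightarrow> 0) at_bot"
    by (rule tendsto_norm_zero_cancel)
  then have "((\<lambda>r. (d r * amp (- \<sigma>) (Y r))\<^sup>2 * inv_ratio T) \<longlongrightarrow> 0\<^sup>2 * inv_ratio T) at_bot"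
    by (intro tendsto_intros)
  moreover have "((\<lambda>r. (d r)\<^sup>2 * ((amp (- \<sigma>) (Y r))\<^sup>2 * inv_ratio T)) \<longlongrightarrow> d0\<^sup>2 * inv_ratio 0) at_bot"
    by (intro tendsto_intros dlim amp0 sigma')
  \<comment> \<open>The squared amplitude of the opposite mode, multiplied by inv_ratio T, has the
    nonzero limit inv_ratio 0. The product can vanish in the limit only if \<open>d0\<close>
    does.\<close>
  ultimately have "d0\<^sup>2 * inv_ratio 0 = 0\<^sup>2 * inv_ratio T"
    by (intro tendsto_unique[OF _ _ \<open>((\<lambda>r. (d r * amp (- \<sigma>) (Y r))\<^sup>2 * inv_ratio T) \<longlongrightarrow> 0\<^sup>2 * inv_ratio T) at_bot\<close>])
       (auto simp: power_mult_distrib mult.assoc)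
  then have d0: "d0 = 0" using r0 by simp
  then have v: "v = \<sigma> * ratio 0 * w" by (simp add: d0_def)
  then have "inv_ratio 0 * v = of_real \<sigma> * (ratio 0 * inv_ratio 0 * w)" by (simp add: ac_simps)
  then have "\<sigma> * inv_ratio 0 * v = of_real \<sigma> * (of_real \<sigma> * w)" by (simp add: sr0 mult.assoc)
  then show "w = \<sigma> * inv_ratio 0 * v" by (simp only: sig)
  have c0: "c0 = v" using d0 by (simp add: c0_def d0_def)
  have dp: "((\<lambda>r. d r * (e r * e r * refl_amp (- \<sigma>) (Y r))) \<longlongrightarrow> 0) at_bot"
  proof (rule tendsto_norm_zero_cancel)
    have "((\<lambda>r. norm (d r * refl_amp (- \<sigma>) (Y r))) \<longlongrightarrow> 0) at_bot"
      using tendsto_mult[OF dlim refl0[OF sigma']] by (intro tendsto_norm_zero) simp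
    then show "((\<lambda>r. norm (d r * (e r * e r * refl_amp (- \<sigma>) (Y r)))) \<longlongrightarrow> 0) at_bot"
      by (simp add: norm_mult e1)
  qed
  have "((\<lambda>r. (e r * b (?z r) + \<sigma> * (e r * (ratio T * a (?z r)))) / 2 -
      d r * (e r * e r * refl_amp (- \<sigma>) (Y r))) \<longlongrightarrow> (\<delta> + \<delta>) / 2 - 0) at_bot"
    by (intro tendsto_intros limb lima dp) simp
  then have "((\<lambda>r. c r * amp \<sigma> (Y r)) \<longlongrightarrow> \<delta>) at_bot"
    unfolding eq2 by simp
  then have "((\<lambda>r. (c r * amp \<sigma> (Y r))\<^sup>2 * inv_ratio T) \<longlongrightarrow> \<delta>\<^sup>2 * inv_ratio T) at_bot"
    by (intro tendsto_intros)
  moreover have "((\<lambda>r. (c r)\<^sup>2 * ((amp \<sigma> (Y r))\<^sup>2 * inv_ratio T)) \<longlongrightarrow> v\<^sup>2 * inv_ratio 0) at_bot"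
    unfolding c0[symmetric] by (intro tendsto_intros clim amp0 sigma)
  ultimately show "v\<^sup>2 * inv_ratio 0 = \<delta>\<^sup>2 * inv_ratio T"
    by (intro tendsto_unique[OF _ _ \<open>((\<lambda>r. (c r * amp \<sigma> (Y r))\<^sup>2 * inv_ratio T) \<longlongrightarrow> \<delta>\<^sup>2 * inv_ratio T) at_bot\<close>])
       (auto simp: power_mult_distrib mult.assoc)
qed

section \<open>Asymptotics on rays to infinity\<close>

definition J :: complex where "J = of_real (sqrt pi / (2 * sqrt 2))"

lemma i_kappa_cancel: "\<i> * \<kappa> * (z * (- \<i> * \<kappa>)) = z"
  using kappa by (auto simp: complex_eq_iff)

text \<open>In a direction \<eta> with square - i \<kappa> the integrand of \<open>E\<close> is
  exp(-2 s^2), so the limit is \<eta> times the Gaussian integral \<open>J\<close> over the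
  half-line.\<close>

lemma E_limit:
  assumes eta: "\<eta>\<^sup>2 = - \<i> * \<kappa>"
  shows "((\<lambda>s. E (of_real s * \<eta>)) \<longlongrightarrow> \<eta> * J) at_top"
proof -
  have eta0: "\<eta> \<noteq> 0" using eta kappa by auto
  \<comment> \<open>Rescaling by sqrt 2 yields the standard Gaussian integrand exp(- s^2), with
    half-line integral sqrt pi / 2.\<close>
  define f where "f = (\<lambda>s. E (of_real (s / sqrt 2) * \<eta>) * (of_real (sqrt 2) / \<eta>))"
  have df: "(f has_vector_derivative of_real (exp (- s\<^sup>2))) (at s within A)" for s A
  proof -
    have "((\<lambda>z. E (z * (\<eta> / of_real (sqrt 2))) * (of_real (sqrt 2) / \<eta>)) has_field_derivative
        of_real (exp (- s\<^sup>2))) (at (of_real s))"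
    proof -
      have lin: "((\<lambda>z. z * (\<eta> / of_real (sqrt 2))) has_field_derivative \<eta> / of_real (sqrt 2)) (at (of_real s))"
        by (auto intro!: derivative_eq_intros)
      have sq: "(of_real (sqrt 2))\<^sup>2 = (2 :: complex)"
        by (simp flip: of_real_power)
      have "- 2 * \<i> * \<kappa> * (of_real s * (\<eta> / of_real (sqrt 2)))\<^sup>2 = - of_real (s\<^sup>2)"
        unfolding power_mult_distrib power_divide eta sq
        using i_kappa_cancel[of "of_real (s\<^sup>2)"] by (simp add: field_simps)
      then have ex: "exp (- 2 * \<i> * \<kappa> * (of_real s * (\<eta> / of_real (sqrt 2)))\<^sup>2) = of_real (exp (- s\<^sup>2))"
        by (simp only:) (simp flip: exp_of_real)
      from DERIV_cmult_right[OF DERIV_chain2[OF E_deriv lin], of "of_real (sqrt 2) / \<eta>"]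
      show ?thesis unfolding ex using eta0 by simp
    qed
    from has_vector_derivative_real_field[OF this]
    show ?thesis unfolding f_def by (simp add: has_vector_derivative_at_within ac_simps)
  qed
  have f0: "f 0 = 0" by (simp add: f_def E_0)
  let ?g = "\<lambda>x. complex_of_real (indicator {0..} x *\<^sub>R exp (- x\<^sup>2))"
  have "has_bochner_integral lborel ?g (of_real (sqrt pi / 2))"
    by (rule has_bochner_integral_of_real[OF gaussian_moment_0])
  then have int: "integrable lborel ?g" "integral\<^sup>L lborel ?g = of_real (sqrt pi / 2)"
    by (auto simp: has_bochner_integral_iff)
  have "((\<lambda>s. \<integral>x. indicator {..s} x *\<^sub>R ?g x \<partial>lborel) \<longlongrightarrow> integral\<^sup>L lborel ?g) at_top"
    by (rule tendsto_integral_at_top) (use int in auto)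
  moreover have "\<forall>\<^sub>F s in at_top. (\<integral>x. indicator {..s} x *\<^sub>R ?g x \<partial>lborel) = f s"
    using eventually_ge_at_top[of 0]
  proof eventually_elim
    case (elim s)
    have "has_bochner_integral lborel (\<lambda>x. indicator {0..s} x *\<^sub>R complex_of_real (exp (- x\<^sup>2))) (f s - f 0)"
      by (rule has_bochner_integral_FTC_Icc) (auto intro!: df continuous_intros elim)
    moreover have "(\<lambda>x. indicator {..s} x *\<^sub>R ?g x) = (\<lambda>x. indicator {0..s} x *\<^sub>R complex_of_real (exp (- x\<^sup>2)))"
      by (auto simp: fun_eq_iff indicator_def)
    ultimately show ?case by (simp add: f0 has_bochner_integral_integral_eq)
  qed
  ultimately have "(f \<longlongrightarrow> of_real (sqrt pi / 2)) at_top"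
    unfolding int(2) by (rule Lim_transform_eventually)
  moreover have "filterlim (\<lambda>s. sqrt 2 * s) at_top at_top"
    by (intro filterlim_tendsto_pos_mult_at_top[OF tendsto_const _ filterlim_ident]) simp
  ultimately have "((\<lambda>s. f (sqrt 2 * s)) \<longlongrightarrow> of_real (sqrt pi / 2)) at_top"
    by (rule filterlim_compose)
  then have "((\<lambda>s. f (sqrt 2 * s) * (\<eta> / of_real (sqrt 2))) \<longlongrightarrow> of_real (sqrt pi / 2) * (\<eta> / of_real (sqrt 2))) at_top"
    by (intro tendsto_intros)
  then show ?thesis using eta0 by (simp add: f_def J_def field_simps)
qed

lemma yv_tendsto_0: "((\<lambda>r. yv (of_real r + \<i> * of_real \<theta>)) \<longlongrightarrow> 0) at_top"
proof (rule tendsto_norm_zero_cancel)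
  have "norm (yv (of_real r + \<i> * of_real \<theta>)) = exp (- r) / sqrt T" for r
    using T by (simp add: yv_def xv_def norm_divide norm_mult exp_minus field_simps)
  moreover have "((\<lambda>r. exp (- r) / sqrt T) \<longlongrightarrow> 0 / sqrt T) at_top"
    using T by (intro tendsto_divide tendsto_const filterlim_compose[OF exp_at_bot filterlim_uminus_at_bot_at_top]) auto
  ultimately show "((\<lambda>r. norm (yv (of_real r + \<i> * of_real \<theta>))) \<longlongrightarrow> 0) at_top" by simp
qed

lemma H_limits:
  "((\<lambda>r. H1 c d (yv (of_real r + \<i> * of_real \<theta>)) T) \<longlongrightarrow> c) at_top"
  "((\<lambda>r. H2 c d (yv (of_real r + \<i> * of_real \<theta>)) T) \<longlongrightarrow> d) at_top"
proof -
  have T': "T \<in> {0..T}" using T by simp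
  have "isCont (\<lambda>y. H1 c d y T) 0" "isCont (\<lambda>y. H2 c d y T) 0"
    using H_y_deriv(3,4)[OF T'] by (auto intro: field_differentiable_imp_continuous_at)
  from this[THEN isCont_tendsto_compose, OF yv_tendsto_0]
  show "((\<lambda>r. H1 c d (yv (of_real r + \<i> * of_real \<theta>)) T) \<longlongrightarrow> c) at_top"
    "((\<lambda>r. H2 c d (yv (of_real r + \<i> * of_real \<theta>)) T) \<longlongrightarrow> d) at_top"
    by (simp_all add: H_y_deriv(5,6)[OF T'])
qed

text \<open>On this ray x^2 is real, so both exponentials have modulus one, and the flow matrix
  tends to the identity. The limits then force exp(-2 i \<kappa> x^2) v to tend to 0 although its
  modulus is constant.\<close>

lemma recessive_at_infinity:
  fixes \<theta> sg :: real
  assumes rep: "represents b a v w"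
    and ray: "exp (\<i> * of_real \<theta>) ^ 2 = of_real sg"
    and lim_b: "((\<lambda>r. exp (- \<i> * \<kappa> * (xv (of_real r + \<i> * of_real \<theta>))\<^sup>2) * b (of_real r + \<i> * of_real \<theta>)) \<longlongrightarrow> 0) at_top"
    and lim_a: "((\<lambda>r. exp (- \<i> * \<kappa> * (xv (of_real r + \<i> * of_real \<theta>))\<^sup>2) * a (of_real r + \<i> * of_real \<theta>)) \<longlongrightarrow> \<omega>) at_top"
  shows "v = 0" "w = \<omega>"
proof -
  let ?z = "\<lambda>r. complex_of_real r + \<i> * of_real \<theta>"
  let ?e = "\<lambda>r. exp (- \<i> * \<kappa> * (xv (?z r))\<^sup>2)"
  have e1: "norm (?e r) = 1" for r
  proof -
    have "(xv (?z r))\<^sup>2 = of_real ((sqrt T * exp r)\<^sup>2 * sg)"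
      unfolding xv_def exp_add power_mult_distrib ray by (simp add: exp_of_real)
    then show ?thesis using norm_exp_i_times[of "- \<kappa> * ((sqrt T * exp r)\<^sup>2 * sg)"] by (simp add: mult.assoc)
  qed
  have "((\<lambda>r. H22 (yv (?z r)) T * (?e r * b (?z r)) - H12 (yv (?z r)) T * (?e r * a (?z r))) \<longlongrightarrow> 1 * 0 - 0 * \<omega>) at_top"
    by (intro tendsto_intros H_limits lim_a lim_b)
  moreover have "H22 (yv (?z r)) T * (?e r * b (?z r)) - H12 (yv (?z r)) T * (?e r * a (?z r)) = ?e r * (?e r * v)" for r
  proof -
    have "H22 (yv (?z r)) T * (?e r * b (?z r)) - H12 (yv (?z r)) T * (?e r * a (?z r)) = ?e r * dress1 b a (?z r)"
      by (simp add: dress1_def algebra_simps)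
    also have "dress1 b a (?z r) = ?e r * v" using rep by (simp add: represents_def)
    finally show ?thesis .
  qed
  ultimately have "((\<lambda>r. ?e r * (?e r * v)) \<longlongrightarrow> 0) at_top" by simp
  then have "((\<lambda>r. norm (?e r * (?e r * v))) \<longlongrightarrow> 0) at_top" by (rule tendsto_norm_zero)
  then have "((\<lambda>r::real. norm v) \<longlongrightarrow> 0) at_top" unfolding norm_mult e1 by simp
  then show v: "v = 0" by (simp add: tendsto_const_iff)
  have "((\<lambda>r. H11 (yv (?z r)) T * (?e r * a (?z r)) - H21 (yv (?z r)) T * (?e r * b (?z r))) \<longlongrightarrow> 1 * \<omega> - 0 * 0) at_top"
    by (intro tendsto_intros H_limits lim_a lim_b)
  moreover have "H11 (yv (?z r)) T * (?e r * a (?z r)) - H21 (yv (?z r)) T * (?e r * b (?z r)) = w" for r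
  proof -
    have "H11 (yv (?z r)) T * (?e r * a (?z r)) - H21 (yv (?z r)) T * (?e r * b (?z r)) = ?e r * dress2 b a (?z r)"
      by (simp add: dress2_def algebra_simps)
    also have "dress2 b a (?z r) = exp (\<i> * \<kappa> * (xv (?z r))\<^sup>2) * w"
      using rep by (simp add: represents_def v)
    also have "?e r * (exp (\<i> * \<kappa> * (xv (?z r))\<^sup>2) * w) = w"
      unfolding mult.assoc[symmetric] mult_exp_exp by simp
    finally show ?thesis .
  qed
  ultimately show "w = \<omega>" by (simp add: tendsto_const_iff)
qed

text \<open>On this ray i \<kappa> x^2 is positive. The column is to behave like the decaying exp(-
  i \<kappa> x^2), so the bracket multiplying the growing exponential must tend to 0, which makes w
  cancel the limit of the term with \<open>E\<close>. The bound on \<open>a\<close> may grow like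
  \<mu>, as happens for \<open>\<kappa> = - 1\<close>; this is harmless against exp(2 T
  \<bar>\<mu>\<bar>^2).\<close>

lemma dominant_at_infinity:
  fixes \<theta> C :: real
  assumes rep: "represents b a v w"
    and ray: "exp (\<i> * of_real \<theta>) ^ 2 = - \<i> * \<kappa>"
    and bd_b: "\<forall>\<^sub>F r in at_top. norm (exp (\<i> * \<kappa> * (xv (of_real r + \<i> * of_real \<theta>))\<^sup>2) * b (of_real r + \<i> * of_real \<theta>)) \<le> C"
    and bd_a: "\<forall>\<^sub>F r in at_top. norm (exp (\<i> * \<kappa> * (xv (of_real r + \<i> * of_real \<theta>))\<^sup>2) * a (of_real r + \<i> * of_real \<theta>)) \<le> C * exp r"
  shows "w = - 2 * n2 0 * v * (exp (\<i> * of_real \<theta>) * J)"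
proof -
  let ?z = "\<lambda>r. complex_of_real r + \<i> * of_real \<theta>"
  let ?e = "\<lambda>r. exp (\<i> * \<kappa> * (xv (?z r))\<^sup>2)"
  have x2: "\<i> * \<kappa> * (xv (?z r))\<^sup>2 = of_real (T * exp r * exp r)" for r
  proof -
    have "(xv (?z r))\<^sup>2 = of_real (T * exp r * exp r) * (- \<i> * \<kappa>)"
      unfolding xv_def exp_add power_mult_distrib ray using T
      by (simp add: exp_of_real power2_eq_square flip: of_real_mult)
    then show ?thesis by (simp only: i_kappa_cancel)
  qed
  have ne: "norm (?e r) = exp (T * exp r * exp r)" for r
    unfolding x2 by simp
  have xvz: "xv (?z r) = of_real (sqrt T * exp r) * exp (\<i> * of_real \<theta>)" for r
    by (simp add: xv_def exp_add exp_of_real)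
  have "filterlim (\<lambda>r::real. sqrt T * exp r) at_top at_top"
    using T by (intro filterlim_tendsto_pos_mult_at_top[OF tendsto_const _ exp_at_top]) auto
  from filterlim_compose[OF E_limit[OF ray] this]
  have El: "((\<lambda>r. E (xv (?z r))) \<longlongrightarrow> exp (\<i> * of_real \<theta>) * J) at_top"
    unfolding xvz by (simp add: mult.commute)
  have "\<forall>\<^sub>F r in at_top. norm (H11 (yv (?z r)) T - 1) < 1" "\<forall>\<^sub>F r in at_top. norm (H21 (yv (?z r)) T - 0) < 1"
    using tendstoD[OF H_limits(1)[of 1 0 \<theta>], of 1] tendstoD[OF H_limits(2)[of 1 0 \<theta>], of 1] by (auto simp: dist_norm)
  then have "\<forall>\<^sub>F r in at_top. norm (w + 2 * n2 0 * v * E (xv (?z r))) \<le> 3 * \<bar>C\<bar> * (exp r / exp (2 * (T * exp r * exp r)))"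
    using bd_a bd_b eventually_ge_at_top[of 0]
  proof eventually_elim
    case (elim r)
    have h: "norm (H11 (yv (?z r)) T) \<le> 2" "norm (H21 (yv (?z r)) T) \<le> 1"
      using elim(1,2) norm_triangle_ineq2[of "H11 (yv (?z r)) T" 1] by auto
    have ge1: "1 \<le> exp r" using elim(5) by simp
    have "?e r * ?e r * (w + 2 * n2 0 * v * E (xv (?z r))) = ?e r * dress2 b a (?z r)"
      using rep by (simp add: represents_def mult.assoc)
    also have "\<dots> = H11 (yv (?z r)) T * (?e r * a (?z r)) - H21 (yv (?z r)) T * (?e r * b (?z r))"
      by (simp add: dress2_def algebra_simps)
    finally have eq: "?e r * ?e r * (w + 2 * n2 0 * v * E (xv (?z r))) =
      H11 (yv (?z r)) T * (?e r * a (?z r)) - H21 (yv (?z r)) T * (?e r * b (?z r))" .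
    have "exp (2 * (T * exp r * exp r)) * norm (w + 2 * n2 0 * v * E (xv (?z r)))
       = norm (?e r * ?e r * (w + 2 * n2 0 * v * E (xv (?z r))))"
      unfolding norm_mult ne by (simp add: mult_exp_exp[symmetric] exp_double power2_eq_square)
    also have "\<dots> \<le> norm (H11 (yv (?z r)) T) * norm (?e r * a (?z r)) + norm (H21 (yv (?z r)) T) * norm (?e r * b (?z r))"
      unfolding eq norm_mult[symmetric] by (rule norm_triangle_ineq4)
    also have "\<dots> \<le> 2 * (\<bar>C\<bar> * exp r) + 1 * (\<bar>C\<bar> * exp r)"
    proof (intro add_mono mult_mono h)
      show "norm (?e r * a (?z r)) \<le> \<bar>C\<bar> * exp r"
        using elim(3) by (rule order_trans) (simp add: mult_right_mono)
      show "norm (?e r * b (?z r)) \<le> \<bar>C\<bar> * exp r"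
        using elim(4) mult_left_mono[OF ge1, of "\<bar>C\<bar>"] by simp
    qed auto
    finally have "norm (w + 2 * n2 0 * v * E (xv (?z r))) * exp (2 * (T * exp r * exp r)) \<le> 3 * \<bar>C\<bar> * exp r"
      by (simp add: ac_simps)
    then show ?case by (simp add: pos_le_divide_eq ac_simps)
  qed
  moreover have "((\<lambda>r. 3 * \<bar>C\<bar> * (exp r / exp (2 * (T * exp r * exp r)))) \<longlongrightarrow> 0) at_top"
  proof (rule Lim_null_comparison)
    show "\<forall>\<^sub>F r in at_top. norm (3 * \<bar>C\<bar> * (exp r / exp (2 * (T * exp r * exp r)))) \<le> 3 * \<bar>C\<bar> * (1 / (2 * T) * exp (- r))"
    proof (rule always_eventually, rule allI)
      fix r :: real
      have "2 * (T * exp r * exp r) \<le> exp (2 * (T * exp r * exp r))"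
        using exp_ge_add_one_self[of "2 * (T * exp r * exp r)"] by linarith
      then have "exp r / exp (2 * (T * exp r * exp r)) \<le> exp r / (2 * (T * exp r * exp r))"
        using T by (intro divide_left_mono) auto
      also have "\<dots> = 1 / (2 * T) * exp (- r)"
        unfolding exp_minus using T by (simp add: divide_simps)
      finally have "3 * \<bar>C\<bar> * (exp r / exp (2 * (T * exp r * exp r))) \<le> 3 * \<bar>C\<bar> * (1 / (2 * T) * exp (- r))"
        by (rule mult_left_mono) simp
      then show "norm (3 * \<bar>C\<bar> * (exp r / exp (2 * (T * exp r * exp r)))) \<le> 3 * \<bar>C\<bar> * (1 / (2 * T) * exp (- r))"
        by (simp add: abs_mult)
    qed
    have "((\<lambda>r. 3 * \<bar>C\<bar> * (1 / (2 * T) * exp (- r))) \<longlongrightarrow> 3 * \<bar>C\<bar> * (1 / (2 * T) * 0)) at_top"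
      by (intro tendsto_mult tendsto_const filterlim_compose[OF exp_at_bot filterlim_uminus_at_bot_at_top])
    then show "((\<lambda>r. 3 * \<bar>C\<bar> * (1 / (2 * T) * exp (- r))) \<longlongrightarrow> 0) at_top" by simp
  qed
  ultimately have "((\<lambda>r. w + 2 * n2 0 * v * E (xv (?z r))) \<longlongrightarrow> 0) at_top"
    by (rule Lim_null_comparison)
  moreover have "((\<lambda>r. w + 2 * n2 0 * v * E (xv (?z r))) \<longlongrightarrow> w + 2 * n2 0 * v * (exp (\<i> * of_real \<theta>) * J)) at_top"
    by (intro tendsto_intros El)
  ultimately have "w + 2 * n2 0 * v * (exp (\<i> * of_real \<theta>) * J) = 0"
    by (intro tendsto_unique[of at_top]) auto
  then show ?thesis by (simp add: eq_neg_iff_add_eq_0)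
qed

text \<open>Dressing is unimodular, the two exponentials are inverse to each other, and the terms
  with \<open>E\<close> cancel in the determinant.\<close>

lemma represents_det:
  assumes "represents b a v w" "represents b' a' v' w'"
  shows "b \<zeta> * a' \<zeta> - b' \<zeta> * a \<zeta> = v * w' - v' * w"
proof -
  have T': "T \<in> {0..T}" using T by simp
  have "dress1 b a \<zeta> * dress2 b' a' \<zeta> - dress1 b' a' \<zeta> * dress2 b a \<zeta> =
     (H11 (yv \<zeta>) T * H22 (yv \<zeta>) T - H12 (yv \<zeta>) T * H21 (yv \<zeta>) T) * (b \<zeta> * a' \<zeta> - b' \<zeta> * a \<zeta>)"
    by (simp add: dress1_def dress2_def algebra_simps)
  then have "b \<zeta> * a' \<zeta> - b' \<zeta> * a \<zeta> =
     dress1 b a \<zeta> * dress2 b' a' \<zeta> - dress1 b' a' \<zeta> * dress2 b a \<zeta>"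
    unfolding det_H[OF T'] by simp
  also have "\<dots> = exp (- \<i> * \<kappa> * (xv \<zeta>)\<^sup>2) * exp (\<i> * \<kappa> * (xv \<zeta>)\<^sup>2) * (v * w' - v' * w)"
    using assms unfolding represents_def by (simp add: algebra_simps)
  finally show ?thesis by (simp add: mult_exp_exp)
qed

end

section \<open>The solution regular at the origin\<close>

text \<open>The derivatives \<open>u'\<close> and \<open>u''\<close>, whose existence
  \<open>dp3_solution\<close> asserts, are fixed as parameters, together with the point
  \<open>\<tau>\<close> at which the monodromy data are read off.\<close>

locale regular_dp3 =
  fixes \<epsilon> b \<kappa> \<tau>\<^sub>0 \<tau> :: real and a :: complex and c :: "nat \<Rightarrow> complex"
    and u u' u'' \<phi> :: "real \<Rightarrow> complex"
  assumes eps: "\<epsilon> \<in> {1, -1}" and eb: "\<epsilon> * b > 0" and kappa: "\<kappa> \<in> {1, -1}"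
    and a_eq: "a = of_real \<kappa> * \<i> / 2" and c0: "c 0 = 1"
    and u_nonzero: "\<And>t. t \<in> {0<..<\<tau>\<^sub>0} \<Longrightarrow> u t \<noteq> 0"
    and u_deriv: "\<And>t. t \<in> {0<..<\<tau>\<^sub>0} \<Longrightarrow> (u has_vector_derivative u' t) (at t)"
    and u'_deriv: "\<And>t. t \<in> {0<..<\<tau>\<^sub>0} \<Longrightarrow> (u' has_vector_derivative u'' t) (at t)"
    and u''_eq: "\<And>t. t \<in> {0<..<\<tau>\<^sub>0} \<Longrightarrow> u'' t = (u' t)\<^sup>2 / u t - u' t / of_real t
                 + 1 / of_real t * (- 8 * of_real \<epsilon> * (u t)\<^sup>2 + 2 * a * of_real b)
                 + (of_real b)\<^sup>2 / u t"
    and expansion: "\<forall>\<^sub>F t in at_right 0. \<exists>w.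
      (\<lambda>m. c m * of_real t ^ m) sums w \<and> u t = - (of_real b * of_real t / (2 * a)) * w"
    and phase: "phase_of a b \<tau>\<^sub>0 u \<phi>"
    and tau: "0 < \<tau>" "\<tau> < \<tau>\<^sub>0"
begin

lemma b_nonzero: "b \<noteq> 0" using eb by auto

lemma kap2: "of_real \<kappa> * (of_real \<kappa> * z) = (z :: complex)" using kappa by auto
lemma ii2: "\<i> * (\<i> * z) = - z" by (simp add: mult.assoc[symmetric])

lemma phi_deriv:
  assumes "t \<in> {0<..<\<tau>\<^sub>0}"
  shows "(\<phi> has_vector_derivative \<i> * \<kappa> / of_real t + of_real b / u t) (at t)"
proof -
  have "2 * a = \<i> * \<kappa>" by (simp add: a_eq)
  then show ?thesis using phase assms unfolding phase_of_def by metis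
qed

text \<open>The prefactor is -b / (2a) = i \<kappa> b. The derivative \<open>u'\<close> is matched
  with the termwise derivative by uniqueness, which makes its behaviour at 0 available.\<close>

lemma expansion_near_0:
  obtains d :: real and W W' :: "complex \<Rightarrow> complex" where "0 < d" "d < \<tau>\<^sub>0" "W 0 = 1" "W' 0 = c 1" "isCont W 0" "isCont W' 0"
    "(W has_field_derivative c 1) (at 0)"
    "\<And>t. t \<in> {0<..<d} \<Longrightarrow> u t = \<i> * \<kappa> * b * of_real t * W (of_real t)"
    "\<And>t. t \<in> {0<..<d} \<Longrightarrow> u' t = \<i> * \<kappa> * b * (W (of_real t) + of_real t * W' (of_real t))"
proof -
  obtain t1 where t1: "0 < t1" "\<And>t. 0 < t \<Longrightarrow> t < t1 \<Longrightarrow> \<exists>w.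
      (\<lambda>m. c m * of_real t ^ m) sums w \<and> u t = - (of_real b * of_real t / (2 * a)) * w"
    using expansion unfolding eventually_at_right_field by auto
  define d where "d = min (t1 / 2) (\<tau>\<^sub>0 / 2)"
  have d: "0 < d" "d < t1" "d < \<tau>\<^sub>0" using t1 tau by (auto simp: d_def)
  define W where "W = (\<lambda>z::complex. \<Sum>m. c m * z ^ m)"
  define W' where "W' = (\<lambda>z::complex. \<Sum>m. diffs c m * z ^ m)"
  have sm: "summable (\<lambda>m. c m * of_real d ^ m)"
    using t1(2)[OF d(1,2)] by (auto simp: sums_iff)
  have WD: "(W has_field_derivative W' z) (at z)" if "norm z < d" for z
    unfolding W_def W'_def by (rule termdiffs_strong[OF sm]) (use that d in auto)
  have sm': "summable (\<lambda>m. diffs c m * z ^ m)" if "norm z < d" for z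
    by (rule termdiff_converges[of _ d]) (use that powser_inside[OF sm] in auto)
  have "isCont W' 0"
  proof -
    have "(W' has_field_derivative (\<Sum>m. diffs (diffs c) m * 0 ^ m)) (at 0)"
      unfolding W'_def by (rule termdiffs_strong[OF sm'[of "of_real (d / 2)"]]) (use d in auto)
    then show ?thesis by (rule DERIV_isCont)
  qed
  moreover have "W 0 = 1" "W' 0 = c 1"
    by (simp_all add: W_def W'_def powser_zero c0 diffs_def)
  moreover have "isCont W 0" "(W has_field_derivative c 1) (at 0)"
    using WD[of 0] d \<open>W' 0 = c 1\<close> by (auto intro: DERIV_isCont)
  moreover have uW: "u t = \<i> * \<kappa> * b * of_real t * W (of_real t)" if t: "t \<in> {0<..<d}" for t
  proof -
    have "u t = - (of_real b * of_real t / (2 * a)) * W (of_real t)"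
      using t1(2)[of t] t d by (auto simp: W_def sums_iff)
    then show ?thesis using kappa by (auto simp: a_eq field_simps)
  qed
  moreover have "u' t = \<i> * \<kappa> * b * (W (of_real t) + of_real t * W' (of_real t))" if t: "t \<in> {0<..<d}" for t
  proof -
    have "((\<lambda>z. \<i> * \<kappa> * b * (z * W z)) has_field_derivative
        \<i> * \<kappa> * b * (W (of_real t) + of_real t * W' (of_real t))) (at (of_real t))"
      by (rule DERIV_cong[OF DERIV_cmult[OF DERIV_mult[OF DERIV_ident WD]]]) (use t in auto)
    from has_vector_derivative_real_field[OF this]
    have "((\<lambda>t. \<i> * \<kappa> * b * (of_real t * W (of_real t))) has_vector_derivative
        \<i> * \<kappa> * b * (W (of_real t) + of_real t * W' (of_real t))) (at t)" .
    then have "(u has_vector_derivative \<i> * \<kappa> * b * (W (of_real t) + of_real t * W' (of_real t))) (at t)"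
      by (rule has_vector_derivative_transform_within_open[of _ _ _ "{0<..<d}"])
         (use t uW in \<open>auto simp: mult.assoc\<close>)
    moreover have "(u has_vector_derivative u' t) (at t)"
      using t d by (intro u_deriv) auto
    ultimately show ?thesis by (rule vector_derivative_unique_at[symmetric])
  qed
  ultimately show thesis using that[OF d(1,3)] by blast
qed

lemma real_at_right_limit:
  assumes "isCont W (0 :: complex)"
  shows "((\<lambda>t. W (complex_of_real t)) \<longlongrightarrow> W 0) (at_right 0)"
proof (rule isCont_tendsto_compose[OF assms])
  show "(complex_of_real \<longlongrightarrow> 0) (at_right 0)"
    by (rule tendsto_eq_rhs[OF tendsto_of_real[OF tendsto_ident_at]]) simp
qed

text \<open>Since b / u = - i \<kappa> / (t W), the poles in the phase equation cancel and its
  right-hand side tends to i \<kappa> c 1; hence \<phi> converges. In the second limit W and t W'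
  contribute c 1 each.\<close>

lemma limits_at_0:
  shows "((\<lambda>t. u t / of_real t) \<longlongrightarrow> \<i> * \<kappa> * b) (at_right 0)"
    and "((\<lambda>t. (u' t - \<i> * \<kappa> * b) / u t) \<longlongrightarrow> 2 * c 1) (at_right 0)"
    and "\<exists>l. (\<phi> \<longlongrightarrow> l) (at_right 0)"
proof -
  obtain d and W W' :: "complex \<Rightarrow> complex" where d: "0 < d" "d < \<tau>\<^sub>0" and W: "W 0 = 1" "W' 0 = c 1" "isCont W 0" "isCont W' 0"
    "(W has_field_derivative c 1) (at 0)"
    and uW: "\<And>t. t \<in> {0<..<d} \<Longrightarrow> u t = \<i> * \<kappa> * b * of_real t * W (of_real t)"
    "\<And>t. t \<in> {0<..<d} \<Longrightarrow> u' t = \<i> * \<kappa> * b * (W (of_real t) + of_real t * W' (of_real t))"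
    by (rule expansion_near_0) blast
  have near: "\<forall>\<^sub>F t in at_right 0. t \<in> {0<..<d}"
    using d(1) by (auto simp: eventually_at_right_field)
  have k0: "\<i> * of_real \<kappa> * of_real b \<noteq> 0" using kappa b_nonzero by auto
  have Wl: "((\<lambda>t. W (of_real t)) \<longlongrightarrow> 1) (at_right 0)" "((\<lambda>t. W' (of_real t)) \<longlongrightarrow> c 1) (at_right 0)"
    using real_at_right_limit[OF W(3)] real_at_right_limit[OF W(4)] W by auto
  have ev: "\<forall>\<^sub>F t in at_right 0. \<i> * \<kappa> * b * W (of_real t) = u t / of_real t"
    using near by eventually_elim (simp add: uW)
  show "((\<lambda>t. u t / of_real t) \<longlongrightarrow> \<i> * \<kappa> * b) (at_right 0)"
    by (rule Lim_transform_eventually[OF _ ev]) (use tendsto_mult_left[OF Wl(1), of "\<i> * \<kappa> * b"] in simp)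
  have quot: "((\<lambda>t. (W (of_real t) - 1) / of_real t) \<longlongrightarrow> c 1) (at_right 0)"
  proof -
    have "((\<lambda>z. (W z - W 0) / (z - 0)) \<longlongrightarrow> c 1) (at 0)"
      using W(5) by (simp add: has_field_derivative_iff)
    moreover have "filterlim complex_of_real (at 0) (at_right 0)"
      by (intro filterlim_atI tendsto_eq_rhs[OF tendsto_of_real[OF tendsto_ident_at]])
         (auto simp: eventually_at_right_field intro: exI[of _ 1])
    ultimately have "((\<lambda>t. (W (of_real t) - W 0) / (of_real t - 0)) \<longlongrightarrow> c 1) (at_right 0)"
      by (rule filterlim_compose)
    then show ?thesis by (simp add: W(1))
  qed
  have Wnz: "\<forall>\<^sub>F t in at_right 0. W (of_real t) \<noteq> 0"
    using tendsto_imp_eventually_ne[OF Wl(1)] by simp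
  have "((\<lambda>t. ((W (of_real t) - 1) / of_real t + W' (of_real t)) / W (of_real t)) \<longlongrightarrow> (c 1 + c 1) / 1) (at_right 0)"
    by (intro tendsto_intros quot Wl) simp
  moreover have "\<forall>\<^sub>F t in at_right 0. ((W (of_real t) - 1) / of_real t + W' (of_real t)) / W (of_real t)
      = (u' t - \<i> * \<kappa> * b) / u t"
    using near Wnz
  proof eventually_elim
    case (elim t)
    have "(u' t - \<i> * \<kappa> * b) / u t = (\<i> * \<kappa> * b * (W (of_real t) + of_real t * W' (of_real t) - 1)) /
        (\<i> * \<kappa> * b * (of_real t * W (of_real t)))"
      using elim by (simp add: uW algebra_simps)
    also have "\<dots> = (W (of_real t) + of_real t * W' (of_real t) - 1) / (of_real t * W (of_real t))"
      using k0 by (rule nonzero_mult_divide_mult_cancel_left)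
    finally show ?case using elim by (simp add: field_simps)
  qed
  ultimately have "((\<lambda>t. (u' t - \<i> * \<kappa> * b) / u t) \<longlongrightarrow> (c 1 + c 1) / 1) (at_right 0)"
    by (rule Lim_transform_eventually)
  then show "((\<lambda>t. (u' t - \<i> * \<kappa> * b) / u t) \<longlongrightarrow> 2 * c 1) (at_right 0)" by simp
  have "((\<lambda>t. \<i> * \<kappa> * ((W (of_real t) - 1) / of_real t / W (of_real t))) \<longlongrightarrow> \<i> * \<kappa> * (c 1 / 1)) (at_right 0)"
    by (intro tendsto_intros quot Wl) simp
  moreover have "\<forall>\<^sub>F t in at_right 0. \<i> * \<kappa> * ((W (of_real t) - 1) / of_real t / W (of_real t))
      = \<i> * \<kappa> / of_real t + of_real b / u t"
    using near Wnz
  proof eventually_elim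
    case (elim t)
    have "of_real b / u t = 1 / (\<i> * \<kappa>) / (of_real t * W (of_real t))"
      using elim b_nonzero by (simp add: uW)
    also have "1 / (\<i> * \<kappa>) = - \<i> * \<kappa>" using kappa by (auto simp: field_simps)
    finally show ?case using elim by (simp add: field_simps)
  qed
  ultimately have "((\<lambda>t. \<i> * \<kappa> / of_real t + of_real b / u t) \<longlongrightarrow> \<i> * \<kappa> * (c 1 / 1)) (at_right 0)"
    by (rule Lim_transform_eventually)
  then have "\<forall>\<^sub>F t in at_right 0. dist (\<i> * \<kappa> / of_real t + of_real b / u t) (\<i> * \<kappa> * (c 1 / 1)) < 1"
    by (rule tendstoD) simp
  then obtain d1 where d1: "0 < d1"
    "\<And>t. 0 < t \<Longrightarrow> t < d1 \<Longrightarrow> dist (\<i> * \<kappa> / of_real t + of_real b / u t) (\<i> * \<kappa> * (c 1 / 1)) < 1"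
    unfolding eventually_at_right_field by auto
  show "\<exists>l. (\<phi> \<longlongrightarrow> l) (at_right 0)"
  proof (rule bounded_derivative_limit_at_right)
    show "0 < min d1 \<tau>\<^sub>0" using d1 tau by simp
    fix t assume t: "t \<in> {0<..<min d1 \<tau>\<^sub>0}"
    then show "(\<phi> has_vector_derivative \<i> * \<kappa> / of_real t + of_real b / u t) (at t)"
      by (intro phi_deriv) auto
    show "norm (\<i> * \<kappa> / of_real t + of_real b / u t) \<le> norm (\<i> * \<kappa> * (c 1 / 1)) + 1"
      using d1(2)[of t] t norm_triangle_ineq2[of "\<i> * \<kappa> / of_real t + of_real b / u t" "\<i> * \<kappa> * (c 1 / 1)"]
      by (simp add: dist_norm)
  qed
qed

definition \<phi>\<^sub>0 :: complex where "\<phi>\<^sub>0 = (SOME l. (\<phi> \<longlongrightarrow> l) (at_right 0))"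

lemma phi_limit: "(\<phi> \<longlongrightarrow> \<phi>\<^sub>0) (at_right 0)"
  unfolding \<phi>\<^sub>0_def by (rule someI_ex[OF limits_at_0(3)])

text \<open>The case distinction \<open>t = 0\<close> extends the coefficients of the rotated pair continuously to the
  singular point of the equation.\<close>

definition N1 :: "real \<Rightarrow> complex" where
  "N1 t = 2 * \<i> * \<epsilon> * (of_real t * exp (\<i> * \<kappa> * (if t = 0 then \<phi>\<^sub>0 else \<phi> t)))"
definition N2 :: "real \<Rightarrow> complex" where
  "N2 t = (if t = 0 then - (\<kappa> * \<epsilon> / 4) * (exp (- \<i> * \<kappa> * \<phi>\<^sub>0) * (2 * c 1))
     else - (\<kappa> * \<epsilon> / 4) * (exp (- \<i> * \<kappa> * \<phi> t) * ((u' t - \<i> * \<kappa> * b) / u t)))"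
definition Q1 :: "real \<Rightarrow> complex" where
  "Q1 t = (if t = 0 then - \<kappa> * \<epsilon> * exp (\<i> * \<kappa> * \<phi>\<^sub>0)
     else - \<i> * \<epsilon> * b * (of_real t / u t * exp (\<i> * \<kappa> * \<phi> t)))"
definition Q2 :: "real \<Rightarrow> complex" where
  "Q2 t = (if t = 0 then \<kappa> * b * exp (- \<i> * \<kappa> * \<phi>\<^sub>0)
     else - \<i> * (u t / of_real t * exp (- \<i> * \<kappa> * \<phi> t)))"

lemma continuous_on_from_limit:
  fixes f :: "real \<Rightarrow> complex"
  assumes "continuous_on {0<..\<tau>} f" "(f \<longlongrightarrow> f 0) (at_right 0)"
  shows "continuous_on {0..\<tau>} f"
proof -
  have "continuous (at t within {0..\<tau>}) f" if t: "t \<in> {0..\<tau>}" for t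
  proof (cases "t = 0")
    case True
    have "at 0 within {0..\<tau>} = at_right 0"
      using tau by (intro at_within_Icc_at_right)
    then show ?thesis unfolding True continuous_within using assms(2) by simp
  next
    case False
    then have "continuous (at t within {0<..\<tau>}) f"
      using t assms(1) by (simp add: continuous_on_eq_continuous_within)
    moreover have "at t within {0<..\<tau>} = at t within {0..\<tau>}"
      by (rule at_within_nhd[of _ "{0<..}"]) (use t False in auto)
    ultimately show ?thesis by (simp add: continuous_within)
  qed
  then show ?thesis by (simp add: continuous_on_eq_continuous_within)
qed

lemma exp_phi_deriv:
  assumes t: "t \<in> {0<..<\<tau>\<^sub>0}"
  shows "((\<lambda>t. exp (\<i> * \<kappa> * \<phi> t)) has_vector_derivative
      (- 1 / of_real t + \<i> * \<kappa> * b / u t) * exp (\<i> * \<kappa> * \<phi> t)) (at t)"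
    and "((\<lambda>t. exp (- \<i> * \<kappa> * \<phi> t)) has_vector_derivative
      (1 / of_real t - \<i> * \<kappa> * b / u t) * exp (- \<i> * \<kappa> * \<phi> t)) (at t)"
proof -
  have *: "((\<lambda>t. exp (k * \<phi> t)) has_vector_derivative (k * (\<i> * \<kappa> / of_real t + of_real b / u t)) * exp (k * \<phi> t)) (at t)" for k
    using field_vector_diff_chain_at[OF has_vector_derivative_mult_right[OF phi_deriv[OF t], of k] DERIV_exp]
    by (simp add: o_def)
  have k: "\<i> * \<kappa> * (\<i> * \<kappa> / of_real t + of_real b / u t) = - 1 / of_real t + \<i> * \<kappa> * b / u t"
    using kappa by (auto simp: algebra_simps)
  show "((\<lambda>t. exp (\<i> * \<kappa> * \<phi> t)) has_vector_derivative
      (- 1 / of_real t + \<i> * \<kappa> * b / u t) * exp (\<i> * \<kappa> * \<phi> t)) (at t)"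
    using *[of "\<i> * \<kappa>"] unfolding k .
  have k': "- \<i> * \<kappa> * (\<i> * \<kappa> / of_real t + of_real b / u t) = 1 / of_real t - \<i> * \<kappa> * b / u t"
    using kappa by (auto simp: algebra_simps)
  show "((\<lambda>t. exp (- \<i> * \<kappa> * \<phi> t)) has_vector_derivative
      (1 / of_real t - \<i> * \<kappa> * b / u t) * exp (- \<i> * \<kappa> * \<phi> t)) (at t)"
    using *[of "- \<i> * \<kappa>"] unfolding k' .
qed

lemma inverse_derivs:
  assumes t: "t \<in> {0<..<\<tau>\<^sub>0}"
  shows "((\<lambda>t. inverse (u t)) has_vector_derivative - u' t * (inverse (u t))\<^sup>2) (at t)"
    and "((\<lambda>t. inverse (complex_of_real t)) has_vector_derivative - (inverse (of_real t))\<^sup>2) (at t)"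
    and "((\<lambda>t. complex_of_real t) has_vector_derivative 1) (at t)"
proof -
  have inv: "(inverse has_field_derivative - (inverse z)\<^sup>2) (at z)" if "z \<noteq> (0::complex)" for z
    using DERIV_inverse[OF that] by (simp only: numeral_2_eq_2)
  show "((\<lambda>t. inverse (u t)) has_vector_derivative - u' t * (inverse (u t))\<^sup>2) (at t)"
    using field_vector_diff_chain_at[OF u_deriv[OF t] inv[OF u_nonzero[OF t]]] by (simp add: o_def)
  have t0: "complex_of_real t \<noteq> 0" using t by simp
  show "((\<lambda>t. inverse (complex_of_real t)) has_vector_derivative - (inverse (of_real t))\<^sup>2) (at t)"
    using has_vector_derivative_real_field[OF inv[OF t0]] .
  show "((\<lambda>t. complex_of_real t) has_vector_derivative 1) (at t)"
    using has_vector_derivative_real_field[OF DERIV_ident] .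
qed

lemma NQ_pos:
  assumes "t \<in> {0<..<\<tau>\<^sub>0}"
  shows "N1 t = 2 * \<i> * \<epsilon> * (of_real t * exp (\<i> * \<kappa> * \<phi> t))"
    and "N2 t = - (\<kappa> * \<epsilon> / 4) * (exp (- \<i> * \<kappa> * \<phi> t) * ((u' t - \<i> * \<kappa> * b) * inverse (u t)))"
    and "Q1 t = - \<i> * \<epsilon> * b * (of_real t * inverse (u t) * exp (\<i> * \<kappa> * \<phi> t))"
    and "Q2 t = - \<i> * (u t * inverse (of_real t) * exp (- \<i> * \<kappa> * \<phi> t))"
proof -
  have "t \<noteq> 0" using assms by simp
  then show "N1 t = 2 * \<i> * \<epsilon> * (of_real t * exp (\<i> * \<kappa> * \<phi> t))"
    "N2 t = - (\<kappa> * \<epsilon> / 4) * (exp (- \<i> * \<kappa> * \<phi> t) * ((u' t - \<i> * \<kappa> * b) * inverse (u t)))"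
    "Q1 t = - \<i> * \<epsilon> * b * (of_real t * inverse (u t) * exp (\<i> * \<kappa> * \<phi> t))"
    "Q2 t = - \<i> * (u t * inverse (of_real t) * exp (- \<i> * \<kappa> * \<phi> t))"
    unfolding N1_def N2_def Q1_def Q2_def divide_inverse[of _ "u t"] divide_inverse[of _ "of_real t"]
    by simp_all
qed

lemma exp_phi_inverse: "exp (- \<i> * \<kappa> * \<phi> t) = inverse (exp (\<i> * \<kappa> * \<phi> t))"
  by (simp add: exp_minus)

text \<open>The equation for \<open>u\<close> enters through the derivative of \<open>N2\<close>;
  the other three follow from the phase equation and the product rule.\<close>

lemma NQ_deriv:
  assumes t: "t \<in> {0<..<\<tau>\<^sub>0}"
  shows "(N1 has_vector_derivative - 2 * \<i> * \<kappa> * Q1 t) (at t)"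
    and "(N2 has_vector_derivative 2 * \<i> * \<kappa> * Q2 t) (at t)"
    and "(Q1 has_vector_derivative - 2 * \<kappa> * \<i> * N1 t * N2 t * Q1 t / t) (at t)"
    and "(Q2 has_vector_derivative 2 * \<kappa> * \<i> * N1 t * N2 t * Q2 t / t) (at t)"
proof -
  define z where "z = exp (\<i> * \<kappa> * \<phi> t)"
  have nz: "z \<noteq> 0" "u t \<noteq> 0" "complex_of_real t \<noteq> 0"
    using t u_nonzero[OF t] by (auto simp: z_def)
  have ek: "of_real \<epsilon> * of_real \<epsilon> = (1::complex)" "of_real \<kappa> * of_real \<kappa> = (1::complex)"
    using eps kappa by auto
  note intros = has_vector_derivative_mult has_vector_derivative_const has_vector_derivative_diff
    exp_phi_deriv[OF t] inverse_derivs[OF t] u_deriv[OF t] u'_deriv[OF t]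
  note pos = NQ_pos[OF t] and zdef = exp_phi_inverse[of t] z_def[symmetric]
  have tr: "(f has_vector_derivative f') (at t)"
    if "(g has_vector_derivative f') (at t)" "\<And>s. s \<in> {0<..<\<tau>\<^sub>0} \<Longrightarrow> f s = g s" for f g f'
    by (rule has_vector_derivative_transform_within_open[OF that(1), of "{0<..<\<tau>\<^sub>0}"]) (use t that(2) in auto)
  show "(N1 has_vector_derivative - 2 * \<i> * \<kappa> * Q1 t) (at t)"
  proof (rule tr[OF _ NQ_pos(1)])
    show "((\<lambda>t. 2 * \<i> * \<epsilon> * (of_real t * exp (\<i> * \<kappa> * \<phi> t))) has_vector_derivative - 2 * \<i> * \<kappa> * Q1 t) (at t)"
      by (rule has_vector_derivative_eq_rhs, (rule intros)+)
         (unfold pos zdef, use nz in \<open>simp add: field_simps ii2 kap2\<close>)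
  qed
  show "(N2 has_vector_derivative 2 * \<i> * \<kappa> * Q2 t) (at t)"
  proof (rule tr[OF _ NQ_pos(2)])
    have a2: "2 * a * of_real b = \<i> * \<kappa> * b" by (simp add: a_eq)
    show "((\<lambda>t. - (\<kappa> * \<epsilon> / 4) * (exp (- \<i> * \<kappa> * \<phi> t) * ((u' t - \<i> * \<kappa> * b) * inverse (u t))))
        has_vector_derivative 2 * \<i> * \<kappa> * Q2 t) (at t)"
      by (rule has_vector_derivative_eq_rhs, (rule intros)+)
         (unfold pos zdef u''_eq[OF t] a2, use nz eps kappa in \<open>auto simp: field_simps power2_eq_square ii2\<close>)
  qed
  show "(Q1 has_vector_derivative - 2 * \<kappa> * \<i> * N1 t * N2 t * Q1 t / t) (at t)"
  proof (rule tr[OF _ NQ_pos(3)])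
    show "((\<lambda>t. - \<i> * \<epsilon> * b * (of_real t * inverse (u t) * exp (\<i> * \<kappa> * \<phi> t)))
        has_vector_derivative - 2 * \<kappa> * \<i> * N1 t * N2 t * Q1 t / t) (at t)"
      by (rule has_vector_derivative_eq_rhs, (rule intros)+)
         (unfold pos zdef, use nz eps kappa in \<open>auto simp: field_simps power2_eq_square ii2\<close>)
  qed
  show "(Q2 has_vector_derivative 2 * \<kappa> * \<i> * N1 t * N2 t * Q2 t / t) (at t)"
  proof (rule tr[OF _ NQ_pos(4)])
    show "((\<lambda>t. - \<i> * (u t * inverse (of_real t) * exp (- \<i> * \<kappa> * \<phi> t)))
        has_vector_derivative 2 * \<kappa> * \<i> * N1 t * N2 t * Q2 t / t) (at t)"
      by (rule has_vector_derivative_eq_rhs, (rule intros)+)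
         (unfold pos zdef, use nz eps kappa in \<open>auto simp: field_simps power2_eq_square ii2\<close>)
  qed
qed

lemma NQ_continuous:
  "continuous_on {0..\<tau>} N1" "continuous_on {0..\<tau>} N2" "continuous_on {0..\<tau>} Q1" "continuous_on {0..\<tau>} Q2"
proof -
  have "continuous_on {0<..\<tau>} f"
    if "\<And>t. t \<in> {0<..<\<tau>\<^sub>0} \<Longrightarrow> (f has_vector_derivative f' t) (at t)" for f f' :: "real \<Rightarrow> complex"
  proof (rule continuous_at_imp_continuous_on, rule ballI)
    fix t assume "t \<in> {0<..\<tau>}"
    then show "isCont f t" using tau by (intro has_vector_derivative_continuous[OF that]) auto
  qed
  from this[OF NQ_deriv(1)] this[OF NQ_deriv(2)] this[OF NQ_deriv(3)] this[OF NQ_deriv(4)]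
  have c: "continuous_on {0<..\<tau>} N1" "continuous_on {0<..\<tau>} N2" "continuous_on {0<..\<tau>} Q1" "continuous_on {0<..\<tau>} Q2"
    by blast+
  have kb: "\<i> * \<kappa> * b \<noteq> 0" using kappa b_nonzero by auto
  have pos: "\<forall>\<^sub>F t in at_right 0. (t::real) \<noteq> 0"
    by (auto simp: eventually_at_right_field intro: exI[of _ 1])
  have tl: "((\<lambda>t. complex_of_real t) \<longlongrightarrow> 0) (at_right 0)"
    by (rule tendsto_eq_rhs[OF tendsto_of_real[OF tendsto_ident_at]]) simp
  have e1: "((\<lambda>t. exp (\<i> * \<kappa> * \<phi> t)) \<longlongrightarrow> exp (\<i> * \<kappa> * \<phi>\<^sub>0)) (at_right 0)"
    and e2: "((\<lambda>t. exp (- \<i> * \<kappa> * \<phi> t)) \<longlongrightarrow> exp (- \<i> * \<kappa> * \<phi>\<^sub>0)) (at_right 0)"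
    by (intro tendsto_intros phi_limit)+
  have il: "((\<lambda>t. of_real t / u t) \<longlongrightarrow> inverse (\<i> * \<kappa> * b)) (at_right 0)"
    using tendsto_inverse[OF limits_at_0(1) kb] by (simp add: divide_inverse mult.commute)
  have inv: "- \<i> * \<epsilon> * b * (inverse (\<i> * \<kappa> * b) * z) = - \<kappa> * \<epsilon> * z" for z :: complex
    using kappa b_nonzero by (auto simp: field_simps)
  have ev: "(f \<longlongrightarrow> l) (at_right 0)"
    if "(g \<longlongrightarrow> l) (at_right 0)" "\<And>t. t \<noteq> 0 \<Longrightarrow> g t = f t" for f g :: "real \<Rightarrow> complex" and l
    by (rule Lim_transform_eventually[OF that(1)]) (use pos in eventually_elim, use that(2) in simp)
  show "continuous_on {0..\<tau>} N1"
  proof (rule continuous_on_from_limit[OF c(1)], rule ev)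
    show "((\<lambda>t. 2 * \<i> * \<epsilon> * (of_real t * exp (\<i> * \<kappa> * \<phi> t))) \<longlongrightarrow> N1 0) (at_right 0)"
      by (rule tendsto_eq_rhs[OF tendsto_mult_left[OF tendsto_mult[OF tl e1]]]) (simp add: N1_def)
  qed (simp add: N1_def)
  show "continuous_on {0..\<tau>} N2"
  proof (rule continuous_on_from_limit[OF c(2)], rule ev)
    show "((\<lambda>t. - (\<kappa> * \<epsilon> / 4) * (exp (- \<i> * \<kappa> * \<phi> t) * ((u' t - \<i> * \<kappa> * b) / u t))) \<longlongrightarrow> N2 0) (at_right 0)"
      by (rule tendsto_eq_rhs[OF tendsto_mult_left[OF tendsto_mult[OF e2 limits_at_0(2)]]]) (simp add: N2_def)
  qed (simp add: N2_def)
  show "continuous_on {0..\<tau>} Q1"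
  proof (rule continuous_on_from_limit[OF c(3)], rule ev)
    show "((\<lambda>t. - \<i> * \<epsilon> * b * (of_real t / u t * exp (\<i> * \<kappa> * \<phi> t))) \<longlongrightarrow> Q1 0) (at_right 0)"
      by (rule tendsto_eq_rhs[OF tendsto_mult_left[OF tendsto_mult[OF il e1]]]) (unfold inv Q1_def, simp)
  qed (simp add: Q1_def)
  show "continuous_on {0..\<tau>} Q2"
  proof (rule continuous_on_from_limit[OF c(4)], rule ev)
    show "((\<lambda>t. - \<i> * (u t / of_real t * exp (- \<i> * \<kappa> * \<phi> t))) \<longlongrightarrow> Q2 0) (at_right 0)"
      by (rule tendsto_eq_rhs[OF tendsto_mult_left[OF tendsto_mult[OF limits_at_0(1) e2]]])
         (simp add: Q2_def mult.assoc[symmetric])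
  qed (simp add: Q2_def)
qed

definition lam :: real where "lam = sqrt (\<epsilon> * b)"

lemma Q1_Q2:
  assumes "t \<in> {0..\<tau>}"
  shows "Q1 t * Q2 t = - (of_real lam)\<^sup>2"
proof -
  have l: "(complex_of_real lam)\<^sup>2 = of_real \<epsilon> * of_real b"
    using eb by (simp add: lam_def flip: of_real_power)
  show ?thesis
  proof (cases "t = 0")
    case True
    then show ?thesis unfolding l using kappa by (auto simp: Q1_def Q2_def exp_minus)
  next
    case False
    then have "u t \<noteq> 0" using assms tau by (intro u_nonzero) auto
    then show ?thesis unfolding l using False by (simp add: Q1_def Q2_def exp_minus field_simps ii2)
  qed
qed

sublocale lax_flow \<kappa> \<tau> lam N1 N2 Q1 Q2
proof
  show "0 < lam" using eb by (simp add: lam_def)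
  fix t assume "t \<in> {0<..<\<tau>}"
  then have t: "t \<in> {0<..<\<tau>\<^sub>0}" using tau by auto
  show "(N1 has_vector_derivative - 2 * \<i> * \<kappa> * Q1 t) (at t)"
    "(N2 has_vector_derivative 2 * \<i> * \<kappa> * Q2 t) (at t)"
    "(Q1 has_vector_derivative - 2 * \<kappa> * \<i> * N1 t * N2 t * Q1 t / t) (at t)"
    "(Q2 has_vector_derivative 2 * \<kappa> * \<i> * N1 t * N2 t * Q2 t / t) (at t)"
    by (rule NQ_deriv[OF t])+
qed (use tau kappa NQ_continuous Q1_Q2 in \<open>auto simp: N1_def\<close>)

text \<open>A choice is made because the instance below has to name one fixed function; an entire
  function has a primitive, and subtracting its value at 0 normalises it.\<close>

definition gauss_primitive :: "complex \<Rightarrow> complex" where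
  "gauss_primitive = (SOME F. (\<forall>z. (F has_field_derivative exp (- 2 * \<i> * \<kappa> * z\<^sup>2)) (at z)) \<and> F 0 = 0)"

sublocale lax_flow_primitive \<kappa> \<tau> lam N1 N2 Q1 Q2 gauss_primitive
proof
  obtain F where F: "\<And>z. (F has_field_derivative exp (- 2 * \<i> * \<kappa> * z\<^sup>2)) (at z)"
  proof (rule holomorphic_convex_primitive'[of UNIV "\<lambda>z. exp (- 2 * \<i> * \<kappa> * z\<^sup>2)"])
    show "(\<lambda>z. exp (- 2 * \<i> * \<kappa> * z\<^sup>2)) holomorphic_on UNIV" by (intro holomorphic_intros)
  qed auto
  have "((\<lambda>z. F z - F 0) has_field_derivative exp (- 2 * \<i> * \<kappa> * z\<^sup>2)) (at z)" for z
    using DERIV_diff[OF F DERIV_const] by simp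
  then have "(\<forall>z. ((\<lambda>z. F z - F 0) has_field_derivative exp (- 2 * \<i> * \<kappa> * z\<^sup>2)) (at z)) \<and> F 0 - F 0 = 0"
    by simp
  then have "(\<forall>z. (gauss_primitive has_field_derivative exp (- 2 * \<i> * \<kappa> * z\<^sup>2)) (at z)) \<and> gauss_primitive 0 = 0"
    unfolding gauss_primitive_def by (rule someI[where P = "\<lambda>F. (\<forall>z. (F has_field_derivative exp (- 2 * \<i> * \<kappa> * z\<^sup>2)) (at z)) \<and> F 0 = 0"])
  then show "(gauss_primitive has_field_derivative exp (- 2 * \<i> * \<kappa> * z\<^sup>2)) (at z)" "gauss_primitive 0 = 0" for z by auto
qed

section \<open>Gauge transformation of the Lax pair\<close>

definition t4 :: complex where "t4 = of_real (root 4 \<tau>)"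

lemma t4: "t4 \<noteq> 0" "of_real \<tau> = t4 ^ 4" "of_real (sqrt \<tau>) = t4\<^sup>2"
proof -
  have "root 4 \<tau> ^ 4 = \<tau>" using tau by simp
  then show "of_real \<tau> = t4 ^ 4" unfolding t4_def by (metis of_real_power)
  show "t4 \<noteq> 0" using tau by (simp add: t4_def)
  have "sqrt \<tau> = (root 4 \<tau>)\<^sup>2"
    using tau real_root_mult_exp[of 2 2 \<tau>] by (simp add: sqrt_def)
  then show "of_real (sqrt \<tau>) = t4\<^sup>2" by (simp add: t4_def)
qed

definition e\<phi> :: complex where "e\<phi> = exp (\<i> * \<phi> \<tau>)"

text \<open>For \<open>\<kappa> = 1\<close> a diagonal gauge makes the system regular at \<open>\<tau> = 0\<close>.  For \<open>\<kappa> = - 1\<close> the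
  factor \<open>\<mu>\<^bsup>-\<sigma>\<^sub>3\<^esup>\<close> at infinity is first removed by an elementary Schlesinger transformation; the
  components are interchanged so that both cases lead to the same lower triangular system at
  \<open>\<tau> = 0\<close>.\<close>

definition gauge_b :: "(complex \<Rightarrow> complex^2^2) \<Rightarrow> 2 \<Rightarrow> complex \<Rightarrow> complex" where
  "gauge_b Y j \<zeta> = (if \<kappa> = 1 then t4 * Y \<zeta> $ 1 $ j else \<epsilon> / e\<phi> * t4 * Y \<zeta> $ 1 $ j)"

definition gauge_a :: "(complex \<Rightarrow> complex^2^2) \<Rightarrow> 2 \<Rightarrow> complex \<Rightarrow> complex" where
  "gauge_a Y j \<zeta> = (if \<kappa> = 1 then Y \<zeta> $ 2 $ j / t4
     else \<epsilon> * e\<phi> / t4 * Y \<zeta> $ 2 $ j - xv \<zeta> / t4 ^ 3 * Y \<zeta> $ 1 $ j)"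

lemma e\<phi>: "e\<phi> \<noteq> 0" "exp (- \<i> * \<phi> \<tau>) = 1 / e\<phi>" "exp (\<i> * \<phi> \<tau>) = e\<phi>"
  by (simp_all add: e\<phi>_def exp_minus divide_inverse)

lemma tau_mem: "\<tau> \<in> {0<..<\<tau>\<^sub>0}" using tau by simp

lemma u\<tau>: "u \<tau> \<noteq> 0" using u_nonzero[OF tau_mem] .

text \<open>The logarithmic derivative of B is u'/u - 1/\<tau> - i \<phi>'; the term i \<kappa> /
  \<tau> in \<phi>' turns -1/\<tau> into (\<kappa> - 1)/\<tau>, which disappears for
  \<open>\<kappa> = 1\<close>.\<close>

lemma D_value:
  "D_fun \<epsilon> u \<phi> \<tau> = \<epsilon> / 4 / e\<phi> * (u' \<tau> / u \<tau> + (\<kappa> - 1) / of_real \<tau> - \<i> * b / u \<tau>)"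
proof -
  have "((\<lambda>t. \<phi> t) has_vector_derivative \<i> * \<kappa> / of_real \<tau> + of_real b / u \<tau>) (at \<tau>)"
    by (rule phi_deriv[OF tau_mem])
  from field_vector_diff_chain_at[OF has_vector_derivative_mult_right[OF this, of "- \<i>"] DERIV_exp]
  have e: "((\<lambda>t. exp (- \<i> * \<phi> t)) has_vector_derivative
      (- \<i> * (\<i> * \<kappa> / of_real \<tau> + of_real b / u \<tau>)) * exp (- \<i> * \<phi> \<tau>)) (at \<tau>)"
    by (simp add: o_def)
  have "((\<lambda>t. - (u t * inverse (of_real t)) * exp (- \<i> * \<phi> t)) has_vector_derivative
      - (u \<tau> * inverse (of_real \<tau>)) * ((- \<i> * (\<i> * \<kappa> / of_real \<tau> + of_real b / u \<tau>)) * exp (- \<i> * \<phi> \<tau>))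
      + - (u \<tau> * (- (inverse (of_real \<tau>))\<^sup>2) + u' \<tau> * inverse (of_real \<tau>)) * exp (- \<i> * \<phi> \<tau>)) (at \<tau>)"
    by (intro has_vector_derivative_mult has_vector_derivative_minus e inverse_derivs u_deriv tau_mem)
  then have "(B_fun u \<phi> has_vector_derivative
      - (u \<tau> * inverse (of_real \<tau>)) * ((- \<i> * (\<i> * \<kappa> / of_real \<tau> + of_real b / u \<tau>)) * exp (- \<i> * \<phi> \<tau>))
      + - (u \<tau> * (- (inverse (of_real \<tau>))\<^sup>2) + u' \<tau> * inverse (of_real \<tau>)) * exp (- \<i> * \<phi> \<tau>)) (at \<tau>)"
    unfolding B_fun_def[abs_def] divide_inverse .
  then have vd: "vector_derivative (B_fun u \<phi>) (at \<tau>) =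
      - (u \<tau> * inverse (of_real \<tau>)) * ((- \<i> * (\<i> * \<kappa> / of_real \<tau> + of_real b / u \<tau>)) * exp (- \<i> * \<phi> \<tau>))
      + - (u \<tau> * (- (inverse (of_real \<tau>))\<^sup>2) + u' \<tau> * inverse (of_real \<tau>)) * exp (- \<i> * \<phi> \<tau>)"
    by (rule vector_derivative_at)
  show ?thesis
    unfolding D_fun_def sqrtmAB_def vd e\<phi>
    using eps u\<tau> tau e\<phi>(1) by (auto simp: field_simps power2_eq_square ii2)
qed

lemma NQ_tau:
  "N1 \<tau> = 2 * \<i> * \<epsilon> * (of_real \<tau> * exp (\<i> * \<kappa> * \<phi> \<tau>))"
  "N2 \<tau> = - (\<kappa> * \<epsilon> / 4) * ((u' \<tau> - \<i> * \<kappa> * b) / (u \<tau> * exp (\<i> * \<kappa> * \<phi> \<tau>)))"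
  "Q1 \<tau> = - \<i> * \<epsilon> * b * (of_real \<tau> / u \<tau> * exp (\<i> * \<kappa> * \<phi> \<tau>))"
  "Q2 \<tau> = - \<i> * (u \<tau> / (of_real \<tau> * exp (\<i> * \<kappa> * \<phi> \<tau>)))"
  unfolding NQ_pos[OF tau_mem] exp_phi_inverse using u\<tau> by (simp_all add: field_simps)

lemma column_deriv:
  assumes "mu_solution \<epsilon> a b u \<phi> \<tau> Y"
  shows "((\<lambda>z. Y z $ 1 $ j) has_field_derivative exp \<zeta> *
      (U_mat \<epsilon> a b u \<phi> \<tau> (exp \<zeta>) $ 1 $ 1 * Y \<zeta> $ 1 $ j + U_mat \<epsilon> a b u \<phi> \<tau> (exp \<zeta>) $ 1 $ 2 * Y \<zeta> $ 2 $ j)) (at \<zeta>)"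
    and "((\<lambda>z. Y z $ 2 $ j) has_field_derivative exp \<zeta> *
      (U_mat \<epsilon> a b u \<phi> \<tau> (exp \<zeta>) $ 2 $ 1 * Y \<zeta> $ 1 $ j + U_mat \<epsilon> a b u \<phi> \<tau> (exp \<zeta>) $ 2 $ 2 * Y \<zeta> $ 2 $ j)) (at \<zeta>)"
  using assms unfolding mu_solution_def cscale_nth matrix_mult_nth by blast+

text \<open>The factor \<open>m\<close> comes from differentiating in \<zeta> = ln \<mu>, and x is
  \<open>t4\<^sup>2 * m\<close>. The constant (1 - \<kappa>)/2 is i a + 1/2: it vanishes for
  \<open>\<kappa> = 1\<close> and equals 1 for \<open>\<kappa> = - 1\<close>, where a Schlesinger
  step becomes necessary.\<close>

lemma U_entries:
  fixes m :: complex
  assumes "m \<noteq> 0"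
  defines "D \<equiv> D_fun \<epsilon> u \<phi> \<tau>"
  shows "m * U_mat \<epsilon> a b u \<phi> \<tau> m $ 1 $ 1 = - 2 * \<i> * (t4\<^sup>2 * m)\<^sup>2 - ((1 - \<kappa>) / 2 + 2 * t4 ^ 4 * \<epsilon> * e\<phi> * D)"
    and "m * U_mat \<epsilon> a b u \<phi> \<tau> m $ 2 $ 2 = 2 * \<i> * (t4\<^sup>2 * m)\<^sup>2 + ((1 - \<kappa>) / 2 + 2 * t4 ^ 4 * \<epsilon> * e\<phi> * D)"
    and "m * U_mat \<epsilon> a b u \<phi> \<tau> m $ 1 $ 2 = 4 * \<i> * t4 ^ 4 * \<epsilon> * e\<phi> * m - \<i> * \<epsilon> * b * t4 ^ 4 * e\<phi> / (u \<tau> * m)"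
    and "m * U_mat \<epsilon> a b u \<phi> \<tau> m $ 2 $ 1 = - 2 * t4 ^ 4 * D * m - \<i> * u \<tau> / (e\<phi> * m)"
proof -
  have R0: "sqrtmAB \<epsilon> u \<tau> \<noteq> 0"
    using eps u\<tau> tau by (auto simp: sqrtmAB_def)
  have AR: "A_fun u \<phi> \<tau> = \<epsilon> * e\<phi> * sqrtmAB \<epsilon> u \<tau>"
    using eps by (auto simp: A_fun_def sqrtmAB_def e\<phi>_def)
  have ia: "\<i> * a + 1 / 2 = (1 - \<kappa>) / 2"
    by (simp add: a_eq algebra_simps diff_divide_distrib)
  have al: "alpha_fun \<epsilon> b u \<phi> \<tau> = - \<i> * \<epsilon> * b * t4 ^ 4 * e\<phi> / u \<tau>"
    unfolding alpha_fun_def B_fun_def e\<phi> t4(2) using u\<tau> e\<phi>(1) t4(1) by (simp add: field_simps t4(2))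
  have Bv: "B_fun u \<phi> \<tau> = - u \<tau> / (t4 ^ 4 * e\<phi>)"
    unfolding B_fun_def e\<phi> t4(2) by simp
  have AR': "2 * of_real \<tau> * A_fun u \<phi> \<tau> * D / sqrtmAB \<epsilon> u \<tau> = 2 * of_real \<tau> * \<epsilon> * e\<phi> * D"
    "2 * \<i> * A_fun u \<phi> \<tau> / sqrtmAB \<epsilon> u \<tau> = 2 * \<i> * \<epsilon> * e\<phi>"
    unfolding AR using R0 by simp_all
  have U: "U_mat \<epsilon> a b u \<phi> \<tau> m $ 1 $ 1 = - 2 * \<i> * t4 ^ 4 * m - 1 / m * ((1 - \<kappa>) / 2 + 2 * t4 ^ 4 * \<epsilon> * e\<phi> * D)"
    "U_mat \<epsilon> a b u \<phi> \<tau> m $ 2 $ 2 = 2 * \<i> * t4 ^ 4 * m + 1 / m * ((1 - \<kappa>) / 2 + 2 * t4 ^ 4 * \<epsilon> * e\<phi> * D)"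
    "U_mat \<epsilon> a b u \<phi> \<tau> m $ 1 $ 2 = 2 * t4 ^ 4 * (2 * \<i> * \<epsilon> * e\<phi>) + 1 / m\<^sup>2 * alpha_fun \<epsilon> b u \<phi> \<tau>"
    "U_mat \<epsilon> a b u \<phi> \<tau> m $ 2 $ 1 = - 2 * t4 ^ 4 * D + 1 / m\<^sup>2 * (\<i> * t4 ^ 4 * B_fun u \<phi> \<tau>)"
    unfolding U_mat_def Let_def D_def[symmetric] sigma3_def AR' ia t4(2)[symmetric]
    by simp_all
  show "m * U_mat \<epsilon> a b u \<phi> \<tau> m $ 1 $ 1 = - 2 * \<i> * (t4\<^sup>2 * m)\<^sup>2 - ((1 - \<kappa>) / 2 + 2 * t4 ^ 4 * \<epsilon> * e\<phi> * D)"
    "m * U_mat \<epsilon> a b u \<phi> \<tau> m $ 2 $ 2 = 2 * \<i> * (t4\<^sup>2 * m)\<^sup>2 + ((1 - \<kappa>) / 2 + 2 * t4 ^ 4 * \<epsilon> * e\<phi> * D)"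
    unfolding U using assms(1) by (simp_all add: algebra_simps power2_eq_square power4_eq_xxxx)
  show "m * U_mat \<epsilon> a b u \<phi> \<tau> m $ 1 $ 2 = 4 * \<i> * t4 ^ 4 * \<epsilon> * e\<phi> * m - \<i> * \<epsilon> * b * t4 ^ 4 * e\<phi> / (u \<tau> * m)"
    unfolding U al using assms(1) u\<tau> by (simp add: field_simps power2_eq_square)
  show "m * U_mat \<epsilon> a b u \<phi> \<tau> m $ 2 $ 1 = - 2 * t4 ^ 4 * D * m - \<i> * u \<tau> / (e\<phi> * m)"
    unfolding U Bv using assms(1) u\<tau> e\<phi>(1) t4(1) by (simp add: field_simps power2_eq_square)
qed

lemma gauge_relations_plus:
  fixes m :: complex
  assumes k: "\<kappa> = 1" and m: "m \<noteq> 0"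
  defines "D \<equiv> D_fun \<epsilon> u \<phi> \<tau>"
  shows "2 * t4 ^ 4 * \<epsilon> * e\<phi> * D = diag \<tau>"
    and "4 * \<i> * t4 ^ 4 * \<epsilon> * e\<phi> * m - \<i> * \<epsilon> * b * t4 ^ 4 * e\<phi> / (u \<tau> * m)
      = offdiag1 (t4\<^sup>2 * m) (1 / (t4\<^sup>2 * m)) \<tau> / t4\<^sup>2"
    and "- 2 * t4 ^ 4 * D * m - \<i> * u \<tau> / (e\<phi> * m) = offdiag2 (t4\<^sup>2 * m) (1 / (t4\<^sup>2 * m)) \<tau> * t4\<^sup>2"
proof -
  note nz = t4(1) e\<phi>(1) u\<tau> m
  have ke: "exp (\<i> * of_real \<kappa> * \<phi> \<tau>) = e\<phi>" by (simp add: k e\<phi>_def)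
  have DN: "D = - N2 \<tau>"
    unfolding D_def D_value NQ_tau ke using nz k by (simp add: field_simps t4(2))
  show "2 * t4 ^ 4 * \<epsilon> * e\<phi> * D = diag \<tau>"
    unfolding DN diag_def NQ_tau(1) ke t4(2) by (simp add: ii2 mult.assoc t4(2))
  show "4 * \<i> * t4 ^ 4 * \<epsilon> * e\<phi> * m - \<i> * \<epsilon> * b * t4 ^ 4 * e\<phi> / (u \<tau> * m)
      = offdiag1 (t4\<^sup>2 * m) (1 / (t4\<^sup>2 * m)) \<tau> / t4\<^sup>2"
    unfolding offdiag1_def NQ_tau(1,3) ke t4(2) using nz by (simp add: field_simps t4(2))
  show "- 2 * t4 ^ 4 * D * m - \<i> * u \<tau> / (e\<phi> * m) = offdiag2 (t4\<^sup>2 * m) (1 / (t4\<^sup>2 * m)) \<tau> * t4\<^sup>2"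
    unfolding DN offdiag2_def NQ_tau(4) ke t4(2) using nz by (simp add: field_simps t4(2))
qed

text \<open>Up to powers of \<open>e\<phi>\<close> and \<open>t4\<close> the entries agree with
  those of the target system except for terms that the shear in \<open>gauge_a\<close> has to
  absorb. The third equation factors the upper right entry for this purpose, the fourth isolates the
  excess in the lower left one.\<close>

lemma gauge_relations_minus:
  fixes m :: complex
  assumes k: "\<kappa> = - 1" and m: "m \<noteq> 0"
  defines "D \<equiv> D_fun \<epsilon> u \<phi> \<tau>"
  shows "1 + 2 * t4 ^ 4 * \<epsilon> * e\<phi> * D = - diag \<tau> - \<i> * b * t4 ^ 4 / u \<tau>"
    and "4 * \<i> * t4 ^ 4 * \<epsilon> * e\<phi> * m - \<i> * \<epsilon> * b * t4 ^ 4 * e\<phi> / (u \<tau> * m)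
      = offdiag1 (t4\<^sup>2 * m) (1 / (t4\<^sup>2 * m)) \<tau> * (e\<phi> * e\<phi>) / t4\<^sup>2"
    and "4 * \<i> * t4 ^ 4 * \<epsilon> * e\<phi> * m - \<i> * \<epsilon> * b * t4 ^ 4 * e\<phi> / (u \<tau> * m)
      = \<epsilon> * e\<phi> / m * (4 * \<i> * (t4\<^sup>2 * m)\<^sup>2 - \<i> * b * t4 ^ 4 / u \<tau>)"
    and "- 2 * t4 ^ 4 * D * m - \<i> * u \<tau> / (e\<phi> * m) =
      offdiag2 (t4\<^sup>2 * m) (1 / (t4\<^sup>2 * m)) \<tau> * t4\<^sup>2 / (e\<phi> * e\<phi>)
        + \<epsilon> * m / e\<phi> * (1 + 2 * diag \<tau> + \<i> * b * t4 ^ 4 / u \<tau>)"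
proof -
  note nz = t4(1) e\<phi>(1) u\<tau> m
  have ke: "exp (\<i> * of_real \<kappa> * \<phi> \<tau>) = 1 / e\<phi>" by (simp add: k e\<phi>_def exp_minus divide_inverse)
  have Dv: "D = \<epsilon> / (4 * e\<phi>) * (u' \<tau> / u \<tau> - 2 / t4 ^ 4 - \<i> * b / u \<tau>)"
    unfolding D_def D_value k by (simp add: t4(2))
  have dv: "diag \<tau> = - (t4 ^ 4 / 2) * (u' \<tau> + \<i> * b) / u \<tau>"
    unfolding diag_def NQ_tau(1,2) ke t4(2) using nz k eps by (auto simp: t4(2) field_simps ii2)
  show "1 + 2 * t4 ^ 4 * \<epsilon> * e\<phi> * D = - diag \<tau> - \<i> * b * t4 ^ 4 / u \<tau>"
    unfolding Dv dv using nz eps by (auto simp: t4(2) field_simps)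
  show "4 * \<i> * t4 ^ 4 * \<epsilon> * e\<phi> * m - \<i> * \<epsilon> * b * t4 ^ 4 * e\<phi> / (u \<tau> * m)
      = offdiag1 (t4\<^sup>2 * m) (1 / (t4\<^sup>2 * m)) \<tau> * (e\<phi> * e\<phi>) / t4\<^sup>2"
    unfolding offdiag1_def NQ_tau(1,3) ke t4(2) using nz by (simp add: field_simps t4(2))
  show "4 * \<i> * t4 ^ 4 * \<epsilon> * e\<phi> * m - \<i> * \<epsilon> * b * t4 ^ 4 * e\<phi> / (u \<tau> * m)
      = \<epsilon> * e\<phi> / m * (4 * \<i> * (t4\<^sup>2 * m)\<^sup>2 - \<i> * b * t4 ^ 4 / u \<tau>)"
    using nz by (simp add: field_simps power2_eq_square power4_eq_xxxx)
  have o2: "offdiag2 (t4\<^sup>2 * m) (1 / (t4\<^sup>2 * m)) \<tau> =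
      t4\<^sup>2 * m * (\<epsilon> / 2) * ((u' \<tau> + \<i> * b) * e\<phi> / u \<tau>) - \<i> * u \<tau> * e\<phi> / (t4\<^sup>2 * m)"
    unfolding offdiag2_def NQ_tau(2,4) ke t4(2) using nz k by (simp add: field_simps t4(2))
  show "- 2 * t4 ^ 4 * D * m - \<i> * u \<tau> / (e\<phi> * m) =
      offdiag2 (t4\<^sup>2 * m) (1 / (t4\<^sup>2 * m)) \<tau> * t4\<^sup>2 / (e\<phi> * e\<phi>)
        + \<epsilon> * m / e\<phi> * (1 + 2 * diag \<tau> + \<i> * b * t4 ^ 4 / u \<tau>)"
  proof -
    have 1: "- 2 * t4 ^ 4 * D * m = - (\<epsilon> * m / (2 * e\<phi>)) * (t4 ^ 4 * u' \<tau> / u \<tau> - 2 - \<i> * b * t4 ^ 4 / u \<tau>)"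
      unfolding Dv using nz by (simp add: field_simps t4(2))
    have 2: "offdiag2 (t4\<^sup>2 * m) (1 / (t4\<^sup>2 * m)) \<tau> * t4\<^sup>2 / (e\<phi> * e\<phi>) =
        \<epsilon> * m / (2 * e\<phi>) * (t4 ^ 4 * u' \<tau> / u \<tau> + \<i> * b * t4 ^ 4 / u \<tau>) - \<i> * u \<tau> / (e\<phi> * m)"
      unfolding o2 using nz by (simp add: field_simps power2_eq_square power4_eq_xxxx)
    have 3: "\<epsilon> * m / e\<phi> * (1 + 2 * diag \<tau> + \<i> * b * t4 ^ 4 / u \<tau>) =
        \<epsilon> * m / (2 * e\<phi>) * (2 - 2 * (t4 ^ 4 * u' \<tau> / u \<tau>))"
      unfolding dv using nz by (simp add: field_simps t4(2))
    show ?thesis unfolding 1 2 3 by (simp add: algebra_simps)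
  qed
qed

lemma gauge_rotated_system:
  assumes sol: "mu_solution \<epsilon> a b u \<phi> \<tau> Y"
  shows "rotated_system (gauge_b Y j) (gauge_a Y j)"
proof -
  note nz = t4(1) e\<phi>(1) u\<tau>
  have "(gauge_b Y j has_field_derivative
        - \<kappa> * (2 * \<i> * (xv \<zeta>)\<^sup>2 + diag \<tau>) * gauge_b Y j \<zeta> + offdiag1 (xv \<zeta>) (yv \<zeta>) \<tau> * gauge_a Y j \<zeta>) (at \<zeta>) \<and>
     (gauge_a Y j has_field_derivative
        offdiag2 (xv \<zeta>) (yv \<zeta>) \<tau> * gauge_b Y j \<zeta> + \<kappa> * (2 * \<i> * (xv \<zeta>)\<^sup>2 + diag \<tau>) * gauge_a Y j \<zeta>) (at \<zeta>)" for \<zeta>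
  proof -
    define m where "m = exp \<zeta>"
    define P where "P = Y \<zeta> $ 1 $ j"
    define R where "R = Y \<zeta> $ 2 $ j"
    have m: "m \<noteq> 0" by (simp add: m_def)
    have x: "xv \<zeta> = t4\<^sup>2 * m" by (simp add: xv_def t4(3) m_def)
    have y: "yv \<zeta> = 1 / (t4\<^sup>2 * m)" by (simp add: yv_def x)
    have dP: "((\<lambda>z. Y z $ 1 $ j) has_field_derivative
        (m * U_mat \<epsilon> a b u \<phi> \<tau> m $ 1 $ 1) * P + (m * U_mat \<epsilon> a b u \<phi> \<tau> m $ 1 $ 2) * R) (at \<zeta>)"
      using column_deriv(1)[OF sol, of j \<zeta>] by (simp add: m_def P_def R_def algebra_simps)
    have dR: "((\<lambda>z. Y z $ 2 $ j) has_field_derivative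
        (m * U_mat \<epsilon> a b u \<phi> \<tau> m $ 2 $ 1) * P + (m * U_mat \<epsilon> a b u \<phi> \<tau> m $ 2 $ 2) * R) (at \<zeta>)"
      using column_deriv(2)[OF sol, of j \<zeta>] by (simp add: m_def P_def R_def algebra_simps)
    define w where "w = 2 * \<i> * (t4\<^sup>2 * m)\<^sup>2"
    define o1 where "o1 = offdiag1 (t4\<^sup>2 * m) (1 / (t4\<^sup>2 * m)) \<tau>"
    define o2 where "o2 = offdiag2 (t4\<^sup>2 * m) (1 / (t4\<^sup>2 * m)) \<tau>"
    define q where "q = \<i> * b * t4 ^ 4 / u \<tau>"
    show ?thesis
    proof (cases "\<kappa> = 1")
      case True
      note rel = gauge_relations_plus[OF True m]
      have kc: "complex_of_real \<kappa> = 1" by (simp add: True)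
      have U: "m * U_mat \<epsilon> a b u \<phi> \<tau> m $ 1 $ 1 = - w - diag \<tau>" "m * U_mat \<epsilon> a b u \<phi> \<tau> m $ 2 $ 2 = w + diag \<tau>"
        "m * U_mat \<epsilon> a b u \<phi> \<tau> m $ 1 $ 2 = o1 / t4\<^sup>2" "m * U_mat \<epsilon> a b u \<phi> \<tau> m $ 2 $ 1 = o2 * t4\<^sup>2"
        unfolding U_entries[OF m] rel(2,3) o1_def o2_def w_def by (simp_all add: kc rel(1))
      have g: "gauge_b Y j \<zeta> = t4 * P" "gauge_a Y j \<zeta> = R / t4"
        by (simp_all add: gauge_b_def gauge_a_def if_P[OF True] P_def R_def)
      have gf: "gauge_b Y j = (\<lambda>z. t4 * Y z $ 1 $ j)" "gauge_a Y j = (\<lambda>z. Y z $ 2 $ j / t4)"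
        by (auto simp: gauge_b_def gauge_a_def if_P[OF True])
      show ?thesis
        unfolding g x y o1_def[symmetric] o2_def[symmetric] w_def[symmetric] mult.assoc[symmetric, of 2 \<i>]
        unfolding gf
        by (intro conjI DERIV_cong[OF DERIV_cmult[OF dP[unfolded U]]] DERIV_cong[OF DERIV_cdivide[OF dR[unfolded U]]])
           (use nz in \<open>simp_all add: kc field_simps power2_eq_square\<close>)
    next
      case False
      then have km: "\<kappa> = - 1" using kappa by auto
      note rel = gauge_relations_minus[OF km m]
      have kc: "complex_of_real \<kappa> = - 1" by (simp add: km)
      have p: "((1 - \<kappa>) / 2 + 2 * t4 ^ 4 * \<epsilon> * e\<phi> * D_fun \<epsilon> u \<phi> \<tau>) = - diag \<tau> - q"
        using rel(1) by (simp add: kc q_def)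
      have U: "m * U_mat \<epsilon> a b u \<phi> \<tau> m $ 1 $ 1 = - w + diag \<tau> + q" "m * U_mat \<epsilon> a b u \<phi> \<tau> m $ 2 $ 2 = w - diag \<tau> - q"
        "m * U_mat \<epsilon> a b u \<phi> \<tau> m $ 1 $ 2 = o1 * (e\<phi> * e\<phi>) / t4\<^sup>2"
        "m * U_mat \<epsilon> a b u \<phi> \<tau> m $ 2 $ 1 = o2 * t4\<^sup>2 / (e\<phi> * e\<phi>) + \<epsilon> * m / e\<phi> * (1 + 2 * diag \<tau> + q)"
        unfolding U_entries[OF m] p rel(2,4) o1_def o2_def w_def q_def by simp_all
      have o1_eq: "o1 * (e\<phi> * e\<phi>) / t4\<^sup>2 = \<epsilon> * e\<phi> / m * (2 * w - q)"
      proof -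
        have "2 * w - q = 4 * \<i> * (t4\<^sup>2 * m)\<^sup>2 - \<i> * b * t4 ^ 4 / u \<tau>"
          by (simp add: w_def q_def)
        then show ?thesis unfolding o1_def rel(2)[symmetric] by (simp only: rel(3))
      qed
      have g: "gauge_b Y j \<zeta> = \<epsilon> / e\<phi> * t4 * P" "gauge_a Y j \<zeta> = \<epsilon> * e\<phi> / t4 * R - m / t4 * P"
        using nz by (simp_all add: gauge_b_def gauge_a_def if_not_P[OF False] P_def R_def x field_simps power2_eq_square power3_eq_cube)
      have gf: "gauge_b Y j = (\<lambda>z. (\<epsilon> / e\<phi> * t4) * Y z $ 1 $ j)"
        "gauge_a Y j = (\<lambda>z. (\<epsilon> * e\<phi> / t4) * Y z $ 2 $ j - xv z / t4 ^ 3 * Y z $ 1 $ j)"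
        by (auto simp: gauge_b_def gauge_a_def if_not_P[OF False])
      have dx: "((\<lambda>z. xv z / t4 ^ 3) has_field_derivative m / t4) (at \<zeta>)"
        using DERIV_cdivide[OF xv_deriv[of \<zeta>], of "t4 ^ 3"] nz
        unfolding x by (simp add: field_simps power2_eq_square power3_eq_cube)
      have x3: "xv \<zeta> / t4 ^ 3 = m / t4"
        unfolding x using nz by (simp add: field_simps power2_eq_square power3_eq_cube)
      have e2: "complex_of_real \<epsilon> * of_real \<epsilon> = 1" using eps by auto
      have "(gauge_b Y j has_field_derivative
          - \<kappa> * (w + diag \<tau>) * (\<epsilon> / e\<phi> * t4 * P) + o1 * (\<epsilon> * e\<phi> / t4 * R - m / t4 * P)) (at \<zeta>)"
      proof -
        \<comment> \<open>The shear moves 2w - q from the off-diagonal entry to the diagonal and so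
          turns w + diag into - w + diag + q. The sign change of w is the interchange of the two
          exponentials.\<close>
        have eq: "o1 * (m / t4 * P) = \<epsilon> / e\<phi> * t4 * P * (2 * w - q)"
        proof -
          have "o1 = \<epsilon> * e\<phi> / m * (2 * w - q) * t4\<^sup>2 / (e\<phi> * e\<phi>)"
            unfolding o1_eq[symmetric] using nz by simp
          then show ?thesis using nz m by (simp add: power2_eq_square)
        qed
        show ?thesis
          unfolding gf(1) right_diff_distrib eq
          by (rule DERIV_cong[OF DERIV_cmult[OF dP]])
             (unfold U(1,3), use nz in \<open>simp add: kc power2_eq_square algebra_simps\<close>)
      qed
      moreover have "(gauge_a Y j has_field_derivative
          o2 * (\<epsilon> / e\<phi> * t4 * P) + \<kappa> * (w + diag \<tau>) * (\<epsilon> * e\<phi> / t4 * R - m / t4 * P)) (at \<zeta>)"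
      proof -
        \<comment> \<open>\<open>A\<close> and \<open>B\<close> express the rescaled off-diagonal
          entries by the coefficients of the target system; the excess terms carry the factor m / t4
          of the shear and cancel against it.\<close>
        have A: "\<epsilon> * e\<phi> / t4 * (o2 * t4\<^sup>2 / (e\<phi> * e\<phi>) + \<epsilon> * m / e\<phi> * (1 + 2 * diag \<tau> + q))
            = o2 * (\<epsilon> / e\<phi> * t4) + m / t4 * (1 + 2 * diag \<tau> + q)"
          using nz eps by (auto simp: t4(2) field_simps power2_eq_square)
        have B: "m / t4 * (o1 * (e\<phi> * e\<phi>) / t4\<^sup>2) = \<epsilon> * e\<phi> / t4 * (2 * w - q)"
          unfolding o1_eq using m by simp
        have "\<epsilon> * e\<phi> / t4 * ((o2 * t4\<^sup>2 / (e\<phi> * e\<phi>) + \<epsilon> * m / e\<phi> * (1 + 2 * diag \<tau> + q)) * P + (w - diag \<tau> - q) * R)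
             - (m / t4 * P + ((- w + diag \<tau> + q) * P + o1 * (e\<phi> * e\<phi>) / t4\<^sup>2 * R) * (m / t4))
           = (o2 * (\<epsilon> / e\<phi> * t4) + m / t4 * (1 + 2 * diag \<tau> + q)) * P + \<epsilon> * e\<phi> / t4 * ((w - diag \<tau> - q) * R)
             - (m / t4 * P + (- w + diag \<tau> + q) * P * (m / t4) + \<epsilon> * e\<phi> / t4 * (2 * w - q) * R)"
          unfolding A[symmetric] B[symmetric] by (simp add: algebra_simps diff_divide_distrib add_divide_distrib)
        also have "\<dots> = o2 * (\<epsilon> / e\<phi> * t4 * P) + \<kappa> * (w + diag \<tau>) * (\<epsilon> * e\<phi> / t4 * R - m / t4 * P)"
          by (simp add: kc algebra_simps diff_divide_distrib add_divide_distrib)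
        finally show ?thesis
          unfolding gf(2)
          by (intro DERIV_cong[OF DERIV_diff[OF DERIV_cmult[OF dR[unfolded U]] DERIV_mult[OF dx dP[unfolded U]]]])
             (simp only: x3 P_def[symmetric])
      qed
      ultimately show ?thesis
        unfolding g x y o1_def[symmetric] o2_def[symmetric] w_def[symmetric] by blast
    qed
  qed
  then show ?thesis unfolding rotated_system_def by blast
qed

section \<open>Coordinate pairs of the canonical solutions\<close>

definition column_rep :: "(complex \<Rightarrow> complex^2^2) \<Rightarrow> 2 \<Rightarrow> complex \<Rightarrow> complex \<Rightarrow> bool" where
  "column_rep Y j v w \<longleftrightarrow> represents (gauge_b Y j) (gauge_a Y j) v w"

lemma column_rep_mult:
  assumes "column_rep Y 1 v1 w1" "column_rep Y 2 v2 w2" "\<And>\<zeta>. Z \<zeta> = Y \<zeta> ** M"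
  shows "column_rep Z j (v1 * M $ 1 $ j + v2 * M $ 2 $ j) (w1 * M $ 1 $ j + w2 * M $ 2 $ j)"
proof -
  have "gauge_b Z j = (\<lambda>\<zeta>. gauge_b Y 1 \<zeta> * M $ 1 $ j + gauge_b Y 2 \<zeta> * M $ 2 $ j)"
    "gauge_a Z j = (\<lambda>\<zeta>. gauge_a Y 1 \<zeta> * M $ 1 $ j + gauge_a Y 2 \<zeta> * M $ 2 $ j)"
    by (auto simp: fun_eq_iff gauge_b_def gauge_a_def assms(3) matrix_mult_nth algebra_simps
        add_divide_distrib diff_divide_distrib)
  then show ?thesis
    using represents_linear assms(1,2) unfolding column_rep_def by simp
qed

lemma column_rep_unique:
  assumes "column_rep Y j v w" "column_rep Y j v' w'"
  shows "v = v'" "w = w'"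
  using represents_unique assms unfolding column_rep_def by blast+

text \<open>The diagonal factors are inverse to each other because \<epsilon> squares to 1, and a
  shear preserves the determinant.\<close>

lemma gauge_det:
  "gauge_b Y 1 \<zeta> * gauge_a Y 2 \<zeta> - gauge_b Y 2 \<zeta> * gauge_a Y 1 \<zeta>
    = Y \<zeta> $ 1 $ 1 * Y \<zeta> $ 2 $ 2 - Y \<zeta> $ 1 $ 2 * Y \<zeta> $ 2 $ 1"
  using t4(1) e\<phi>(1) eps by (auto simp: gauge_b_def gauge_a_def field_simps)

lemma xv_exp: "xv \<zeta> = t4\<^sup>2 * exp \<zeta>"
  by (simp add: xv_def t4(3))

text \<open>The case distinction on the index selects the column carrying exp(- i \<kappa> x^2). The
  other column is determined on the central ray of the sector. For the selected one the first
  coordinate comes from the determinant, the second from the ray \<theta>, on which the opposite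
  exponential grows and must be absent.\<close>

lemma data_at_infinity:
  fixes k :: int and \<theta> :: real
  assumes can: "canonical_inf \<epsilon> a b u \<phi> \<tau> k Y"
    and th: "- pi / 2 + pi * of_int k / 2 < \<theta>" "\<theta> < pi / 2 + pi * of_int k / 2"
    and ray: "exp (\<i> * of_real \<theta>) ^ 2 = - \<i> * \<kappa>"
  shows "column_rep Y (if \<kappa> = 1 then 1 else 2) t4 (- 2 * N2 0 * t4 * (exp (\<i> * of_real \<theta>) * J))"
    and "column_rep Y (if \<kappa> = 1 then 2 else 1) 0 (\<kappa> / t4)"
proof -
  have sol: "mu_solution \<epsilon> a b u \<phi> \<tau> Y" using can by (simp add: canonical_inf_def)
  obtain R where YR: "\<And>\<zeta>. Y \<zeta> = (mat 1 + R \<zeta>) **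
        exp_sigma3 (- \<i> * (of_real \<tau> * (exp \<zeta>)\<^sup>2 + (a - \<i> / 2) * \<zeta>))"
    and RO: "\<And>\<theta>\<^sub>1 \<theta>\<^sub>2 i j. - pi / 2 + pi * of_int k / 2 < \<theta>\<^sub>1 \<Longrightarrow> \<theta>\<^sub>2 < pi / 2 + pi * of_int k / 2 \<Longrightarrow>
             (\<lambda>\<zeta>. R \<zeta> $ i $ j) \<in> O[sector_at_infinity \<theta>\<^sub>1 \<theta>\<^sub>2](\<lambda>\<zeta>. inverse (exp \<zeta>))"
    using can unfolding canonical_inf_def by blast
  \<comment> \<open>The central ray of the sector: x^2 is real there, as
    \<open>recessive_at_infinity\<close> requires.\<close>
  define \<theta>c where "\<theta>c = pi * of_int k / 2"
  have thc: "- pi / 2 + pi * of_int k / 2 < \<theta>c" "\<theta>c < pi / 2 + pi * of_int k / 2"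
    by (simp_all add: \<theta>c_def)
  have central: "exp (\<i> * of_real \<theta>c) ^ 2 = of_real (cos (pi * of_int k))"
  proof -
    have "exp (\<i> * of_real \<theta>c) ^ 2 = cis (pi * of_int k)"
      by (simp add: cis_conv_exp \<theta>c_def flip: exp_double)
    also have "\<dots> = of_real (cos (pi * of_int k))"
      using sin_zero_iff_int2[of "pi * of_int k"] by (auto simp: complex_eq_iff mult.commute)
    finally show ?thesis .
  qed
  have Rc: "((\<lambda>r. R (of_real r + \<i> * of_real \<theta>c) $ i $ j) \<longlongrightarrow> 0) at_top" for i j
    by (rule null_on_ray_infinity[OF RO[OF thc]])
  have Rd: "((\<lambda>r. R (of_real r + \<i> * of_real \<theta>) $ i $ j) \<longlongrightarrow> 0) at_top" for i j
    by (rule null_on_ray_infinity[OF RO[OF th]])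
  have Rsmall: "\<forall>\<^sub>F r in at_top. norm (R (of_real r + \<i> * of_real \<theta>) $ i $ j) < 1" for i j
    using tendstoD[OF Rd[of i j], of 1] by simp
  define S where "S = (\<lambda>\<zeta> i j. (mat 1 + R \<zeta>) $ i $ j)"
  have Sv: "S \<zeta> 1 1 = 1 + R \<zeta> $ 1 $ 1" "S \<zeta> 1 2 = R \<zeta> $ 1 $ 2" "S \<zeta> 2 1 = R \<zeta> $ 2 $ 1" "S \<zeta> 2 2 = 1 + R \<zeta> $ 2 $ 2" for \<zeta>
    by (simp_all add: S_def)
  define ph where "ph = (\<lambda>\<zeta>. - \<i> * (of_real \<tau> * (exp \<zeta>)\<^sup>2 + (a - \<i> / 2) * \<zeta>))"
  have Ye: "Y \<zeta> $ i $ 1 = S \<zeta> i 1 * exp (ph \<zeta>)" "Y \<zeta> $ i $ 2 = S \<zeta> i 2 * exp (- ph \<zeta>)" for \<zeta> i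
    unfolding YR S_def ph_def times_exp_sigma3_nth by simp_all
  have x2: "(xv \<zeta>)\<^sup>2 = of_real \<tau> * (exp \<zeta>)\<^sup>2" for \<zeta>
    by (simp add: xv_exp power_mult_distrib t4(2))
  obtain v1 w1 where r1: "column_rep Y 1 v1 w1"
    using represents_exists[OF gauge_rotated_system[OF sol]] unfolding column_rep_def by blast
  obtain v2 w2 where r2: "column_rep Y 2 v2 w2"
    using represents_exists[OF gauge_rotated_system[OF sol]] unfolding column_rep_def by blast
  \<comment> \<open>The determinant is independent of \<zeta>, so its limit on one ray determines
    it.\<close>
  have det: "v1 * w2 - v2 * w1 = 1"
  proof -
    have eq: "S \<zeta> 1 1 * S \<zeta> 2 2 - S \<zeta> 1 2 * S \<zeta> 2 1 = v1 * w2 - v2 * w1" for \<zeta>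
    proof -
      have "exp (ph \<zeta>) * exp (- ph \<zeta>) = 1" by (simp add: mult_exp_exp)
      then have "S \<zeta> 1 1 * S \<zeta> 2 2 - S \<zeta> 1 2 * S \<zeta> 2 1 =
          (exp (ph \<zeta>) * exp (- ph \<zeta>)) * (S \<zeta> 1 1 * S \<zeta> 2 2 - S \<zeta> 1 2 * S \<zeta> 2 1)" by simp
      also have "\<dots> = Y \<zeta> $ 1 $ 1 * Y \<zeta> $ 2 $ 2 - Y \<zeta> $ 1 $ 2 * Y \<zeta> $ 2 $ 1"
        unfolding Ye by (simp only: algebra_simps)
      also have "\<dots> = v1 * w2 - v2 * w1"
        unfolding gauge_det[symmetric] using represents_det r1 r2 unfolding column_rep_def by blast
      finally show ?thesis .
    qed
    have "((\<lambda>r. S (of_real r + \<i> * of_real \<theta>c) 1 1 * S (of_real r + \<i> * of_real \<theta>c) 2 2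
        - S (of_real r + \<i> * of_real \<theta>c) 1 2 * S (of_real r + \<i> * of_real \<theta>c) 2 1)
        \<longlongrightarrow> (1 + 0) * (1 + 0) - 0 * 0) at_top"
      unfolding Sv by (intro tendsto_intros Rc)
    then show ?thesis unfolding eq by (simp add: tendsto_const_iff)
  qed
  have e1: "exp (- \<i> * (xv \<zeta>)\<^sup>2) * exp (\<i> * (xv \<zeta>)\<^sup>2) = 1" "exp (\<i> * (xv \<zeta>)\<^sup>2) * exp (- \<i> * (xv \<zeta>)\<^sup>2) = 1" for \<zeta>
    by (simp_all add: mult_exp_exp)
  have "column_rep Y (if \<kappa> = 1 then 1 else 2) t4 (- 2 * N2 0 * t4 * (exp (\<i> * of_real \<theta>) * J)) \<and>
    column_rep Y (if \<kappa> = 1 then 2 else 1) 0 (\<kappa> / t4)"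
  proof (cases "\<kappa> = 1")
    case True
    have kc: "complex_of_real \<kappa> = 1" by (simp add: True)
    have ph: "ph \<zeta> = - \<i> * (xv \<zeta>)\<^sup>2" for \<zeta>
      unfolding ph_def x2 a_eq kc by simp
    have E: "exp (- \<i> * \<kappa> * (xv \<zeta>)\<^sup>2) = exp (- \<i> * (xv \<zeta>)\<^sup>2)" "exp (\<i> * \<kappa> * (xv \<zeta>)\<^sup>2) = exp (\<i> * (xv \<zeta>)\<^sup>2)" for \<zeta>
      unfolding kc by simp_all
    have mph: "- ph \<zeta> = \<i> * (xv \<zeta>)\<^sup>2" for \<zeta> unfolding ph by simp
    have g: "exp (- \<i> * \<kappa> * (xv \<zeta>)\<^sup>2) * gauge_b Y 2 \<zeta> = t4 * R \<zeta> $ 1 $ 2"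
      "exp (- \<i> * \<kappa> * (xv \<zeta>)\<^sup>2) * gauge_a Y 2 \<zeta> = (1 + R \<zeta> $ 2 $ 2) / t4"
      "exp (\<i> * \<kappa> * (xv \<zeta>)\<^sup>2) * gauge_b Y 1 \<zeta> = t4 * (1 + R \<zeta> $ 1 $ 1)"
      "exp (\<i> * \<kappa> * (xv \<zeta>)\<^sup>2) * gauge_a Y 1 \<zeta> = R \<zeta> $ 2 $ 1 / t4" for \<zeta>
    proof -
      have c: "p * (t4 * (s * q)) = t4 * s" "p * (s * q / t4) = s / t4" if "p * q = 1" for p q s
      proof -
        have "p * (t4 * (s * q)) = t4 * s * (p * q)" "p * (s * q / t4) = s / t4 * (p * q)" by simp_all
        then show "p * (t4 * (s * q)) = t4 * s" "p * (s * q / t4) = s / t4" unfolding that by simp_all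
      qed
      show "exp (- \<i> * \<kappa> * (xv \<zeta>)\<^sup>2) * gauge_b Y 2 \<zeta> = t4 * R \<zeta> $ 1 $ 2"
        "exp (- \<i> * \<kappa> * (xv \<zeta>)\<^sup>2) * gauge_a Y 2 \<zeta> = (1 + R \<zeta> $ 2 $ 2) / t4"
        "exp (\<i> * \<kappa> * (xv \<zeta>)\<^sup>2) * gauge_b Y 1 \<zeta> = t4 * (1 + R \<zeta> $ 1 $ 1)"
        "exp (\<i> * \<kappa> * (xv \<zeta>)\<^sup>2) * gauge_a Y 1 \<zeta> = R \<zeta> $ 2 $ 1 / t4"
        unfolding gauge_b_def gauge_a_def if_P[OF True] Ye mph E unfolding ph Sv
        by (rule c[OF e1(1)] c[OF e1(2)])+
    qed
    have rec: "v2 = 0" "w2 = 1 / t4"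
    proof -
      have "((\<lambda>r. exp (- \<i> * \<kappa> * (xv (of_real r + \<i> * of_real \<theta>c))\<^sup>2) * gauge_b Y 2 (of_real r + \<i> * of_real \<theta>c)) \<longlongrightarrow> t4 * 0) at_top"
        "((\<lambda>r. exp (- \<i> * \<kappa> * (xv (of_real r + \<i> * of_real \<theta>c))\<^sup>2) * gauge_a Y 2 (of_real r + \<i> * of_real \<theta>c)) \<longlongrightarrow> (1 + 0) / t4) at_top"
        unfolding g by (intro tendsto_intros Rc t4)+
      then show "v2 = 0" "w2 = 1 / t4"
        using recessive_at_infinity[OF r2[unfolded column_rep_def] central, of "1 / t4"] by simp_all
    qed
    have v1: "v1 = t4" using det rec t4(1) by (simp add: field_simps)
    have "w1 = - 2 * n2' * v1 * (exp (\<i> * of_real \<theta>) * J)" if "n2' = N2 0" for n2'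
      unfolding that
    proof (rule dominant_at_infinity[OF r1[unfolded column_rep_def] ray])
      show "\<forall>\<^sub>F r in at_top. norm (exp (\<i> * \<kappa> * (xv (of_real r + \<i> * of_real \<theta>))\<^sup>2) * gauge_b Y 1 (of_real r + \<i> * of_real \<theta>))
          \<le> 2 * norm t4 + 1 / norm t4"
        unfolding g using Rsmall[of 1 1]
      proof eventually_elim
        case (elim r)
        have "norm (1 + R (of_real r + \<i> * of_real \<theta>) $ 1 $ 1) \<le> 2"
          using elim norm_triangle_ineq[of 1 "R (of_real r + \<i> * of_real \<theta>) $ 1 $ 1"] by simp
        then have "norm t4 * norm (1 + R (of_real r + \<i> * of_real \<theta>) $ 1 $ 1) \<le> norm t4 * 2"
          by (rule mult_left_mono) simp
        moreover have "0 \<le> 1 / norm t4" by simp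
        ultimately show ?case unfolding norm_mult by linarith
      qed
      show "\<forall>\<^sub>F r in at_top. norm (exp (\<i> * \<kappa> * (xv (of_real r + \<i> * of_real \<theta>))\<^sup>2) * gauge_a Y 1 (of_real r + \<i> * of_real \<theta>))
          \<le> (2 * norm t4 + 1 / norm t4) * exp r"
        unfolding g using Rsmall[of 2 1] eventually_ge_at_top[of 0]
      proof eventually_elim
        case (elim r)
        have "norm (R (of_real r + \<i> * of_real \<theta>) $ 2 $ 1 / t4) \<le> 1 / norm t4"
          using elim(1) by (simp add: norm_divide divide_right_mono)
        also have "\<dots> \<le> (2 * norm t4 + 1 / norm t4) * 1" by simp
        also have "\<dots> \<le> (2 * norm t4 + 1 / norm t4) * exp r"
          using elim(2) by (intro mult_left_mono) auto
        finally show ?case .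
      qed
    qed
    then have w1: "w1 = - 2 * N2 0 * t4 * (exp (\<i> * of_real \<theta>) * J)" unfolding v1 by blast
    show ?thesis
      unfolding if_P[OF True] kc using r1 r2 unfolding v1 w1 rec by blast
  next
    case False
    then have km: "\<kappa> = - 1" using kappa by auto
    have kc: "complex_of_real \<kappa> = - 1" by (simp add: km)
    \<comment> \<open>Now a - i/2 = - i, which gives the columns the additional factors \<mu>^(-1)
      and \<mu>.\<close>
    have ph: "ph \<zeta> = - \<i> * (xv \<zeta>)\<^sup>2 + - \<zeta>" for \<zeta>
      unfolding ph_def x2 a_eq kc by (simp add: algebra_simps)
    have mph: "- ph \<zeta> = \<i> * (xv \<zeta>)\<^sup>2 + \<zeta>" for \<zeta> unfolding ph by simp
    have E: "exp (- \<i> * \<kappa> * (xv \<zeta>)\<^sup>2) = exp (\<i> * (xv \<zeta>)\<^sup>2)" "exp (\<i> * \<kappa> * (xv \<zeta>)\<^sup>2) = exp (- \<i> * (xv \<zeta>)\<^sup>2)" for \<zeta>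
      unfolding kc by simp_all
    have ez: "xv \<zeta> / t4 ^ 3 * (s * exp (- \<zeta>)) = s / t4" for \<zeta> s
      unfolding xv_exp using t4(1) by (simp add: exp_minus field_simps power2_eq_square power3_eq_cube)
    have ez': "xv \<zeta> / t4 ^ 3 * (s * exp \<zeta>) = s * exp \<zeta> * exp \<zeta> / t4" for \<zeta> s
      unfolding xv_exp using t4(1) by (simp add: field_simps power2_eq_square power3_eq_cube)
    have g: "exp (- \<i> * \<kappa> * (xv \<zeta>)\<^sup>2) * gauge_b Y 1 \<zeta> = \<epsilon> / e\<phi> * t4 * ((1 + R \<zeta> $ 1 $ 1) * exp (- \<zeta>))"
      "exp (- \<i> * \<kappa> * (xv \<zeta>)\<^sup>2) * gauge_a Y 1 \<zeta> = \<epsilon> * e\<phi> / t4 * (R \<zeta> $ 2 $ 1 * exp (- \<zeta>)) - (1 + R \<zeta> $ 1 $ 1) / t4"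
      "exp (\<i> * \<kappa> * (xv \<zeta>)\<^sup>2) * gauge_b Y 2 \<zeta> = \<epsilon> / e\<phi> * t4 * (R \<zeta> $ 1 $ 2 * exp \<zeta>)"
      "exp (\<i> * \<kappa> * (xv \<zeta>)\<^sup>2) * gauge_a Y 2 \<zeta> = \<epsilon> * e\<phi> / t4 * ((1 + R \<zeta> $ 2 $ 2) * exp \<zeta>) - R \<zeta> $ 1 $ 2 * exp \<zeta> * exp \<zeta> / t4" for \<zeta>
    proof -
      have c: "p * (A * (s * (q * d))) = A * (s * d)"
        "p * (A * (s * (q * d)) - B * (s' * (q * d))) = A * (s * d) - B * (s' * d)" if "p * q = 1" for p q s s' A B d :: complex
      proof -
        have "p * (A * (s * (q * d))) = p * q * (A * (s * d))"
          "p * (A * (s * (q * d)) - B * (s' * (q * d))) = p * q * (A * (s * d) - B * (s' * d))"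
          by (simp_all add: algebra_simps)
        then show "p * (A * (s * (q * d))) = A * (s * d)"
          "p * (A * (s * (q * d)) - B * (s' * (q * d))) = A * (s * d) - B * (s' * d)" unfolding that by simp_all
      qed
      show "exp (- \<i> * \<kappa> * (xv \<zeta>)\<^sup>2) * gauge_b Y 1 \<zeta> = \<epsilon> / e\<phi> * t4 * ((1 + R \<zeta> $ 1 $ 1) * exp (- \<zeta>))"
        unfolding gauge_b_def if_not_P[OF False] Ye E ph exp_add Sv by (rule c(1)[OF e1(2)])
      show "exp (- \<i> * \<kappa> * (xv \<zeta>)\<^sup>2) * gauge_a Y 1 \<zeta> = \<epsilon> * e\<phi> / t4 * (R \<zeta> $ 2 $ 1 * exp (- \<zeta>)) - (1 + R \<zeta> $ 1 $ 1) / t4"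
        unfolding gauge_a_def if_not_P[OF False] Ye E ph exp_add Sv c(2)[OF e1(2)] ez ..
      show "exp (\<i> * \<kappa> * (xv \<zeta>)\<^sup>2) * gauge_b Y 2 \<zeta> = \<epsilon> / e\<phi> * t4 * (R \<zeta> $ 1 $ 2 * exp \<zeta>)"
        unfolding gauge_b_def if_not_P[OF False] Ye E mph exp_add Sv by (rule c(1)[OF e1(1)])
      show "exp (\<i> * \<kappa> * (xv \<zeta>)\<^sup>2) * gauge_a Y 2 \<zeta> = \<epsilon> * e\<phi> / t4 * ((1 + R \<zeta> $ 2 $ 2) * exp \<zeta>) - R \<zeta> $ 1 $ 2 * exp \<zeta> * exp \<zeta> / t4"
        unfolding gauge_a_def if_not_P[OF False] Ye E mph exp_add Sv c(2)[OF e1(1)] ez' ..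
    qed
    have em: "((\<lambda>r. exp (- (complex_of_real r + \<i> * of_real \<theta>c))) \<longlongrightarrow> 0) at_top"
    proof (rule tendsto_norm_zero_cancel)
      show "((\<lambda>r. norm (exp (- (complex_of_real r + \<i> * of_real \<theta>c)))) \<longlongrightarrow> 0) at_top"
        unfolding norm_exp_eq_Re by (simp add: filterlim_compose[OF exp_at_bot filterlim_uminus_at_bot_at_top])
    qed
    have rec: "v1 = 0" "w1 = - 1 / t4"
    proof -
      have "((\<lambda>r. exp (- \<i> * \<kappa> * (xv (of_real r + \<i> * of_real \<theta>c))\<^sup>2) * gauge_b Y 1 (of_real r + \<i> * of_real \<theta>c)) \<longlongrightarrow>
           \<epsilon> / e\<phi> * t4 * ((1 + 0) * 0)) at_top"
        "((\<lambda>r. exp (- \<i> * \<kappa> * (xv (of_real r + \<i> * of_real \<theta>c))\<^sup>2) * gauge_a Y 1 (of_real r + \<i> * of_real \<theta>c)) \<longlongrightarrow>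
           \<epsilon> * e\<phi> / t4 * (0 * 0) - (1 + 0) / t4) at_top"
        unfolding g by (intro tendsto_intros Rc em t4)+
      then show "v1 = 0" "w1 = - 1 / t4"
        using recessive_at_infinity[OF r1[unfolded column_rep_def] central, of "- 1 / t4"] by simp_all
    qed
    have v2: "v2 = t4" using det rec t4(1) by (simp add: field_simps)
    obtain C where C: "\<forall>\<^sub>F r in at_top. norm (R (of_real r + \<i> * of_real \<theta>) $ 1 $ 2) \<le> C * exp (- r)"
      using bound_on_ray_infinity[OF RO[OF th]] by blast
    \<comment> \<open>The error entry in row 1, column 2 is multiplied by \<mu> in
      \<open>gauge_b\<close> and by \<mu>^2 in \<open>gauge_a\<close>; its decay like 1/\<mu> leaves
      a bounded term and one of growth exp r. \<open>K\<close> dominates both.\<close>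
    define K where "K = norm (\<epsilon> / e\<phi> * t4) * \<bar>C\<bar> + (norm (\<epsilon> * e\<phi> / t4) * 2 + \<bar>C\<bar> / norm t4)"
    have ne: "norm (exp (complex_of_real r + \<i> * of_real \<theta>)) = exp r" for r
      by simp
    have CR: "norm (R (of_real r + \<i> * of_real \<theta>) $ 1 $ 2) * exp r \<le> \<bar>C\<bar>"
      if "norm (R (of_real r + \<i> * of_real \<theta>) $ 1 $ 2) \<le> C * exp (- r)" for r
    proof -
      have "norm (R (of_real r + \<i> * of_real \<theta>) $ 1 $ 2) * exp r \<le> C * exp (- r) * exp r"
        using that by (rule mult_right_mono) simp
      then show ?thesis by (simp add: mult.assoc mult_exp_exp)
    qed
    have "w2 = - 2 * n2' * v2 * (exp (\<i> * of_real \<theta>) * J)" if "n2' = N2 0" for n2'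
      unfolding that
    proof (rule dominant_at_infinity[OF r2[unfolded column_rep_def] ray])
      show "\<forall>\<^sub>F r in at_top. norm (exp (\<i> * \<kappa> * (xv (of_real r + \<i> * of_real \<theta>))\<^sup>2) * gauge_b Y 2 (of_real r + \<i> * of_real \<theta>)) \<le> K"
        unfolding g using C
      proof eventually_elim
        case (elim r)
        have "norm (\<epsilon> / e\<phi> * t4) * (norm (R (of_real r + \<i> * of_real \<theta>) $ 1 $ 2) * exp r) \<le> norm (\<epsilon> / e\<phi> * t4) * \<bar>C\<bar>"
          by (rule mult_left_mono[OF CR[OF elim]]) simp
        moreover have "0 \<le> norm (\<epsilon> * e\<phi> / t4) * 2 + \<bar>C\<bar> / norm t4" by simp
        ultimately show ?case
          unfolding norm_mult[of _ "_ * exp _"] norm_mult[of _ "exp _"] ne K_def by linarith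
      qed
      show "\<forall>\<^sub>F r in at_top. norm (exp (\<i> * \<kappa> * (xv (of_real r + \<i> * of_real \<theta>))\<^sup>2) * gauge_a Y 2 (of_real r + \<i> * of_real \<theta>)) \<le> K * exp r"
        unfolding g using C Rsmall[of 2 2]
      proof eventually_elim
        case (elim r)
        let ?z = "of_real r + \<i> * of_real \<theta>"
        have "norm (1 + R ?z $ 2 $ 2) \<le> 2"
          using elim(2) norm_triangle_ineq[of 1 "R ?z $ 2 $ 2"] by simp
        then have "norm (\<epsilon> * e\<phi> / t4) * norm (1 + R ?z $ 2 $ 2) * exp r \<le> norm (\<epsilon> * e\<phi> / t4) * 2 * exp r"
          by (intro mult_right_mono mult_left_mono) auto
        then have 1: "norm (\<epsilon> * e\<phi> / t4 * ((1 + R ?z $ 2 $ 2) * exp ?z)) \<le> norm (\<epsilon> * e\<phi> / t4) * 2 * exp r"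
          unfolding norm_mult[of "\<epsilon> * e\<phi> / t4"] norm_mult[of _ "exp _"] ne by (simp add: mult.assoc)
        have "norm (R ?z $ 1 $ 2) * exp r * exp r / norm t4 \<le> \<bar>C\<bar> * exp r / norm t4"
          using CR[OF elim(1)] by (intro divide_right_mono mult_right_mono) auto
        then have 2: "norm (R ?z $ 1 $ 2 * exp ?z * exp ?z / t4) \<le> \<bar>C\<bar> / norm t4 * exp r"
          unfolding norm_divide norm_mult ne by simp
        have "norm (\<epsilon> * e\<phi> / t4 * ((1 + R ?z $ 2 $ 2) * exp ?z) - R ?z $ 1 $ 2 * exp ?z * exp ?z / t4)
            \<le> (norm (\<epsilon> * e\<phi> / t4) * 2 + \<bar>C\<bar> / norm t4) * exp r"
          using norm_triangle_ineq4[of "\<epsilon> * e\<phi> / t4 * ((1 + R ?z $ 2 $ 2) * exp ?z)" "R ?z $ 1 $ 2 * exp ?z * exp ?z / t4"] 1 2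
          unfolding distrib_right by linarith
        also have "\<dots> \<le> K * exp r" unfolding K_def by (intro mult_right_mono) auto
        finally show ?case .
      qed
    qed
    then have w2: "w2 = - 2 * N2 0 * t4 * (exp (\<i> * of_real \<theta>) * J)" unfolding v2 by blast
    show ?thesis
      unfolding if_not_P[OF False] kc using r1 r2 unfolding v2 w2 rec by blast
  qed
  then show "column_rep Y (if \<kappa> = 1 then 1 else 2) t4 (- 2 * N2 0 * t4 * (exp (\<i> * of_real \<theta>) * J))"
    "column_rep Y (if \<kappa> = 1 then 2 else 1) 0 (\<kappa> / t4)"
    by blast+
qed

lemma xv_tendsto_0: "((\<lambda>r. xv (of_real r + \<i> * of_real \<theta>)) \<longlongrightarrow> 0) at_bot"
proof (rule tendsto_norm_zero_cancel)
  have "norm (xv (of_real r + \<i> * of_real \<theta>)) = sqrt \<tau> * exp r" for r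
    using tau by (simp add: xv_def norm_mult)
  moreover have "((\<lambda>r. sqrt \<tau> * exp r) \<longlongrightarrow> sqrt \<tau> * 0) at_bot"
    by (intro tendsto_intros exp_at_bot)
  ultimately show "((\<lambda>r. norm (xv (of_real r + \<i> * of_real \<theta>))) \<longlongrightarrow> 0) at_bot" by simp
qed

lemma ratio_tau: "ratio \<tau> = - lam * (of_real \<tau> / u \<tau>) * exp (\<i> * \<kappa> * \<phi> \<tau>)"
proof -
  have l: "of_real \<epsilon> * of_real b = complex_of_real lam * of_real lam"
    using eb by (simp add: lam_def flip: of_real_mult)
  have "ratio \<tau> = (of_real \<epsilon> * of_real b) * (- \<i> * (of_real \<tau> / u \<tau> * exp (\<i> * \<kappa> * \<phi> \<tau>))) / (\<i> * lam)"
    by (simp add: ratio_def NQ_tau(3) mult.assoc)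
  then show ?thesis unfolding l using lam by (simp add: field_simps)
qed

text \<open>The columns oscillate with opposite phases on the real ray, so
  \<open>connection_at_zero\<close> applies with \<sigma> = 1 and \<sigma> = -1. The value -1/2 is
  the square of the factor i / sqrt 2 in \<open>Psi0\<close>.\<close>

lemma data_at_zero:
  fixes k :: int and q :: complex
  assumes can: "canonical_zero \<epsilon> a b u \<phi> \<tau> q k X" and q: "q\<^sup>2 = B_fun u \<phi> \<tau>" and k: "k \<in> {0, 1}"
  shows "\<exists>v. v\<^sup>2 * inv_ratio 0 = - 1 / 2 \<and> column_rep X 1 v (inv_ratio 0 * v) \<and> column_rep X 2 v (- inv_ratio 0 * v)"
proof -
  have sol: "mu_solution \<epsilon> a b u \<phi> \<tau> X" using can by (simp add: canonical_zero_def)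
  obtain R where XR: "\<And>\<zeta>. X \<zeta> = Psi0 \<epsilon> b \<tau> q ** (mat 1 + R \<zeta>) **
        exp_sigma3 (- \<i> * of_real (sqrt (\<tau> * \<epsilon> * b)) / exp \<zeta>)"
    and RO: "\<And>\<theta>\<^sub>1 \<theta>\<^sub>2 i j. - pi + pi * of_int k < \<theta>\<^sub>1 \<Longrightarrow> \<theta>\<^sub>2 < pi + pi * of_int k \<Longrightarrow>
             (\<lambda>\<zeta>. R \<zeta> $ i $ j) \<in> O[sector_at_zero \<theta>\<^sub>1 \<theta>\<^sub>2](exp)"
    using can unfolding canonical_zero_def by blast
  define \<theta> where "\<theta> = pi * of_int k"
  have th: "- pi + pi * of_int k < \<theta>" "\<theta> < pi + pi * of_int k"
    by (simp_all add: \<theta>_def)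
  \<comment> \<open>The central rays of the two sectors at zero are the positive and the negative
    real axis.\<close>
  define sg :: real where "sg = (if k = 0 then 1 else - 1)"
  have ray: "exp (\<i> * \<theta>) = of_real sg" "sg \<in> {1, -1}"
    using k by (auto simp: \<theta>_def sg_def exp_eq_polar cis_conv_exp[symmetric])
  let ?z = "\<lambda>r. complex_of_real r + \<i> * of_real \<theta>"
  have R0: "((\<lambda>r. R (?z r) $ i $ j) \<longlongrightarrow> 0) at_bot" for i j
    by (rule null_on_ray_zero[OF RO[OF th]])
  define ph where "ph = (\<lambda>\<zeta>. - (\<i> * lam * \<tau> * yv \<zeta>))"
  have ph: "- \<i> * of_real (sqrt (\<tau> * \<epsilon> * b)) / exp \<zeta> = ph \<zeta>" for \<zeta>
  proof -
    have "sqrt (\<tau> * \<epsilon> * b) = sqrt \<tau> * lam" by (simp add: lam_def real_sqrt_mult mult.assoc)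
    moreover have "complex_of_real \<tau> = of_real (sqrt \<tau>) * of_real (sqrt \<tau>)"
      using tau by (simp flip: of_real_mult)
    ultimately show ?thesis using tau by (simp add: ph_def yv_def xv_def field_simps)
  qed
  define r where "r = complex_of_real (root 4 (\<epsilon> * b)) / (of_real (root 4 \<tau>) * q)"
  define \<rho> where "\<rho> = t4 * r"
  define i2 where "i2 = \<i> / complex_of_real (sqrt 2)"
  have i2: "i2\<^sup>2 = - 1 / 2" by (simp add: i2_def power_divide flip: of_real_power)
  have q0: "q \<noteq> 0" using q u\<tau> tau by (auto simp: B_fun_def)
  have r0: "r \<noteq> 0" using q0 eb tau by (auto simp: r_def)
  have \<rho>0: "\<rho> \<noteq> 0" using r0 t4(1) by (simp add: \<rho>_def)
  have \<rho>2: "\<rho>\<^sup>2 = - lam * (of_real \<tau> / u \<tau>) * e\<phi>"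
  proof -
    have "root 4 (\<epsilon> * b) ^ 2 = sqrt (\<epsilon> * b)"
      using eb real_root_mult_exp[of 2 2 "\<epsilon> * b"] by (simp add: sqrt_def)
    then have "(complex_of_real (root 4 (\<epsilon> * b)))\<^sup>2 = lam" by (simp add: lam_def flip: of_real_power)
    moreover have "\<rho> = of_real (root 4 (\<epsilon> * b)) / q"
      using tau by (simp add: \<rho>_def r_def t4_def)
    ultimately have "\<rho>\<^sup>2 = lam / B_fun u \<phi> \<tau>" by (simp add: power_divide q)
    then show ?thesis unfolding B_fun_def e\<phi> by (simp add: field_simps)
  qed
  have Psi: "Psi0 \<epsilon> b \<tau> q $ 1 $ 1 = i2 * r" "Psi0 \<epsilon> b \<tau> q $ 1 $ 2 = i2 * r"
    "Psi0 \<epsilon> b \<tau> q $ 2 $ 1 = i2 / r" "Psi0 \<epsilon> b \<tau> q $ 2 $ 2 = - i2 / r"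
    unfolding Psi0_def r_def[symmetric] i2_def[symmetric] cscale_nth matrix_mult_nth pow_sigma3_def
    by (simp_all add: sigma1_def sigma3_def divide_inverse)
  have Xe: "X \<zeta> $ 1 $ 1 = i2 * r * (1 + R \<zeta> $ 1 $ 1 + R \<zeta> $ 2 $ 1) * exp (ph \<zeta>)"
    "X \<zeta> $ 2 $ 1 = i2 / r * (1 + R \<zeta> $ 1 $ 1 - R \<zeta> $ 2 $ 1) * exp (ph \<zeta>)"
    "X \<zeta> $ 1 $ 2 = i2 * r * (R \<zeta> $ 1 $ 2 + (1 + R \<zeta> $ 2 $ 2)) * exp (- ph \<zeta>)"
    "X \<zeta> $ 2 $ 2 = i2 / r * (R \<zeta> $ 1 $ 2 - (1 + R \<zeta> $ 2 $ 2)) * exp (- ph \<zeta>)" for \<zeta>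
    unfolding XR ph times_exp_sigma3_nth unfolding matrix_mult_nth Psi by (simp_all add: algebra_simps)
  obtain v1 w1 where r1: "column_rep X 1 v1 w1"
    using represents_exists[OF gauge_rotated_system[OF sol]] unfolding column_rep_def by blast
  obtain v2 w2 where r2: "column_rep X 2 v2 w2"
    using represents_exists[OF gauge_rotated_system[OF sol]] unfolding column_rep_def by blast
  have pp: "exp (ph \<zeta>) * exp (- ph \<zeta>) = 1" for \<zeta> by (simp add: mult_exp_exp)
  have det: "v1 * w2 - v2 * w1 = 1"
  proof -
    have eq: "i2\<^sup>2 * ((1 + R \<zeta> $ 1 $ 1 + R \<zeta> $ 2 $ 1) * (R \<zeta> $ 1 $ 2 - (1 + R \<zeta> $ 2 $ 2))
        - (R \<zeta> $ 1 $ 2 + (1 + R \<zeta> $ 2 $ 2)) * (1 + R \<zeta> $ 1 $ 1 - R \<zeta> $ 2 $ 1)) = v1 * w2 - v2 * w1" for \<zeta>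
    proof -
      have "X \<zeta> $ 1 $ 1 * X \<zeta> $ 2 $ 2 - X \<zeta> $ 1 $ 2 * X \<zeta> $ 2 $ 1 =
        (exp (ph \<zeta>) * exp (- ph \<zeta>)) * (r * (1 / r)) * (i2\<^sup>2 * ((1 + R \<zeta> $ 1 $ 1 + R \<zeta> $ 2 $ 1) * (R \<zeta> $ 1 $ 2 - (1 + R \<zeta> $ 2 $ 2))
        - (R \<zeta> $ 1 $ 2 + (1 + R \<zeta> $ 2 $ 2)) * (1 + R \<zeta> $ 1 $ 1 - R \<zeta> $ 2 $ 1)))"
        unfolding Xe power2_eq_square divide_inverse by (simp only: algebra_simps mult_1_left)
      also have "\<dots> = i2\<^sup>2 * ((1 + R \<zeta> $ 1 $ 1 + R \<zeta> $ 2 $ 1) * (R \<zeta> $ 1 $ 2 - (1 + R \<zeta> $ 2 $ 2))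
        - (R \<zeta> $ 1 $ 2 + (1 + R \<zeta> $ 2 $ 2)) * (1 + R \<zeta> $ 1 $ 1 - R \<zeta> $ 2 $ 1))"
        unfolding pp using r0 by simp
      also have "X \<zeta> $ 1 $ 1 * X \<zeta> $ 2 $ 2 - X \<zeta> $ 1 $ 2 * X \<zeta> $ 2 $ 1 = v1 * w2 - v2 * w1"
        unfolding gauge_det[symmetric] using represents_det r1 r2 unfolding column_rep_def by blast
      finally show ?thesis by simp
    qed
    have "((\<lambda>t. i2\<^sup>2 * ((1 + R (?z t) $ 1 $ 1 + R (?z t) $ 2 $ 1) * (R (?z t) $ 1 $ 2 - (1 + R (?z t) $ 2 $ 2))
        - (R (?z t) $ 1 $ 2 + (1 + R (?z t) $ 2 $ 2)) * (1 + R (?z t) $ 1 $ 1 - R (?z t) $ 2 $ 1)))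
        \<longlongrightarrow> i2\<^sup>2 * ((1 + 0 + 0) * (0 - (1 + 0)) - (0 + (1 + 0)) * (1 + 0 - 0))) at_bot"
      by (intro tendsto_intros R0)
    then show ?thesis unfolding eq unfolding i2 by (simp add: tendsto_const_iff)
  qed
  \<comment> \<open>With this factor the gauge becomes diag(f t4, 1/(f t4)) up to the shear. The
    identity \<open>ssf\<close> says that the gauged leading matrix \<open>Psi0\<close> has
    eigenvectors of Q(\<tau>) as columns.\<close>
  define f where "f = (if \<kappa> = 1 then 1 else \<epsilon> / e\<phi>)"
  have f0: "f \<noteq> 0" using e\<phi>(1) eps by (auto simp: f_def)
  have ssf: "ratio \<tau> = (f * \<rho>)\<^sup>2"
  proof (cases "\<kappa> = 1")
    case True
    then show ?thesis unfolding ratio_tau power_mult_distrib \<rho>2 by (simp add: f_def e\<phi>_def)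
  next
    case False
    then have km: "complex_of_real \<kappa> = - 1" using kappa by auto
    have e: "exp (\<i> * \<kappa> * \<phi> \<tau>) = 1 / e\<phi>" unfolding km by (simp add: e\<phi>_def exp_minus inverse_eq_divide)
    show ?thesis unfolding ratio_tau power_mult_distrib \<rho>2 e f_def if_not_P[OF False]
      using eps e\<phi>(1) by (auto simp: power2_eq_square)
  qed
  have gb: "gauge_b X j \<zeta> = f * t4 * X \<zeta> $ 1 $ j" for j \<zeta>
    by (simp add: gauge_b_def f_def)
  have ga: "gauge_a X j \<zeta> = 1 / (f * t4) * X \<zeta> $ 2 $ j - (if \<kappa> = 1 then 0 else xv \<zeta> / t4 ^ 3) * X \<zeta> $ 1 $ j" for j \<zeta>
    using eps e\<phi>(1) by (auto simp: gauge_a_def f_def)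
  \<comment> \<open>The coefficient of the shear; it is proportional to x and vanishes in the limit
    at zero.\<close>
  define g where "g = (\<lambda>\<zeta>. if \<kappa> = 1 then 0 else xv \<zeta> / t4 ^ 3)"
  have g0: "((\<lambda>t. g (?z t)) \<longlongrightarrow> 0) at_bot"
  proof -
    have "((\<lambda>t. xv (?z t) / t4 ^ 3) \<longlongrightarrow> 0 / t4 ^ 3) at_bot"
      by (intro tendsto_intros xv_tendsto_0) (simp add: t4)
    then show ?thesis by (cases "\<kappa> = 1") (simp_all add: g_def if_P if_not_P)
  qed
  define \<delta> where "\<delta> = i2 * (f * \<rho>)"
  have \<delta>: "\<delta>\<^sup>2 * inv_ratio \<tau> = - 1 / 2"
  proof -
    have "\<delta>\<^sup>2 * inv_ratio \<tau> = i2\<^sup>2 * (ratio \<tau> * inv_ratio \<tau>)" unfolding \<delta>_def ssf by (simp add: power_mult_distrib)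
    then show ?thesis using ratio_inv_ratio(1)[of \<tau>] tau by (simp add: i2)
  qed
  have ssd: "ratio \<tau> * (1 / (f * t4) * (i2 / r)) = \<delta>"
    unfolding ssf \<delta>_def \<rho>_def using f0 t4(1) r0 by (simp add: power2_eq_square)
  have column: "v\<^sup>2 * inv_ratio 0 = - 1 / 2 \<and> w = \<sigma> * inv_ratio 0 * v"
    if rep: "column_rep X j v w" and sigma: "\<sigma> \<in> {1, -1 :: real}"
      and X1: "\<And>\<zeta>. exp (\<i> * \<sigma> * lam * \<tau> * yv \<zeta>) * X \<zeta> $ 1 $ j = i2 * r * A \<zeta>"
      and X2: "\<And>\<zeta>. exp (\<i> * \<sigma> * lam * \<tau> * yv \<zeta>) * X \<zeta> $ 2 $ j = i2 / r * B \<zeta>"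
      and A: "((\<lambda>t. A (?z t)) \<longlongrightarrow> 1) at_bot" and B: "((\<lambda>t. B (?z t)) \<longlongrightarrow> \<sigma>) at_bot"
    for j v w \<sigma> A B
  proof -
    have b: "exp (\<i> * \<sigma> * lam * \<tau> * yv \<zeta>) * gauge_b X j \<zeta> = \<delta> * A \<zeta>" for \<zeta>
    proof -
      have "exp (\<i> * \<sigma> * lam * \<tau> * yv \<zeta>) * gauge_b X j \<zeta> = f * t4 * (exp (\<i> * \<sigma> * lam * \<tau> * yv \<zeta>) * X \<zeta> $ 1 $ j)"
        unfolding gb by simp
      then show ?thesis unfolding X1 \<delta>_def \<rho>_def by simp
    qed
    have a: "exp (\<i> * \<sigma> * lam * \<tau> * yv \<zeta>) * (ratio \<tau> * gauge_a X j \<zeta>) = \<delta> * B \<zeta> - ratio \<tau> * g \<zeta> * (i2 * r * A \<zeta>)" for \<zeta>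
    proof -
      have "exp (\<i> * \<sigma> * lam * \<tau> * yv \<zeta>) * (ratio \<tau> * gauge_a X j \<zeta>) =
          ratio \<tau> * (1 / (f * t4)) * (exp (\<i> * \<sigma> * lam * \<tau> * yv \<zeta>) * X \<zeta> $ 2 $ j)
          - ratio \<tau> * g \<zeta> * (exp (\<i> * \<sigma> * lam * \<tau> * yv \<zeta>) * X \<zeta> $ 1 $ j)"
        unfolding ga g_def by (simp only: algebra_simps)
      also have "\<dots> = ratio \<tau> * (1 / (f * t4) * (i2 / r)) * B \<zeta> - ratio \<tau> * g \<zeta> * (i2 * r * A \<zeta>)"
        unfolding X1 X2 by (simp only: mult.assoc)
      finally show ?thesis unfolding ssd .
    qed
    have lb: "((\<lambda>t. exp (\<i> * \<sigma> * lam * \<tau> * yv (?z t)) * gauge_b X j (?z t)) \<longlongrightarrow> \<delta>) at_bot"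
      unfolding b using tendsto_mult_left[OF A, of \<delta>] by simp
    have "((\<lambda>t. \<delta> * B (?z t) - ratio \<tau> * g (?z t) * (i2 * r * A (?z t))) \<longlongrightarrow> \<delta> * \<sigma> - ratio \<tau> * 0 * (i2 * r * 1)) at_bot"
      by (intro tendsto_intros A B g0)
    then have la: "((\<lambda>t. exp (\<i> * \<sigma> * lam * \<tau> * yv (?z t)) * (ratio \<tau> * gauge_a X j (?z t))) \<longlongrightarrow> \<sigma> * \<delta>) at_bot"
      unfolding a by (simp add: mult.commute)
    from connection_at_zero[OF rep[unfolded column_rep_def] ray sigma lb la]
    show ?thesis unfolding \<delta> by simp
  qed
  have c1: "v1\<^sup>2 * inv_ratio 0 = - 1 / 2 \<and> w1 = of_real 1 * inv_ratio 0 * v1"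
  proof (rule column[OF r1, where A = "\<lambda>\<zeta>. 1 + R \<zeta> $ 1 $ 1 + R \<zeta> $ 2 $ 1" and B = "\<lambda>\<zeta>. 1 + R \<zeta> $ 1 $ 1 - R \<zeta> $ 2 $ 1"])
    have e: "exp (\<i> * of_real 1 * lam * \<tau> * yv \<zeta>) = exp (- ph \<zeta>)" for \<zeta> by (simp add: ph_def)
    have c: "exp (- ph \<zeta>) * (s * exp (ph \<zeta>)) = s" for s \<zeta>
      using pp[of \<zeta>] by (simp add: mult.commute mult.left_commute)
    show "exp (\<i> * of_real 1 * lam * \<tau> * yv \<zeta>) * X \<zeta> $ 1 $ 1 = i2 * r * (1 + R \<zeta> $ 1 $ 1 + R \<zeta> $ 2 $ 1)"
      "exp (\<i> * of_real 1 * lam * \<tau> * yv \<zeta>) * X \<zeta> $ 2 $ 1 = i2 / r * (1 + R \<zeta> $ 1 $ 1 - R \<zeta> $ 2 $ 1)" for \<zeta>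
      unfolding e Xe by (rule c)+
    have "((\<lambda>t. 1 + R (?z t) $ 1 $ 1 + R (?z t) $ 2 $ 1) \<longlongrightarrow> 1 + 0 + 0) at_bot"
      "((\<lambda>t. 1 + R (?z t) $ 1 $ 1 - R (?z t) $ 2 $ 1) \<longlongrightarrow> 1 + 0 - 0) at_bot"
      by (intro tendsto_intros R0)+
    then show "((\<lambda>t. 1 + R (?z t) $ 1 $ 1 + R (?z t) $ 2 $ 1) \<longlongrightarrow> 1) at_bot"
      "((\<lambda>t. 1 + R (?z t) $ 1 $ 1 - R (?z t) $ 2 $ 1) \<longlongrightarrow> complex_of_real 1) at_bot" by simp_all
  qed simp
  have c2: "v2\<^sup>2 * inv_ratio 0 = - 1 / 2 \<and> w2 = of_real (- 1) * inv_ratio 0 * v2"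
  proof (rule column[OF r2, where A = "\<lambda>\<zeta>. R \<zeta> $ 1 $ 2 + (1 + R \<zeta> $ 2 $ 2)" and B = "\<lambda>\<zeta>. R \<zeta> $ 1 $ 2 - (1 + R \<zeta> $ 2 $ 2)"])
    have e: "exp (\<i> * of_real (- 1) * lam * \<tau> * yv \<zeta>) = exp (ph \<zeta>)" for \<zeta> by (simp add: ph_def)
    have c: "exp (ph \<zeta>) * (s * exp (- ph \<zeta>)) = s" for s \<zeta>
      using pp[of \<zeta>] by (simp add: mult.commute mult.left_commute)
    show "exp (\<i> * of_real (- 1) * lam * \<tau> * yv \<zeta>) * X \<zeta> $ 1 $ 2 = i2 * r * (R \<zeta> $ 1 $ 2 + (1 + R \<zeta> $ 2 $ 2))"
      "exp (\<i> * of_real (- 1) * lam * \<tau> * yv \<zeta>) * X \<zeta> $ 2 $ 2 = i2 / r * (R \<zeta> $ 1 $ 2 - (1 + R \<zeta> $ 2 $ 2))" for \<zeta>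
      unfolding e Xe by (rule c)+
    have "((\<lambda>t. R (?z t) $ 1 $ 2 + (1 + R (?z t) $ 2 $ 2)) \<longlongrightarrow> 0 + (1 + 0)) at_bot"
      "((\<lambda>t. R (?z t) $ 1 $ 2 - (1 + R (?z t) $ 2 $ 2)) \<longlongrightarrow> 0 - (1 + 0)) at_bot"
      by (intro tendsto_intros R0)+
    then show "((\<lambda>t. R (?z t) $ 1 $ 2 + (1 + R (?z t) $ 2 $ 2)) \<longlongrightarrow> 1) at_bot"
      "((\<lambda>t. R (?z t) $ 1 $ 2 - (1 + R (?z t) $ 2 $ 2)) \<longlongrightarrow> complex_of_real (- 1)) at_bot" by simp_all
  qed simp
  have rr0: "inv_ratio 0 \<noteq> 0" and v0: "v1 \<noteq> 0" using c1 by auto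
  \<comment> \<open>The squares determine \<open>v1\<close> and \<open>v2\<close> up to sign only;
    the determinant relation shows that the signs agree.\<close>
  have "- 2 * (inv_ratio 0 * v1) * v2 = 1" using det c1 c2 by (simp add: algebra_simps)
  moreover have "- 2 * (inv_ratio 0 * v1) * v1 = 1"
  proof -
    have "- 2 * (inv_ratio 0 * v1) * v1 = - 2 * (v1\<^sup>2 * inv_ratio 0)" by (simp add: power2_eq_square)
    then show ?thesis using c1 by simp
  qed
  ultimately have "- 2 * (inv_ratio 0 * v1) * v2 = - 2 * (inv_ratio 0 * v1) * v1" by simp
  then have "v2 = v1" using rr0 v0 by simp
  then show ?thesis using c1 c2 r1 r2 by (intro exI[of _ v1]) auto
qed

section \<open>Stokes multipliers and connection matrix\<close>

lemma N2_ratio_0: "2 * N2 0 * ratio 0 = - \<i> * c 1 / lam"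
proof -
  \<comment> \<open>The limit of the phase cancels in the product: this is why the result is
    insensitive to the integration constant in \<phi>.\<close>
  have "exp (- \<i> * \<kappa> * \<phi>\<^sub>0) * exp (\<i> * \<kappa> * \<phi>\<^sub>0) = 1" by (simp add: mult_exp_exp)
  moreover have "2 * N2 0 * ratio 0 = (\<kappa> * \<epsilon>) * (\<kappa> * \<epsilon>) * (exp (- \<i> * \<kappa> * \<phi>\<^sub>0) * exp (\<i> * \<kappa> * \<phi>\<^sub>0)) * (c 1 / (\<i> * lam))"
    by (simp add: N2_def ratio_def Q1_def)
  moreover have "complex_of_real (\<kappa> * \<epsilon>) * (\<kappa> * \<epsilon>) = 1" using eps kappa by auto
  ultimately have "2 * N2 0 * ratio 0 = c 1 / (\<i> * lam)" by simp
  also have "\<dots> = - \<i> * c 1 / lam" using lam by (simp add: field_simps)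
  finally show ?thesis .
qed

text \<open>The pair (0, \<kappa> / t4) of the recessive column is the same in every sector, so the
  multiplier that would add the dominant column to it vanishes. The other multiplier adds the
  recessive column to the dominant one and measures the jump of the Gaussian limit between opposite
  rays.\<close>

lemma data_values:
  assumes "monodromy_data \<epsilon> a b u \<phi> \<tau> s00 sinf0 sinf1 G"
  defines "Z \<equiv> \<i> * exp (- \<i> * \<kappa> * pi / 4) * J * c 1 / lam"
  shows "\<exists>v. v \<noteq> 0 \<and> s00 = 0 \<and>
    (\<kappa> = 1 \<longrightarrow> sinf1 = 0 \<and> sinf0 * (G$1$2)\<^sup>2 = Z \<and>
       G$1$1 = t4 * (1 + Z) / (2 * v) \<and> G$2$1 = t4 * (1 - Z) / (2 * v) \<and> G$1$2 = - v / t4 \<and> G$2$2 = v / t4) \<and>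
    (\<kappa> = - 1 \<longrightarrow> sinf0 = 0 \<and> sinf1 * (G$2$1)\<^sup>2 = - Z \<and>
       G$1$2 = t4 * (1 + Z) / (2 * v) \<and> G$2$2 = t4 * (1 - Z) / (2 * v) \<and> G$1$1 = v / t4 \<and> G$2$1 = - v / t4)"
proof -
  obtain q Y0 Y1 Y2 X0 X1 where q: "q\<^sup>2 = B_fun u \<phi> \<tau>"
    and Y0: "canonical_inf \<epsilon> a b u \<phi> \<tau> 0 Y0" and Y1: "canonical_inf \<epsilon> a b u \<phi> \<tau> 1 Y1"
    and Y2: "canonical_inf \<epsilon> a b u \<phi> \<tau> 2 Y2"
    and X0: "canonical_zero \<epsilon> a b u \<phi> \<tau> q 0 X0" and X1: "canonical_zero \<epsilon> a b u \<phi> \<tau> q 1 X1"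
    and S0: "\<And>\<zeta>. Y1 \<zeta> = Y0 \<zeta> ** mat2 1 0 sinf0 1"
    and S1: "\<And>\<zeta>. Y2 \<zeta> = Y1 \<zeta> ** mat2 1 sinf1 0 1"
    and SX: "\<And>\<zeta>. X1 \<zeta> = X0 \<zeta> ** mat2 1 s00 0 1"
    and G: "\<And>\<zeta>. Y0 \<zeta> = X0 \<zeta> ** G"
    using assms(1) unfolding monodromy_data_def by blast
  define \<eta> where "\<eta> = exp (- \<i> * \<kappa> * pi / 4)"
  \<comment> \<open>The second coordinate of the dominant column for the direction \<eta>; the
    opposite direction gives \<open>- K\<close>.\<close>
  define K where "K = - 2 * N2 0 * t4 * (\<eta> * J)"
  have \<eta>2: "\<eta>\<^sup>2 = - \<i> * \<kappa>"
  proof -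
    have "\<eta>\<^sup>2 = exp (- (\<i> * \<kappa> * (pi / 2)))" by (simp add: \<eta>_def ac_simps flip: exp_double)
    also have "\<dots> = - \<i> * \<kappa>" using kappa by (auto simp: exp_minus exp_i_pi_half)
    finally show ?thesis .
  qed
  have rr0: "inv_ratio 0 * ratio 0 = 1" using ratio_inv_ratio(1)[of 0] tau by (simp add: mult.commute)
  have KZ: "K = Z * t4 * inv_ratio 0"
  proof -
    have "K = - (2 * N2 0 * (inv_ratio 0 * ratio 0)) * (t4 * (\<eta> * J))" by (simp add: K_def rr0)
    also have "\<dots> = - (2 * N2 0 * ratio 0) * (inv_ratio 0 * t4 * (\<eta> * J))" by (simp only: ac_simps mult_minus_left mult_minus_right)
    also have "\<dots> = Z * t4 * inv_ratio 0" unfolding N2_ratio_0 by (simp add: Z_def \<eta>_def)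
    finally show ?thesis .
  qed
  obtain v where v: "v\<^sup>2 * inv_ratio 0 = - 1 / 2" "column_rep X0 1 v (inv_ratio 0 * v)" "column_rep X0 2 v (- inv_ratio 0 * v)"
    using data_at_zero[OF X0 q] by auto
  obtain v' where v': "column_rep X1 1 v' (inv_ratio 0 * v')" "column_rep X1 2 v' (- inv_ratio 0 * v')"
    using data_at_zero[OF X1 q] by auto
  have v0: "v \<noteq> 0" using v(1) by auto
  note X1v = column_rep_mult[OF v(2,3) SX]
  \<comment> \<open>The two columns at zero have the same first coordinate, both before and after
    the Stokes jump. Comparing the first columns identifies v' with v, and the second columns then
    leave no room for \<open>s00\<close>.\<close>
  have "v' = v" using column_rep_unique(1)[OF v'(1) X1v[of 1]] by simp
  moreover have "v' = v * s00 + v" using column_rep_unique(1)[OF v'(2) X1v[of 2]] by simp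
  ultimately have s00: "s00 = 0" using v0 by simp
  note Gv = column_rep_mult[OF v(2,3) G]
  have minus: "- 2 * N2 0 * t4 * (- \<eta> * J) = - K" by (simp add: K_def)
  have eplus: "exp (\<i> * of_real (- \<kappa> * pi / 4)) = \<eta>"
    by (simp add: \<eta>_def mult.assoc)
  have eminus: "exp (\<i> * of_real (pi - \<kappa> * pi / 4)) = - \<eta>"
  proof -
    have "\<i> * of_real (pi - \<kappa> * pi / 4) = \<i> * of_real pi + - \<i> * \<kappa> * pi / 4"
      by (simp add: algebra_simps)
    then show ?thesis unfolding \<eta>_def by (simp only: exp_add exp_pi_i' mult_minus1)
  qed
  have ray: "exp (\<i> * of_real (- \<kappa> * pi / 4)) ^ 2 = - \<i> * \<kappa>"
    "exp (\<i> * of_real (pi - \<kappa> * pi / 4)) ^ 2 = - \<i> * \<kappa>"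
    unfolding eplus eminus by (simp_all add: \<eta>2)
  show ?thesis
  proof (cases "\<kappa> = 1")
    case True
    have kc: "complex_of_real \<kappa> = 1" by (simp add: True)
    \<comment> \<open>The admissible rays have arguments -\<pi>/4 and 3\<pi>/4: the first lies in
      sector 0, the second in sectors 1 and 2. The jump therefore occurs between Y0 and Y1.\<close>
    have th: "- pi / 2 + pi * of_int 0 / 2 < - \<kappa> * pi / 4" "- \<kappa> * pi / 4 < pi / 2 + pi * of_int 0 / 2"
      "- pi / 2 + pi * of_int 1 / 2 < pi - \<kappa> * pi / 4" "pi - \<kappa> * pi / 4 < pi / 2 + pi * of_int 1 / 2"
      "- pi / 2 + pi * of_int 2 / 2 < pi - \<kappa> * pi / 4" "pi - \<kappa> * pi / 4 < pi / 2 + pi * of_int 2 / 2"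
      by (simp_all only: True of_int_0 of_int_1 of_int_numeral) (use pi_gt_zero in linarith)+
    have D0: "column_rep Y0 1 t4 K" "column_rep Y0 2 0 (1 / t4)"
      using data_at_infinity[OF Y0 th(1,2) ray(1)]
      unfolding if_P[OF True] eplus K_def[symmetric] kc by blast+
    have D1: "column_rep Y1 1 t4 (- K)" "column_rep Y1 2 0 (1 / t4)"
      using data_at_infinity[OF Y1 th(3,4) ray(2)]
      unfolding if_P[OF True] eminus minus kc by blast+
    have D2: "column_rep Y2 2 0 (1 / t4)"
      using data_at_infinity(2)[OF Y2 th(5,6) ray(2)]
      unfolding if_P[OF True] kc .
    note C = connection_columns[OF v(1) t4(1), of "G$1$1" "G$2$1" Z "G$1$2" "G$2$2" 1]
    have e: "v * G$1$1 + v * G$2$1 = t4" "inv_ratio 0 * v * G$1$1 + - inv_ratio 0 * v * G$2$1 = Z * t4 * inv_ratio 0"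
      "v * G$1$2 + v * G$2$2 = 0" "inv_ratio 0 * v * G$1$2 + - inv_ratio 0 * v * G$2$2 = 1 / t4"
      using column_rep_unique[OF D0(1) Gv[of 1]] column_rep_unique[OF D0(2) Gv[of 2]] unfolding KZ by simp_all
    note Gs = C[OF e]
    have "0 = t4 * sinf1 + 0"
      using column_rep_unique(1)[OF D2 column_rep_mult[OF D1 S1, of 2]] by simp
    then have s1: "sinf1 = 0" using t4(1) by simp
    have "- K = K + 1 / t4 * sinf0"
      using column_rep_unique(2)[OF D1(1) column_rep_mult[OF D0 S0, of 1]] by simp
    then have "sinf0 = - 2 * K * t4" using t4(1) by (simp add: field_simps eq_neg_iff_add_eq_0)
    then have "sinf0 * (G$1$2)\<^sup>2 = - 2 * (v\<^sup>2 * inv_ratio 0) * Z"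
      unfolding Gs(3) KZ using t4(1) by (simp add: power2_eq_square field_simps)
    then have "sinf0 * (G$1$2)\<^sup>2 = Z" unfolding v by simp
    moreover have "\<kappa> \<noteq> - 1" unfolding True by simp
    ultimately show ?thesis using v0 s00 s1 Gs by (intro exI[of _ v]) auto
  next
    case False
    then have km: "\<kappa> = - 1" using kappa by auto
    have kc: "complex_of_real \<kappa> = - 1" by (simp add: km)
    \<comment> \<open>Here the ray \<pi>/4 lies in sectors 0 and 1, while sector 2 contains the
      opposite ray 5\<pi>/4, so the jump occurs between Y1 and Y2.\<close>
    have th: "- pi / 2 + pi * of_int 0 / 2 < - \<kappa> * pi / 4" "- \<kappa> * pi / 4 < pi / 2 + pi * of_int 0 / 2"
      "- pi / 2 + pi * of_int 1 / 2 < - \<kappa> * pi / 4" "- \<kappa> * pi / 4 < pi / 2 + pi * of_int 1 / 2"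
      "- pi / 2 + pi * of_int 2 / 2 < pi - \<kappa> * pi / 4" "pi - \<kappa> * pi / 4 < pi / 2 + pi * of_int 2 / 2"
      by (simp_all only: km of_int_0 of_int_1 of_int_numeral) (use pi_gt_zero in linarith)+
    have D0: "column_rep Y0 2 t4 K" "column_rep Y0 1 0 (- 1 / t4)"
      using data_at_infinity[OF Y0 th(1,2) ray(1)]
      unfolding if_not_P[OF False] eplus K_def[symmetric] kc by blast+
    have D1: "column_rep Y1 2 t4 K" "column_rep Y1 1 0 (- 1 / t4)"
      using data_at_infinity[OF Y1 th(3,4) ray(1)]
      unfolding if_not_P[OF False] eplus K_def[symmetric] kc by blast+
    have D2: "column_rep Y2 2 t4 (- K)"
      using data_at_infinity(1)[OF Y2 th(5,6) ray(2)]
      unfolding if_not_P[OF False] eminus minus .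
    note C = connection_columns[OF v(1) t4(1), of "G$1$2" "G$2$2" Z "G$1$1" "G$2$1" "- 1"]
    have e: "v * G$1$2 + v * G$2$2 = t4" "inv_ratio 0 * v * G$1$2 + - inv_ratio 0 * v * G$2$2 = Z * t4 * inv_ratio 0"
      "v * G$1$1 + v * G$2$1 = 0" "inv_ratio 0 * v * G$1$1 + - inv_ratio 0 * v * G$2$1 = - 1 / t4"
      using column_rep_unique[OF D0(1) Gv[of 2]] column_rep_unique[OF D0(2) Gv[of 1]] unfolding KZ by simp_all
    note Gs = C[OF e]
    have "0 = t4 * sinf0"
      using column_rep_unique(1)[OF D1(2) column_rep_mult[OF D0(2,1) S0, of 1]] by simp
    then have s0: "sinf0 = 0" using t4(1) by simp
    have "- K = - 1 / t4 * sinf1 + K"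
      using column_rep_unique(2)[OF D2 column_rep_mult[OF D1(2,1) S1, of 2]] by simp
    then have "sinf1 = 2 * K * t4" using t4(1) by (simp add: field_simps)
    then have "sinf1 * (G$2$1)\<^sup>2 = 2 * (v\<^sup>2 * inv_ratio 0) * Z"
      unfolding Gs(4) KZ using t4(1) by (simp add: power2_eq_square field_simps)
    then have "sinf1 * (G$2$1)\<^sup>2 = - Z" unfolding v by simp
    then show ?thesis using v0 s00 s0 Gs False by (intro exI[of _ v]) auto
  qed
qed

end

theorem lemma5p1:
  fixes \<epsilon> b \<kappa> \<tau>\<^sub>0 \<tau> :: real
    and a X s00 sinf0 sinf1 :: complex
    and c :: "nat \<Rightarrow> complex"
    and u \<phi> :: "real \<Rightarrow> complex"
    and G :: "complex^2^2"
  assumes eps: "\<epsilon> \<in> {1, -1}"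
    and eb: "\<epsilon> * b > 0"
    and kappa: "\<kappa> \<in> {1, -1}"
    and a_eq: "a = of_real \<kappa> * \<i> / 2"
    and c0: "c 0 = 1"
    and c_rec: "\<And>m. m \<ge> 2 \<Longrightarrow>
      (of_nat m ^ 2 - 1) * c m =
        (\<Sum>k=0..m-2. (of_nat k + 2) * (of_nat m - 2 * (of_nat k + 1)) * c (k + 1) * c (m - k - 1))
        - 8 * of_real \<kappa> * of_real \<epsilon> * of_real b * \<i> *
          (\<Sum>k=0..m-2. \<Sum>l=0..k. c (m - k - 2) * c l * c (k - l))"
    and sol: "dp3_solution \<epsilon> a b \<tau>\<^sub>0 u"
    and expansion: "\<forall>\<^sub>F t in at_right 0. \<exists>w.
      (\<lambda>m. c m * of_real t ^ m) sums w \<and> u t = - (of_real b * of_real t / (2 * a)) * w"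
    and phase: "phase_of a b \<tau>\<^sub>0 u \<phi>"
    and tau: "0 < \<tau>" "\<tau> < \<tau>\<^sub>0"
    and data: "monodromy_data \<epsilon> a b u \<phi> \<tau> s00 sinf0 sinf1 G"
    and X_def: "X = of_real (sqrt pi) * c 1 / of_real (2 powr (3 / 2) * sqrt (\<epsilon> * b))"
  shows
    "(a = \<i> / 2 \<longrightarrow>
        s00 = 0 \<and> sinf1 = 0 \<and>
        sinf0 * (G$1$2)\<^sup>2 = X * exp (\<i> * pi / 4) \<and>
        G$2$2 = - G$1$2 \<and> G$2$2 \<noteq> 0 \<and>
        \<i> * G$1$2 * G$1$1 = - (\<i> / 2) * (1 + X * exp (\<i> * pi / 4)) \<and>
        \<i> * G$2$1 * G$2$2 = \<i> / 2 * (1 - X * exp (\<i> * pi / 4)) \<and>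
        G$1$1 * G$2$2 = 1 / 2 * (1 + X * exp (\<i> * pi / 4)) \<and>
        G$1$2 * G$2$1 = - (1 / 2) * (1 - X * exp (\<i> * pi / 4))) \<and>
     (a = - \<i> / 2 \<longrightarrow>
        s00 = 0 \<and> sinf0 = 0 \<and>
        sinf1 * (G$2$1)\<^sup>2 = X * exp (- \<i> * pi / 4) \<and>
        G$1$1 = - G$2$1 \<and> G$1$1 \<noteq> 0 \<and>
        \<i> * G$1$2 * G$1$1 = \<i> / 2 * (1 - X * exp (- \<i> * pi / 4)) \<and>
        \<i> * G$2$1 * G$2$2 = - (\<i> / 2) * (1 + X * exp (- \<i> * pi / 4)) \<and>
        G$1$1 * G$2$2 = 1 / 2 * (1 + X * exp (- \<i> * pi / 4)) \<and>
        G$1$2 * G$2$1 = - (1 / 2) * (1 - X * exp (- \<i> * pi / 4)))"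
proof -
  obtain u' u'' where u: "\<And>t. t \<in> {0<..<\<tau>\<^sub>0} \<Longrightarrow> u t \<noteq> 0 \<and>
        (u has_vector_derivative u' t) (at t) \<and> (u' has_vector_derivative u'' t) (at t) \<and>
        u'' t = (u' t)\<^sup>2 / u t - u' t / of_real t
                 + 1 / of_real t * (- 8 * of_real \<epsilon> * (u t)\<^sup>2 + 2 * a * of_real b)
                 + (of_real b)\<^sup>2 / u t"
    using sol unfolding dp3_solution_def by blast
  interpret regular_dp3 \<epsilon> b \<kappa> \<tau>\<^sub>0 \<tau> a c u u' u'' \<phi>
    using eps eb kappa a_eq c0 u expansion phase tau by unfold_locales blast+
  define Z where "Z = \<i> * exp (- \<i> * \<kappa> * pi / 4) * J * c 1 / lam"
  obtain v where v: "v \<noteq> 0" "s00 = 0"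
    and plus: "\<kappa> = 1 \<Longrightarrow> sinf1 = 0 \<and> sinf0 * (G$1$2)\<^sup>2 = Z \<and>
       G$1$1 = t4 * (1 + Z) / (2 * v) \<and> G$2$1 = t4 * (1 - Z) / (2 * v) \<and> G$1$2 = - v / t4 \<and> G$2$2 = v / t4"
    and minus: "\<kappa> = - 1 \<Longrightarrow> sinf0 = 0 \<and> sinf1 * (G$2$1)\<^sup>2 = - Z \<and>
       G$1$2 = t4 * (1 + Z) / (2 * v) \<and> G$2$2 = t4 * (1 - Z) / (2 * v) \<and> G$1$1 = v / t4 \<and> G$2$1 = - v / t4"
    using data_values[OF data] unfolding Z_def by blast
  have JX: "J * c 1 / lam = X"
  proof -
    have "(2 :: real) powr (3 / 2) = 2 * sqrt 2"
      using powr_add[of "2 :: real" 1 "1 / 2"] by (simp add: powr_half_sqrt)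
    then show ?thesis unfolding X_def J_def lam_def by simp
  qed
  have Zp: "Z = X * exp (\<i> * pi / 4)" if "\<kappa> = 1"
  proof -
    have "exp (\<i> * pi / 2) * exp (- \<i> * pi / 4) = exp (\<i> * pi / 4)"
      unfolding mult_exp_exp by (rule arg_cong[where f = exp]) (simp add: field_simps)
    then have "\<i> * exp (- \<i> * pi / 4) = exp (\<i> * pi / 4)" unfolding exp_i_pi_half .
    then show ?thesis unfolding Z_def JX[symmetric] using that by (simp add: mult.assoc[symmetric] mult.commute)
  qed
  \<comment> \<open>For \<open>\<kappa> = - 1\<close> the phase is i exp(i \<pi>/4) = - exp(- i
    \<pi>/4). This sign compensates the opposite sign of the recessive column in the formulas for
    \<open>G\<close> and \<open>sinf1\<close>.\<close>
  have Zm: "Z = - (X * exp (- \<i> * pi / 4))" if "\<kappa> = - 1"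
  proof -
    have "exp (\<i> * pi / 2) * exp (- \<i> * pi / 4) = exp (\<i> * pi / 4)"
      unfolding mult_exp_exp by (rule arg_cong[where f = exp]) (simp add: field_simps)
    then have "\<i> * exp (- \<i> * pi / 4) = exp (\<i> * pi / 4)" unfolding exp_i_pi_half .
    then have "\<i> * exp (\<i> * pi / 4) = - exp (- \<i> * pi / 4)" by (metis i_squared mult.assoc mult_minus1 power2_eq_square)
    then show ?thesis unfolding Z_def JX[symmetric] using that by (simp add: mult.assoc[symmetric] mult.commute)
  qed
  have kp: "\<kappa> = 1" if "a = \<i> / 2" using that a_eq kappa by (auto simp: field_simps complex_eq_iff)
  have km: "\<kappa> = - 1" if "a = - \<i> / 2" using that a_eq kappa by (auto simp: field_simps complex_eq_iff)
  show ?thesis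
  proof (intro conjI[of "_ \<longrightarrow> _"] impI)
    assume "a = \<i> / 2"
    from kp[OF this] have k: "\<kappa> = 1" .
    show "s00 = 0 \<and> sinf1 = 0 \<and>
        sinf0 * (G$1$2)\<^sup>2 = X * exp (\<i> * pi / 4) \<and>
        G$2$2 = - G$1$2 \<and> G$2$2 \<noteq> 0 \<and>
        \<i> * G$1$2 * G$1$1 = - (\<i> / 2) * (1 + X * exp (\<i> * pi / 4)) \<and>
        \<i> * G$2$1 * G$2$2 = \<i> / 2 * (1 - X * exp (\<i> * pi / 4)) \<and>
        G$1$1 * G$2$2 = 1 / 2 * (1 + X * exp (\<i> * pi / 4)) \<and>
        G$1$2 * G$2$1 = - (1 / 2) * (1 - X * exp (\<i> * pi / 4))"
    proof -
      have s: "sinf1 = 0" "sinf0 * (G$1$2)\<^sup>2 = Z" and g: "G$1$1 = t4 * (1 + Z) / (2 * v)"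
        "G$2$1 = t4 * (1 - Z) / (2 * v)" "G$1$2 = - v / t4" "G$2$2 = v / t4"
        using plus[OF k] by auto
      have "G$2$2 = - G$1$2 \<and> G$2$2 \<noteq> 0 \<and>
        \<i> * G$1$2 * G$1$1 = - (\<i> / 2) * (1 + Z) \<and> \<i> * G$2$1 * G$2$2 = \<i> / 2 * (1 - Z) \<and>
        G$1$1 * G$2$2 = 1 / 2 * (1 + Z) \<and> G$1$2 * G$2$1 = - (1 / 2) * (1 - Z)"
        unfolding g using v t4(1) by (simp add: field_simps)
      then show ?thesis unfolding Zp[OF k, symmetric] using s v(2) by blast
    qed
  next
    assume "a = - \<i> / 2"
    from km[OF this] have k: "\<kappa> = - 1" .
    have XZ: "X * exp (- \<i> * pi / 4) = - Z" using Zm[OF k] by simp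
    show "s00 = 0 \<and> sinf0 = 0 \<and>
        sinf1 * (G$2$1)\<^sup>2 = X * exp (- \<i> * pi / 4) \<and>
        G$1$1 = - G$2$1 \<and> G$1$1 \<noteq> 0 \<and>
        \<i> * G$1$2 * G$1$1 = \<i> / 2 * (1 - X * exp (- \<i> * pi / 4)) \<and>
        \<i> * G$2$1 * G$2$2 = - (\<i> / 2) * (1 + X * exp (- \<i> * pi / 4)) \<and>
        G$1$1 * G$2$2 = 1 / 2 * (1 + X * exp (- \<i> * pi / 4)) \<and>
        G$1$2 * G$2$1 = - (1 / 2) * (1 - X * exp (- \<i> * pi / 4))"
    proof -
      have s: "sinf0 = 0" "sinf1 * (G$2$1)\<^sup>2 = - Z" and g: "G$1$2 = t4 * (1 + Z) / (2 * v)"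
        "G$2$2 = t4 * (1 - Z) / (2 * v)" "G$1$1 = v / t4" "G$2$1 = - v / t4"
        using minus[OF k] by auto
      have "G$1$1 = - G$2$1 \<and> G$1$1 \<noteq> 0 \<and>
        \<i> * G$1$2 * G$1$1 = \<i> / 2 * (1 - - Z) \<and> \<i> * G$2$1 * G$2$2 = - (\<i> / 2) * (1 + - Z) \<and>
        G$1$1 * G$2$2 = 1 / 2 * (1 + - Z) \<and> G$1$2 * G$2$1 = - (1 / 2) * (1 - - Z)"
        unfolding g using v t4(1) by (simp add: field_simps)
      then show ?thesis unfolding XZ using s v(2) by blast
    qed
  qed
qed

end
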